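(* Let $X$ be one of the types $\mathsf{B}_n$, $\mathsf{C}_n$, $\mathsf{F}_4$, $\mathsf{G}_2$, let $p=3$ if $X=\mathsf{G}_2$ and $p=2$ otherwise, and let $K\subsetneq L$ be fields of characteristic $p$ with $L^p\subseteq K$. Then \[ T(K,L)=\bigl\langle \{h_r(t)\mid r\in\Phi_l,\ t\in K^\times\}\cup\{h_r(t)\mid r\in\Phi_s,\ t\in L^\times\}\bigr\rangle \] holds if and only if $X$ is of type $\mathsf{G}_2$, of type $\mathsf{F}_4$, or of type $\mathsf{B}_n$ with $n$ odd. In these cases, moreover, \[ X(K,L)=\bigl\langle \{u_r(s)\mid r\in\Phi_l,\ s\in K\}\cup\{u_r(t)\mid r\in\Phi_s,\ t\in L\}\bigr\rangle. \]
   Context: Let $\Phi$ be a root system of type $X$, with long roots $\Phi_l$ and short roots $\Phi_s$. Let $X(L)$ be the adjoint Chevalley group of type $X$ over $L$, generated by root elements $u_r(t)$ ($r\in\Phi$, $t\in L$). Put $n_r(t)=u_r(t)u_{-r}(-t^{-1})u_r(t)$ and $h_r(t)=n_r(t)n_r(-1)$ for $t\in L^\times$, and let $T(L)=\langle h_r(t)\mid r\in\Phi,t\in L^\times\rangle$ (the standard maximal split torus). For $h\in T(L)$ and $r\in\Phi$, $r(h)\in L^\times$ denotes the scalar with $h u_r(t)h^{-1}=u_r(r(h)t)$ for all $t$. Define $T(K,L)=\{h\in T(L)\mid r(h)\in K \text{ for all } r\in\Phi_l\}$ and the mixed group $X(K,L)=\langle T(K,L)\cup\{u_r(s)\mid r\in\Phi_l,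 s\in K\}\cup\{u_r(t)\mid r\in\Phi_s,t\in L\}\rangle$. *)

theory Defs
  imports Complex_Main "HOL-Algebra.Generated_Groups"
begin

type_synonym vec = "int list"
type_synonym idx = "vec + vec"  \<comment> \<open>Inl r: root vector e_r;  Inr a: Cartan basis vector h_a for a simple root a\<close>

datatype ctype = TB nat | TC nat | TF4 | TG2

fun dimv :: "ctype \<Rightarrow> nat" where
  "dimv (TB n) = n" | "dimv (TC n) = n" | "dimv TF4 = 4" | "dimv TG2 = 3"

fun valid_type :: "ctype \<Rightarrow> bool" where
  "valid_type (TB n) = (n \<ge> 2)" | "valid_type (TC n) = (n \<ge> 2)"
| "valid_type TF4 = True" | "valid_type TG2 = True"

fun charp :: "ctype \<Rightarrow> nat" where
  "charp TG2 = 3" | "charp (TB n) = 2" | "charp (TC n) = 2" | "charp TF4 = 2"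

definition unitv :: "nat \<Rightarrow> nat \<Rightarrow> vec" where
  "unitv m i = map (\<lambda>k. if k = i then 1 else 0) [0..<m]"
definition vadd :: "vec \<Rightarrow> vec \<Rightarrow> vec" where "vadd u v = map2 (+) u v"
definition vsmul :: "int \<Rightarrow> vec \<Rightarrow> vec" where "vsmul c u = map ((*) c) u"
definition vneg :: "vec \<Rightarrow> vec" where "vneg u = map uminus u"
definition ip :: "vec \<Rightarrow> vec \<Rightarrow> int" where "ip u v = sum_list (map2 (*) u v)"

text \<open>Standard realisations (F_4 scaled by 2 so that all coordinates are integers).\<close>
fun roots :: "ctype \<Rightarrow> vec set" where
  "roots (TB n) =
     {vsmul a (unitv n i) | a i. a \<in> {1,-1} \<and> i < n} \<union>
     {vadd (vsmul a (unitv n i)) (vsmul b (unitv n j)) | a b i j. a \<in> {1,-1} \<and> b \<in> {1,-1} \<and> i < j \<and> j < n}"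
| "roots (TC n) =
     {vsmul (2*a) (unitv n i) | a i. a \<in> {1,-1} \<and> i < n} \<union>
     {vadd (vsmul a (unitv n i)) (vsmul b (unitv n j)) | a b i j. a \<in> {1,-1} \<and> b \<in> {1,-1} \<and> i < j \<and> j < n}"
| "roots TF4 =
     {vsmul (2*a) (unitv 4 i) | a i. a \<in> {1,-1} \<and> i < 4} \<union>
     {vadd (vsmul (2*a) (unitv 4 i)) (vsmul (2*b) (unitv 4 j)) | a b i j. a \<in> {1,-1} \<and> b \<in> {1,-1} \<and> i < j \<and> j < 4} \<union>
     {v. length v = 4 \<and> set v \<subseteq> {1,-1}}"
| "roots TG2 =
     {vadd (unitv 3 i) (vneg (unitv 3 j)) | i j. i < 3 \<and> j < 3 \<and> i \<noteq> j} \<union>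
     {vsmul a (vadd (vsmul 2 (unitv 3 i)) (vneg (vadd (unitv 3 j) (unitv 3 k)))) | a i j k.
        a \<in> {1,-1} \<and> i < 3 \<and> j < 3 \<and> k < 3 \<and> i \<noteq> j \<and> i \<noteq> k \<and> j \<noteq> k}"

fun simple :: "ctype \<Rightarrow> vec set" where
  "simple (TB n) = {vadd (unitv n i) (vneg (unitv n (Suc i))) | i. Suc i < n} \<union> {unitv n (n - 1)}"
| "simple (TC n) = {vadd (unitv n i) (vneg (unitv n (Suc i))) | i. Suc i < n} \<union> {vsmul 2 (unitv n (n - 1))}"
| "simple TF4 = {[0,2,-2,0], [0,0,2,-2], [0,0,0,2], [1,-1,-1,-1]}"
| "simple TG2 = {[1,-1,0], [-2,1,1]}"

definition long_root :: "ctype \<Rightarrow> vec \<Rightarrow> bool" where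
  "long_root X r \<longleftrightarrow> r \<in> roots X \<and> (\<forall>s \<in> roots X. ip s s \<le> ip r r)"
definition short_root :: "ctype \<Rightarrow> vec \<Rightarrow> bool" where
  "short_root X r \<longleftrightarrow> r \<in> roots X \<and> \<not> long_root X r"

definition cint :: "vec \<Rightarrow> vec \<Rightarrow> int" where
  "cint s a = (2 * ip s a) div ip a a"

definition coc :: "ctype \<Rightarrow> vec \<Rightarrow> vec \<Rightarrow> int" where
  "coc X r = (THE c. (\<forall>a. a \<notin> simple X \<longrightarrow> c a = 0) \<and>
     (\<forall>k < dimv X. (\<Sum>a\<in>simple X. of_int (c a) * (2 * of_int (a ! k) / of_int (ip a a)))
                     = (2 * of_int (r ! k) / of_int (ip r r) :: rat)))"

definition strpos :: "ctype \<Rightarrow> vec \<Rightarrow> vec \<Rightarrow> nat" where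
  "strpos X r s = (GREATEST p. vadd s (vsmul (- int p) r) \<in> roots X)"

definition basis :: "ctype \<Rightarrow> idx set" where
  "basis X = Inl ` roots X \<union> Inr ` simple X"

definition delta :: "idx \<Rightarrow> idx \<Rightarrow> int" where
  "delta x = (\<lambda>y. if y = x then 1 else 0)"

text \<open>Bracket of two basis elements, as integer coordinate vector; N are the structure constants.\<close>
fun brb :: "ctype \<Rightarrow> (vec \<Rightarrow> vec \<Rightarrow> int) \<Rightarrow> idx \<Rightarrow> idx \<Rightarrow> idx \<Rightarrow> int" where
  "brb X N (Inr a) (Inr b) = (\<lambda>y. 0)"
| "brb X N (Inr a) (Inl s) = (\<lambda>y. cint s a * delta (Inl s) y)"
| "brb X N (Inl s) (Inr a) = (\<lambda>y. - cint s a * delta (Inl s) y)"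
| "brb X N (Inl r) (Inl s) =
    (if s = vneg r then (\<lambda>y. case y of Inr a \<Rightarrow> coc X r a | Inl _ \<Rightarrow> 0)
     else if vadd r s \<in> roots X then (\<lambda>y. N r s * delta (Inl (vadd r s)) y)
     else (\<lambda>y. 0))"

definition brk :: "ctype \<Rightarrow> (vec \<Rightarrow> vec \<Rightarrow> int) \<Rightarrow> (idx \<Rightarrow> int) \<Rightarrow> (idx \<Rightarrow> int) \<Rightarrow> idx \<Rightarrow> int" where
  "brk X N u v = (\<lambda>y. \<Sum>x\<in>basis X. \<Sum>z\<in>basis X. u x * v z * brb X N x z y)"

definition chevalley_basis :: "ctype \<Rightarrow> (vec \<Rightarrow> vec \<Rightarrow> int) \<Rightarrow> bool" where
  "chevalley_basis X N \<longleftrightarrow>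
     (\<forall>x\<in>basis X. \<forall>y\<in>basis X. brb X N x y = (\<lambda>i. - brb X N y x i)) \<and>
     (\<forall>r\<in>roots X. \<forall>s\<in>roots X. vadd r s \<in> roots X \<longrightarrow>
         N r s = int (strpos X r s) + 1 \<or> N r s = - (int (strpos X r s) + 1)) \<and>
     (\<forall>x\<in>basis X. \<forall>y\<in>basis X. \<forall>z\<in>basis X.
         (\<lambda>i. brk X N (delta x) (brk X N (delta y) (delta z)) i
            + brk X N (delta y) (brk X N (delta z) (delta x)) i
            + brk X N (delta z) (brk X N (delta x) (delta y)) i) = (\<lambda>i. 0))"

definition imul :: "ctype \<Rightarrow> (idx \<Rightarrow> idx \<Rightarrow> int) \<Rightarrow> (idx \<Rightarrow> idx \<Rightarrow> int) \<Rightarrow> idx \<Rightarrow> idx \<Rightarrow> int" where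
  "imul X A B = (\<lambda>i j. \<Sum>k\<in>basis X. A i k * B k j)"

fun ipow :: "ctype \<Rightarrow> (idx \<Rightarrow> idx \<Rightarrow> int) \<Rightarrow> nat \<Rightarrow> idx \<Rightarrow> idx \<Rightarrow> int" where
  "ipow X A 0 = (\<lambda>i j. if i = j \<and> i \<in> basis X then 1 else 0)"
| "ipow X A (Suc k) = imul X A (ipow X A k)"

text \<open>Matrix of ad e_r with respect to the Chevalley basis (column j = image of basis vector j).\<close>
definition adm :: "ctype \<Rightarrow> (vec \<Rightarrow> vec \<Rightarrow> int) \<Rightarrow> vec \<Rightarrow> idx \<Rightarrow> idx \<Rightarrow> int" where
  "adm X N r = (\<lambda>i j. if i \<in> basis X \<and> j \<in> basis X then brb X N (Inl r) j i else 0)"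

text \<open>Divided powers (ad e_r)^k / k! (integral for a Chevalley basis).\<close>
definition divpow :: "ctype \<Rightarrow> (vec \<Rightarrow> vec \<Rightarrow> int) \<Rightarrow> vec \<Rightarrow> nat \<Rightarrow> idx \<Rightarrow> idx \<Rightarrow> int" where
  "divpow X N r k = (\<lambda>i j. ipow X (adm X N r) k i j div int (fact k))"

text \<open>Root element u_r(t) = exp(t ad e_r) acting on the Lie algebra over the field.\<close>
definition ur :: "ctype \<Rightarrow> (vec \<Rightarrow> vec \<Rightarrow> int) \<Rightarrow> vec \<Rightarrow> 'a::field \<Rightarrow> idx \<Rightarrow> idx \<Rightarrow> 'a" where
  "ur X N r t = (\<lambda>i j. \<Sum>k\<le>card (basis X). t ^ k * of_int (divpow X N r k i j))"

definition matmon :: "ctype \<Rightarrow> (idx \<Rightarrow> idx \<Rightarrow> 'a::field) monoid" where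
  "matmon X = \<lparr> carrier = {M. \<forall>i j. M i j \<noteq> 0 \<longrightarrow> i \<in> basis X \<and> j \<in> basis X},
                mult = (\<lambda>M M' i j. \<Sum>k\<in>basis X. M i k * M' k j),
                one = (\<lambda>i j. if i = j \<and> i \<in> basis X then 1 else 0) \<rparr>"

definition GLie :: "ctype \<Rightarrow> (idx \<Rightarrow> idx \<Rightarrow> 'a::field) monoid" where
  "GLie X = units_of (matmon X)"

definition nr :: "ctype \<Rightarrow> (vec \<Rightarrow> vec \<Rightarrow> int) \<Rightarrow> vec \<Rightarrow> 'a::field \<Rightarrow> idx \<Rightarrow> idx \<Rightarrow> 'a" where
  "nr X N r t = ur X N r t \<otimes>\<^bsub>GLie X\<^esub> ur X N (vneg r) (- inverse t) \<otimes>\<^bsub>GLie X\<^esub> ur X N r t"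

definition hr :: "ctype \<Rightarrow> (vec \<Rightarrow> vec \<Rightarrow> int) \<Rightarrow> vec \<Rightarrow> 'a::field \<Rightarrow> idx \<Rightarrow> idx \<Rightarrow> 'a" where
  "hr X N r t = nr X N r t \<otimes>\<^bsub>GLie X\<^esub> nr X N r (-1)"

definition torus :: "ctype \<Rightarrow> (vec \<Rightarrow> vec \<Rightarrow> int) \<Rightarrow> (idx \<Rightarrow> idx \<Rightarrow> 'a::field) set" where
  "torus X N = generate (GLie X) {hr X N r t | r t. r \<in> roots X \<and> t \<noteq> 0}"

definition rootval :: "ctype \<Rightarrow> (vec \<Rightarrow> vec \<Rightarrow> int) \<Rightarrow> vec \<Rightarrow> (idx \<Rightarrow> idx \<Rightarrow> 'a::field) \<Rightarrow> 'a" where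
  "rootval X N r h = (THE c. \<forall>t. h \<otimes>\<^bsub>GLie X\<^esub> ur X N r t \<otimes>\<^bsub>GLie X\<^esub> inv\<^bsub>GLie X\<^esub> h = ur X N r (c * t))"

definition TKL :: "ctype \<Rightarrow> (vec \<Rightarrow> vec \<Rightarrow> int) \<Rightarrow> 'a::field set \<Rightarrow> (idx \<Rightarrow> idx \<Rightarrow> 'a) set" where
  "TKL X N K = {h \<in> torus X N. \<forall>r. long_root X r \<longrightarrow> rootval X N r h \<in> K}"

definition XKL :: "ctype \<Rightarrow> (vec \<Rightarrow> vec \<Rightarrow> int) \<Rightarrow> 'a::field set \<Rightarrow> (idx \<Rightarrow> idx \<Rightarrow> 'a) set" where
  "XKL X N K = generate (GLie X)
     (TKL X N K \<union> {ur X N r s | r s. long_root X r \<and> s \<in> K} \<union> {ur X N r t | r t. short_root X r})"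

definition subfield :: "'a::field set \<Rightarrow> bool" where
  "subfield K \<longleftrightarrow> 0 \<in> K \<and> 1 \<in> K \<and> (\<forall>x\<in>K. \<forall>y\<in>K. x + y \<in> K \<and> x * y \<in> K) \<and>
     (\<forall>x\<in>K. - x \<in> K \<and> inverse x \<in> K)"

end

(* In the basis of e_r and h_a the torus is diagonal: splitting the Lie algebra into r-strings and
   the block spanned by e_r, e_{-r} and the h_a, the Jacobi identity turns every string of length
   q + 1 into the q-th symmetric power of the natural sl_2-module up to signs, and q <= 3 reduces
   h_r(t) = (e_s |-> t^<s,r> e_s) to polynomial identities.  A torus element is therefore given by
   units u_a, one for each simple coroot, and it lies in T(K,L) iff its values on long roots lie in K.
   For short r the numbers <s,r> with s long are divisible by p, so modulo K only the u_a with a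
   long matter.  For G_2, F_4 and B_n with n odd the long values force these u_a into K.  For B_n
   with n even the cocharacter e_0 + ... + e_{n-1} of the coroot lattice gives an element of T(K,L)
   whose values on short roots lie outside K, whereas all generators have them in K.  For C_n the
   coroot of 2 e_0 works: the product of the values at the 2 e_i, a square of an element of K for
   all generators, is x^2 for it. *)

theory Submission
  imports Defs
begin

section \<open>Root strings\<close>

text \<open>As L^p lies in K, the units of L modulo those of K form a vector space over the field
  with p elements. A long root, written in simple roots, has coefficients divisible by p at the
  short ones, so the condition defining T(K,L) says that the classes of the u_a, a long and simple,
  are killed by the Cartan matrix of the long simple roots modulo p. This subsystem is A_1 for G_2
  and C_n, A_2 for F_4 and A_(n-1) for B_n, with determinants 2, 2, 3 and n: invertible modulo p
  precisely in the listed cases. The obstacle lies before this count. The structure constants are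
  known only through the axioms of a Chevalley basis, and h_r(t) is a product of six truncated
  exponentials, so its diagonal form must be extracted with unknown signs. Moreover, the matrices
  are never organised into a group: \<open>generate\<close> and \<open>m_inv\<close> are used
  directly, and inverses are computed by hand.\<close>

lemma ip_conv_sum: "length u = d \<Longrightarrow> length v = d \<Longrightarrow> ip u v = (\<Sum>k<d. u ! k * v ! k)"
  unfolding ip_def by (simp add: sum_list_sum_nth atLeast0LessThan)

lemma length_vadd [simp]: "length (vadd u v) = min (length u) (length v)"
  and length_vsmul [simp]: "length (vsmul c u) = length u"
  and length_vneg [simp]: "length (vneg u) = length u"
  and length_unitv [simp]: "length (unitv n i) = n"
  by (auto simp: vadd_def vsmul_def vneg_def unitv_def)

lemma nth_vadd [simp]: "k < length u \<Longrightarrow> k < length v \<Longrightarrow> vadd u v ! k = u ! k + v ! k"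
  and nth_vsmul [simp]: "k < length u \<Longrightarrow> vsmul c u ! k = c * u ! k"
  and nth_vneg [simp]: "k < length u \<Longrightarrow> vneg u ! k = - u ! k"
  and nth_unitv [simp]: "k < n \<Longrightarrow> unitv n i ! k = (if k = i then 1 else 0)"
  by (auto simp: vadd_def vsmul_def vneg_def unitv_def)

lemma ip_commute: "length u = length v \<Longrightarrow> ip u v = ip v u"
  by (simp add: ip_conv_sum mult.commute)

lemma ip_vadd_left: "length u = length w \<Longrightarrow> length v = length w \<Longrightarrow> ip (vadd u v) w = ip u w + ip v w"
  and ip_vadd_right: "length u = length w \<Longrightarrow> length v = length w \<Longrightarrow> ip w (vadd u v) = ip w u + ip w v"
  and ip_vsmul_left: "length u = length w \<Longrightarrow> ip (vsmul c u) w = c * ip u w"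
  and ip_vsmul_right: "length u = length w \<Longrightarrow> ip w (vsmul c u) = c * ip w u"
  and ip_vneg_left: "length u = length w \<Longrightarrow> ip (vneg u) w = - ip u w"
  and ip_vneg_right: "length u = length w \<Longrightarrow> ip w (vneg u) = - ip w u"
  by (simp_all add: ip_conv_sum algebra_simps sum.distrib sum_distrib_left sum_negf)

lemmas ip_linear = ip_vadd_left ip_vadd_right ip_vsmul_left ip_vsmul_right ip_vneg_left ip_vneg_right

lemma ip_self_nonneg: "0 \<le> ip u u"
  by (simp add: ip_conv_sum[OF refl refl] sum_nonneg)

lemma ip_self_eq_0: "ip u u = 0 \<longleftrightarrow> (\<forall>k<length u. u ! k = 0)"
  by (subst ip_conv_sum[OF refl refl], subst sum_nonneg_eq_0_iff) auto

lemma vneg_vneg [simp]: "vneg (vneg u) = u"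
  by (auto intro!: nth_equalityI)

lemma vadd_commute: "vadd u v = vadd v u"
  by (auto intro!: nth_equalityI)

lemma vadd_vsmul_add: "vadd (vadd s (vsmul i r)) (vsmul j r) = vadd s (vsmul (i + j) r)"
  by (auto intro!: nth_equalityI simp: algebra_simps)

lemma vadd_vsmul_1: "vadd (vadd s (vsmul i r)) r = vadd s (vsmul (i + 1) r)"
  by (auto intro!: nth_equalityI simp: algebra_simps)

lemma vadd_vsmul_neg1: "vadd s (vneg r) = vadd s (vsmul (- 1) r)"
  by (auto intro!: nth_equalityI)

lemma vadd_vsmul_0 [simp]: "length s = length r \<Longrightarrow> vadd s (vsmul 0 r) = s"
  by (auto intro!: nth_equalityI)

lemma vadd_vsmul_inject:
  assumes "length s = length r" "ip r r > 0"
  shows "vadd s (vsmul i r) = vadd s (vsmul j r) \<longleftrightarrow> i = j"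
proof
  assume h: "vadd s (vsmul i r) = vadd s (vsmul j r)"
  have "i * r ! k = j * r ! k" if "k < length r" for k
    using arg_cong[OF h, of "\<lambda>v. v ! k"] assms that by simp
  moreover have "ip r r \<noteq> 0" using assms by simp
  ultimately show "i = j" unfolding ip_self_eq_0 by auto
qed auto

text \<open>\<open>p\<close> is both the ratio of the squared lengths and the characteristic;
  \<open>m\<close> is the squared length of a short root (1 for B_n, 2 for C_n and G_2, 4 for F_4 in
  doubled coordinates). \<open>coroot_exists\<close> and \<open>simple_dual\<close> provide
  existence and uniqueness for the description that defines \<open>coc\<close>.\<close>

locale rootdata =
  fixes X :: ctype and p m :: int
  assumes p_cases: "p = 2 \<or> p = 3" and m_pos: "m > 0"
    and charp_eq: "int (charp X) = p"
    and fin_roots: "finite (roots X)"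
    and len: "r \<in> roots X \<Longrightarrow> length r = dimv X"
    and norm_cases: "r \<in> roots X \<Longrightarrow> ip r r = m \<or> ip r r = p * m"
    and integral: "r \<in> roots X \<Longrightarrow> s \<in> roots X \<Longrightarrow> ip r r dvd 2 * ip s r"
    and reflect: "r \<in> roots X \<Longrightarrow> s \<in> roots X \<Longrightarrow> vadd s (vsmul (- cint s r) r) \<in> roots X"
    and long_exists: "\<exists>r\<in>roots X. ip r r = p * m"
    and fin_simple: "finite (simple X)" and simple_roots: "simple X \<subseteq> roots X"
    and coroot_exists: "r \<in> roots X \<Longrightarrow> \<exists>c :: vec \<Rightarrow> int. \<forall>k<dimv X.
       (\<Sum>a\<in>simple X. of_int (c a) * (2 * of_int (a ! k) / of_int (ip a a)))
         = (2 * of_int (r ! k) / of_int (ip r r) :: rat)"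
    and simple_dual: "a \<in> simple X \<Longrightarrow> \<exists>w. length w = dimv X \<and> ip a w \<noteq> 0 \<and> (\<forall>b\<in>simple X. b \<noteq> a \<longrightarrow> ip b w = 0)"
begin

abbreviation R where "R \<equiv> roots X"

section \<open>Cartan integers and the r-string through a root\<close>

lemma p_pos: "p > 0" using p_cases by auto

lemma norm_pos: "r \<in> R \<Longrightarrow> ip r r > 0"
  using norm_cases[of r] m_pos p_pos by auto

lemma cint_mult: "r \<in> R \<Longrightarrow> s \<in> R \<Longrightarrow> cint s r * ip r r = 2 * ip s r"
  unfolding cint_def using integral by simp

lemma cintI: "r \<in> R \<Longrightarrow> 2 * ip s r = c * ip r r \<Longrightarrow> cint s r = c"
  unfolding cint_def using norm_pos[of r] by simp

lemma cint_self: "r \<in> R \<Longrightarrow> cint r r = 2"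
  by (rule cintI) auto

lemma cint_line:
  assumes "r \<in> R" "a \<in> R" "s \<in> R"
  shows "cint (vadd s (vsmul i r)) a = cint s a + i * cint r a"
proof (rule cintI)
  show "2 * ip (vadd s (vsmul i r)) a = (cint s a + i * cint r a) * ip a a"
    using cint_mult[OF assms(2,3)] cint_mult[OF assms(2,1)] assms
    by (simp add: ip_linear len algebra_simps)
qed (use assms in auto)

lemma cint_vadd: 
  assumes "r \<in> R" "a \<in> R" "s \<in> R" shows "cint (vadd s r) a = cint s a + cint r a"
  using cint_line[OF assms, of 1] assms
  by (metis (no_types, lifting) len mult_1 vadd_vsmul_0 vadd_vsmul_1 add_0)

lemma vneg_root: "r \<in> R \<Longrightarrow> vneg r \<in> R"
proof -
  assume r: "r \<in> R"
  have "vadd r (vsmul (- 2) r) = vneg r" by (auto intro!: nth_equalityI)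
  then show ?thesis using reflect[OF r r] r by (simp add: cint_self)
qed

lemma cint_neg_left: "r \<in> R \<Longrightarrow> s \<in> R \<Longrightarrow> cint (vneg s) r = - cint s r"
  using cint_mult[of r s] by (intro cintI) (auto simp: ip_linear len)

lemma vneg_neq: "r \<in> R \<Longrightarrow> vneg r \<noteq> r"
  using cint_neg_left[of r r] cint_self[of r] by auto

lemma eq_vneg_iff: "length s = length r \<Longrightarrow> s = vneg r \<longleftrightarrow> (\<forall>k<length r. s ! k + r ! k = 0)"
  by (auto simp: list_eq_iff_nth_eq add_eq_0_iff2)

text \<open>Both Cartan integers are negative. If one of them is -1, a reflection produces s + r; if
  both are at most -2, the norm of s + r is at most 0, which leaves only s = -r.\<close>

lemma add_root:
  assumes r: "r \<in> R" and s: "s \<in> R" and neg: "ip s r < 0" and ne: "s \<noteq> vneg r"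
  shows "vadd s r \<in> R"
proof -
  have lens: "length s = dimv X" "length r = dimv X" using r s len by auto
  have n: "cint s r * ip r r = 2 * ip s r" "cint r s * ip s s = 2 * ip s r"
    using cint_mult r s ip_commute[of r s] lens by auto
  have np: "ip r r > 0" "ip s s > 0" using norm_pos r s by auto
  have "cint s r < 0" "cint r s < 0" using n np neg
    by (metis mult_less_0_iff not_less_iff_gr_or_eq zero_less_numeral)+
  then consider "cint s r = -1" | "cint r s = -1" | "cint s r \<le> -2" "cint r s \<le> -2" by linarith
  then show ?thesis
  proof cases
    case 1
    have "vadd s (vsmul 1 r) = vadd s r" by (auto intro!: nth_equalityI)
    then show ?thesis using reflect[OF r s] 1 by simp
  next
    case 2
    have "vadd r (vsmul 1 s) = vadd s r" by (auto intro!: nth_equalityI)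
    then show ?thesis using reflect[OF s r] 2 by simp
  next
    case 3
    have "ip (vadd s r) (vadd s r) = ip s s + ip r r + 2 * ip s r"
      using lens ip_commute[of r s] by (simp add: ip_linear)
    moreover have "2 * ip s r \<le> - 2 * ip r r" "2 * ip s r \<le> - 2 * ip s s"
      using 3 n np mult_right_mono[of "cint s r" "-2" "ip r r"] mult_right_mono[of "cint r s" "-2" "ip s s"] by auto
    ultimately have "ip (vadd s r) (vadd s r) \<le> 0" by linarith
    then have "ip (vadd s r) (vadd s r) = 0" using ip_self_nonneg by (metis antisym)
    then have "\<forall>k<length r. s ! k + r ! k = 0" unfolding ip_self_eq_0 using lens by auto
    then have "s = vneg r" using eq_vneg_iff lens by simp
    then show ?thesis using ne by simp
  qed
qed

text \<open>Only the norms m and p m occur, so c^2 is 1, p or 1/p; the last two are impossible for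
  an integer c, the prime p being neither a square nor a unit.\<close>

lemma multiple_root:
  assumes r: "r \<in> R" and c: "vsmul c r \<in> R" shows "c = 1 \<or> c = -1"
proof -
  have "ip (vsmul c r) (vsmul c r) = c * c * ip r r" by (simp add: ip_linear)
  moreover define n where "n = c * c"
  ultimately have "n * ip r r = m \<or> n * ip r r = p * m" using norm_cases[OF c] by simp
  then have "n * m = 1 * m \<or> n * m = p * m \<or> (n * p) * m = 1 * m \<or> (n * p) * m = p * m"
    using norm_cases[OF r] by (metis mult.assoc mult_1)
  then have "c * c = 1 \<or> c * c = p \<or> c * c * p = 1 \<or> c * c * p = p"
    unfolding n_def mult_cancel_right using m_pos by blast
  then have "c * c = 1 \<or> c * c = p \<or> c * c * p = 1" using p_pos by auto
  moreover have "c * c \<noteq> p"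
  proof
    assume h: "c * c = p"
    then obtain x where x: "x * x = p" "0 \<le> x" by (metis abs_ge_zero abs_mult_self_eq)
    have "x = 0 \<or> x = 1 \<or> 2 \<le> x" using x(2) by linarith
    then have "x = 0 \<or> x = 1 \<or> 2 * 2 \<le> x * x" using mult_mono[of 2 x 2 x] by auto
    then show False using x p_cases by auto
  qed
  moreover have "c * c * p \<noteq> 1"
  proof
    assume "c * c * p = 1"
    then have "p dvd 1" by (metis dvd_triv_right)
    then show False using p_cases by auto
  qed
  ultimately have "c * c = 1" by auto
  then show ?thesis by (simp add: square_eq_1_iff)
qed

text \<open>A line in direction r that meets a multiple of r consists of multiples of r, so s itself
  would be one, hence r or -r.\<close>

lemma line_neq:
  assumes "r \<in> R" "s \<in> R" "s \<noteq> r" "s \<noteq> vneg r" "vadd s (vsmul i r) \<in> R"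
  shows "vadd s (vsmul i r) \<noteq> r" "vadd s (vsmul i r) \<noteq> vneg r"
proof -
  have lens: "length s = dimv X" "length r = dimv X" using assms len by auto
  have False if h: "vadd s (vsmul i r) = vsmul j r" for j
  proof -
    have "s ! k = (j - i) * r ! k" if "k < length r" for k
      using arg_cong[OF h, of "\<lambda>v. v ! k"] that lens by (auto simp: algebra_simps)
    then have s: "s = vsmul (j - i) r" using lens by (auto intro!: nth_equalityI)
    then have "vsmul (j - i) r \<in> R" using assms by simp
    then have "j - i = 1 \<or> j - i = -1" using multiple_root assms by blast
    moreover have "vsmul 1 r = r" "vsmul (-1) r = vneg r" by (auto intro!: nth_equalityI)
    ultimately show False using s assms by auto
  qed
  moreover have "vsmul 1 r = r" "vsmul (-1) r = vneg r" by (auto intro!: nth_equalityI)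
  ultimately show "vadd s (vsmul i r) \<noteq> r" "vadd s (vsmul i r) \<noteq> vneg r" by metis+
qed

text \<open>At the last root before a gap the inner product with r cannot be negative, and at the
  first root after the gap it cannot be positive, both by \<open>add_root\<close>; yet it grows
  strictly along the line.\<close>

lemma string_convex:
  assumes r: "r \<in> R" and s: "s \<in> R" "s \<noteq> r" "s \<noteq> vneg r"
    and i: "vadd s (vsmul i r) \<in> R" and j: "vadd s (vsmul j r) \<in> R" and k: "i \<le> k" "k \<le> j"
  shows "vadd s (vsmul k r) \<in> R"
proof (rule ccontr)
  assume nk: "vadd s (vsmul k r) \<notin> R"
  have lens: "length s = dimv X" "length r = dimv X" using r s len by auto
  let ?P = "\<lambda>l. vadd s (vsmul l r) \<in> R"
  have ipl: "ip (vadd s (vsmul l r)) r = ip s r + l * ip r r" for l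
    using lens by (simp add: ip_linear)
  define a where "a = (GREATEST n::nat. ?P (i + int n) \<and> i + int n \<le> k)"
  have a: "?P (i + int a) \<and> i + int a \<le> k"
    unfolding a_def by (rule GreatestI_nat[of _ 0 "nat (k - i)"]) (use i k in auto)
  have a': "\<not> ?P (i + int a + 1)"
  proof
    assume "?P (i + int a + 1)"
    moreover have "i + int a \<noteq> k" using a nk by auto
    ultimately have "?P (i + int (Suc a)) \<and> i + int (Suc a) \<le> k" using a by (auto simp: algebra_simps)
    then have "Suc a \<le> a" unfolding a_def by (intro Greatest_le_nat[of _ _ "nat (k - i)"]) auto
    then show False by simp
  qed
  define b where "b = (GREATEST n::nat. ?P (j - int n) \<and> j - int n \<ge> k)"
  have b: "?P (j - int b) \<and> j - int b \<ge> k"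
    unfolding b_def by (rule GreatestI_nat[of _ 0 "nat (j - k)"]) (use j k in auto)
  have b': "\<not> ?P (j - int b - 1)"
  proof
    assume "?P (j - int b - 1)"
    moreover have "j - int b \<noteq> k" using b nk by auto
    ultimately have "?P (j - int (Suc b)) \<and> j - int (Suc b) \<ge> k" using b by (auto simp: algebra_simps)
    then have "Suc b \<le> b" unfolding b_def by (intro Greatest_le_nat[of _ _ "nat (j - k)"]) auto
    then show False by simp
  qed
  have "ip (vadd s (vsmul (i + int a) r)) r \<ge> 0"
    using add_root[of r "vadd s (vsmul (i + int a) r)"] a a' r line_neq[OF r s] 
    by (auto simp: vadd_vsmul_1 not_le[symmetric])
  moreover have "ip (vadd s (vsmul (j - int b) r)) r \<le> 0"
  proof (rule ccontr)
    assume h: "\<not> ?thesis"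
    then have "ip (vadd s (vsmul (j - int b) r)) (vneg r) < 0" using lens by (simp add: ip_linear)
    then have "vadd (vadd s (vsmul (j - int b) r)) (vneg r) \<in> R"
      using add_root[of "vneg r" "vadd s (vsmul (j - int b) r)"] b r line_neq[OF r s] vneg_root
      by auto
    then show False using b' by (simp add: vadd_vsmul_neg1 vadd_vsmul_add)
  qed
  moreover have "i + int a < j - int b" using a b nk by (metis order_le_less_trans order_less_le)
  moreover from this have "(i + int a) * ip r r < (j - int b) * ip r r"
    using norm_pos[OF r] by (intro mult_strict_right_mono)
  ultimately show False unfolding ipl by linarith
qed

lemma string_reflect:
  assumes r: "r \<in> R" and s: "s \<in> R" and i: "vadd s (vsmul i r) \<in> R"
  shows "vadd s (vsmul (- i - cint s r) r) \<in> R"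
  using reflect[OF r i] r s
  by (simp add: cint_line cint_self vadd_vsmul_add algebra_simps)

text \<open>\<open>s0\<close> is the bottom of the string. Reflection in r keeps the bottom and the
  top inside the string, and the two resulting inequalities pin down <s0,r> = -q.\<close>

lemma string:
  assumes r: "r \<in> R" and s: "s \<in> R" "s \<noteq> r" "s \<noteq> vneg r"
  obtains s0 q i where "s = vadd s0 (vsmul (int i) r)" "i \<le> q" "s0 \<in> R" "s0 \<noteq> r" "s0 \<noteq> vneg r"
    "\<And>j. vadd s0 (vsmul j r) \<in> R \<longleftrightarrow> 0 \<le> j \<and> j \<le> int q" "q \<le> 3" "cint s0 r = - int q"
proof -
  have lens: "length s = dimv X" "length r = dimv X" using r s len by auto
  let ?P = "\<lambda>l. vadd s (vsmul l r) \<in> R"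
  have "inj (\<lambda>l. vadd s (vsmul l r))"
    by (rule injI) (use vadd_vsmul_inject[of s r] lens norm_pos[OF r] in auto)
  from finite_vimageI[OF fin_roots this] have fin: "finite {l. ?P l}" by (simp add: vimage_def)
  have P0: "?P 0" using s lens by simp
  define lo where "lo = Min {l. ?P l}" define hi where "hi = Max {l. ?P l}"
  have nonempty: "{l. ?P l} \<noteq> {}" using P0 by blast
  have lo_hi: "lo \<le> l \<and> l \<le> hi" if "?P l" for l
    unfolding lo_def hi_def using that fin by (blast intro: Min_le Max_ge)
  have lo: "?P lo" "lo \<le> 0" using Min_in[OF fin nonempty] lo_hi[OF P0] unfolding lo_def[symmetric] by blast+
  have hi: "?P hi" "0 \<le> hi" using Max_in[OF fin nonempty] lo_hi[OF P0] unfolding hi_def[symmetric] by blast+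
  have iff: "?P l \<longleftrightarrow> lo \<le> l \<and> l \<le> hi" for l
    using string_convex[OF r s lo(1) hi(1)] lo_hi by blast
  define s0 where "s0 = vadd s (vsmul lo r)"
  define q where "q = nat (hi - lo)"
  have q: "int q = hi - lo" using lo hi q_def by simp
  have s0: "s0 \<in> R" using lo s0_def by simp
  have ne: "s0 \<noteq> r" "s0 \<noteq> vneg r" using line_neq[OF r s lo(1)] s0_def by auto
  have iff0: "vadd s0 (vsmul j r) \<in> R \<longleftrightarrow> 0 \<le> j \<and> j \<le> int q" for j
    unfolding s0_def vadd_vsmul_add iff q by auto
  have c: "cint s0 r = - int q"
  proof -
    have "0 \<le> - cint s0 r \<and> - cint s0 r \<le> int q"
      using string_reflect[OF r s0, of 0] iff0[of "- cint s0 r"] iff0[of 0] by simp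
    moreover have "0 \<le> - int q - cint s0 r"
      using string_reflect[OF r s0, of "int q"] iff0[of "- int q - cint s0 r"] iff0[of "int q"] by simp
    ultimately show ?thesis by linarith
  qed
  \<comment> \<open>For q at least 4 the norm of s0 + r would be at most 3 + 1 - 4 = 0 times that of
    r; the 3 bounds the ratio of two root norms.\<close>
  have "q \<le> 3"
  proof (rule ccontr)
    assume q4: "\<not> q \<le> 3"
    then have "vadd s0 (vsmul 1 r) \<in> R" using iff0 by simp
    then have "ip (vadd s0 (vsmul 1 r)) (vadd s0 (vsmul 1 r)) > 0" by (rule norm_pos)
    moreover have "ip (vadd s0 (vsmul 1 r)) (vadd s0 (vsmul 1 r)) = ip s0 s0 + ip r r + 2 * ip s0 r"
      using ip_commute[of s0 r] len[OF s0] lens by (simp add: ip_linear)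
    moreover have "2 * ip s0 r = - int q * ip r r" using cint_mult[OF r s0] c by simp
    moreover have "int q * ip r r \<ge> 4 * ip r r" using q4 norm_pos[OF r] by (intro mult_right_mono) auto
    moreover have "ip s0 s0 \<le> 3 * ip r r" 
      using norm_cases[OF s0] norm_cases[OF r] p_cases m_pos by auto
    ultimately show False by linarith
  qed
  moreover have "s = vadd s0 (vsmul (int (nat (- lo))) r)" 
    using lo lens unfolding s0_def vadd_vsmul_add by simp
  moreover have "nat (- lo) \<le> q" using lo hi q by linarith
  ultimately show thesis using that[OF _ _ s0 ne iff0] c by blast
qed

lemma strpos_string:
  assumes iff: "\<And>j. vadd s0 (vsmul j r) \<in> R \<longleftrightarrow> 0 \<le> j \<and> j \<le> int q" and "i \<le> q"
  shows "strpos X r (vadd s0 (vsmul (int i) r)) = i"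
  unfolding strpos_def vadd_vsmul_add
  by (rule Greatest_equality) (use assms in auto)

text \<open>Shows the description in \<open>coc\<close> to be proper: the solution from
  \<open>coroot_exists\<close>, cut off outside the simple roots, satisfies it, and pairing the
  equations with a dual vector from \<open>simple_dual\<close> isolates one coefficient at a
  time.\<close>

lemma coc_expand:
  assumes "r \<in> R" "k < dimv X"
  shows "(\<Sum>a\<in>simple X. of_int (coc X r a) * (2 * of_int (a ! k) / of_int (ip a a)))
     = (2 * of_int (r ! k) / of_int (ip r r) :: rat)"
proof -
  let ?Q = "\<lambda>c :: vec \<Rightarrow> int. (\<forall>a. a \<notin> simple X \<longrightarrow> c a = 0) \<and>
     (\<forall>k < dimv X. (\<Sum>a\<in>simple X. of_int (c a) * (2 * of_int (a ! k) / of_int (ip a a)))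
                     = (2 * of_int (r ! k) / of_int (ip r r) :: rat))"
  obtain c :: "vec \<Rightarrow> int" where c: "\<forall>k<dimv X.
       (\<Sum>a\<in>simple X. of_int (c a) * (2 * of_int (a ! k) / of_int (ip a a)))
         = (2 * of_int (r ! k) / of_int (ip r r) :: rat)" using coroot_exists[OF assms(1)] by blast
  let ?c = "\<lambda>a. if a \<in> simple X then c a else 0"
  have Qc: "?Q ?c" using c by (auto intro!: sum.cong)
  have val: "of_int (c a) * (2 * of_int (ip a w) / of_int (ip a a)) = (2 * of_int (ip r w) / of_int (ip r r) :: rat)"
    if Q: "?Q c" and a: "a \<in> simple X" and w: "length w = dimv X" "\<forall>b\<in>simple X. b \<noteq> a \<longrightarrow> ip b w = 0" for c a w
  proof -
    have lr: "length b = dimv X" if "b \<in> simple X" for b using that len simple_roots by auto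
    have e: "(of_int (ip b w) :: rat) = (\<Sum>k<dimv X. of_int (b ! k) * of_int (w ! k))" if "length b = dimv X" for b
      using ip_conv_sum[OF that w(1)] by simp
    have "2 * of_int (ip r w) / of_int (ip r r) = (\<Sum>k<dimv X. (2 * of_int (r ! k) / of_int (ip r r) :: rat) * of_int (w ! k))"
      unfolding e[OF len[OF assms(1)]] by (simp add: sum_distrib_left sum_divide_distrib mult.assoc)
    also have "\<dots> = (\<Sum>k<dimv X. \<Sum>b\<in>simple X. of_int (c b) * (2 * of_int (b ! k) / of_int (ip b b)) * of_int (w ! k))"
      using Q by (intro sum.cong refl, subst sum_distrib_right[symmetric]) simp
    also have "\<dots> = (\<Sum>b\<in>simple X. \<Sum>k<dimv X. of_int (c b) * (2 * of_int (b ! k) / of_int (ip b b)) * of_int (w ! k))"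
      by (rule sum.swap)
    also have "\<dots> = (\<Sum>b\<in>simple X. of_int (c b) * (2 * of_int (ip b w) / of_int (ip b b)))"
      using e lr by (intro sum.cong refl) (simp add: sum_distrib_left sum_divide_distrib algebra_simps)
    also have "\<dots> = (\<Sum>b\<in>{a}. of_int (c b) * (2 * of_int (ip b w) / of_int (ip b b)))"
      by (rule sum.mono_neutral_right) (use a w fin_simple in auto)
    finally show ?thesis by simp
  qed
  have uniq: "c' = ?c" if Q: "?Q c'" for c'
  proof
    fix a show "c' a = ?c a"
    proof (cases "a \<in> simple X")
      case True
      obtain w where w: "length w = dimv X" "ip a w \<noteq> 0" "\<forall>b\<in>simple X. b \<noteq> a \<longrightarrow> ip b w = 0"
        using simple_dual[OF True] by blast
      have "ip a a \<noteq> 0" using norm_pos[of a] True simple_roots by auto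
      moreover have "of_int (c' a) * (2 * of_int (ip a w) / of_int (ip a a))
          = (of_int (?c a) * (2 * of_int (ip a w) / of_int (ip a a)) :: rat)"
        using val[OF Q True w(1,3)] val[OF Qc True w(1,3)] by (rule trans[OF _ sym])
      ultimately show ?thesis using w(2) by (simp only: mult_cancel_right) simp
    qed (use Q in auto)
  qed
  have "?Q (coc X r)" unfolding coc_def by (rule theI[of ?Q, OF Qc uniq])
  then show ?thesis using assms by blast
qed

text \<open>Pairs s with the expansion of the coroot of r in simple coroots. This makes [e_r, e_-r]
  act on e_s by <s,r>, and later reduces h_r to the h_a with a simple.\<close>

lemma coc_cint:
  assumes r: "r \<in> R" and s: "s \<in> R"
  shows "(\<Sum>a\<in>simple X. coc X r a * cint s a) = cint s r"
proof -
  have e: "(of_int (ip s b) :: rat) = (\<Sum>k<dimv X. of_int (b ! k) * of_int (s ! k))" if "length b = dimv X" for b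
    using ip_conv_sum[OF len[OF s] that] by (simp add: mult.commute)
  have ci: "(of_int (cint s b) :: rat) = 2 * of_int (ip s b) / of_int (ip b b)" if "b \<in> R" for b
    using arg_cong[OF cint_mult[OF that s], of "of_int :: int \<Rightarrow> rat"] norm_pos[OF that] by (simp add: field_simps)
  have lr: "length b = dimv X" "b \<in> R" if "b \<in> simple X" for b using that len simple_roots by auto
  have "(of_int (cint s r) :: rat) = (\<Sum>k<dimv X. (2 * of_int (r ! k) / of_int (ip r r) :: rat) * of_int (s ! k))"
    unfolding ci[OF r] e[OF len[OF r]] by (simp add: sum_distrib_left sum_divide_distrib mult.assoc)
  also have "\<dots> = (\<Sum>k<dimv X. \<Sum>b\<in>simple X. of_int (coc X r b) * (2 * of_int (b ! k) / of_int (ip b b)) * of_int (s ! k))"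
    using coc_expand[OF r] by (intro sum.cong refl, subst sum_distrib_right[symmetric]) simp
  also have "\<dots> = (\<Sum>b\<in>simple X. \<Sum>k<dimv X. of_int (coc X r b) * (2 * of_int (b ! k) / of_int (ip b b)) * of_int (s ! k))"
    by (rule sum.swap)
  also have "\<dots> = (\<Sum>b\<in>simple X. of_int (coc X r b) * of_int (cint s b))"
    using e lr ci by (intro sum.cong refl) (simp add: sum_distrib_left sum_divide_distrib algebra_simps)
  finally show ?thesis by (metis (no_types, lifting) of_int_eq_iff of_int_mult of_int_sum sum.cong)
qed

lemma long_iff: "long_root X r \<longleftrightarrow> r \<in> R \<and> ip r r = p * m"
proof -
  have "m < p * m" using p_cases m_pos by auto
  then show ?thesis unfolding long_root_def using long_exists norm_cases
    by (metis linorder_not_le order.refl less_imp_le)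
qed

lemma short_iff: "short_root X r \<longleftrightarrow> r \<in> R \<and> ip r r = m"
  unfolding short_root_def long_iff using norm_cases p_cases m_pos by auto

text \<open><s,r> |r|^2 and <r,s> |s|^2 agree by symmetry, and |s|^2 = p |r|^2. With L^p inside K,
  this puts the values of h_r(t), r short, at all long roots into K.\<close>

lemma cint_long_short: 
  assumes "long_root X s" "short_root X r" shows "p dvd cint s r"
proof -
  have "r \<in> R" "s \<in> R" "ip r r = m" "ip s s = p * m" using assms long_iff short_iff by auto
  then have "cint s r * m = cint r s * (p * m)" 
    using cint_mult[of r s] cint_mult[of s r] ip_commute[of r s] len by auto
  then have "cint s r = cint r s * p" using m_pos by simp
  then show ?thesis by simp
qed

end

section \<open>Root elements on root strings\<close>

definition mulv :: "ctype \<Rightarrow> (idx \<Rightarrow> idx \<Rightarrow> 'a :: field) \<Rightarrow> (idx \<Rightarrow> 'a) \<Rightarrow> idx \<Rightarrow> 'a" where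
  "mulv X M v = (\<lambda>i. \<Sum>j\<in>basis X. M i j * v j)"

text \<open>A vector on a string, in coordinates relative to the rescaled basis \<eta>_i e_(v i);
  the signs will be chosen so that the structure constants along the string become positive.\<close>

definition stringv :: "(nat \<Rightarrow> vec) \<Rightarrow> (nat \<Rightarrow> int) \<Rightarrow> nat \<Rightarrow> (nat \<Rightarrow> 'a :: field) \<Rightarrow> idx \<Rightarrow> 'a" where
  "stringv v \<eta> q x = (\<lambda>y. \<Sum>i\<le>q. x i * of_int (\<eta> i) * of_int (delta (Inl (v i)) y))"

text \<open>The unipotent exp(t e) on the module with e w_i = (i + 1) w_(i+1), the q-th symmetric
  power in its binomially scaled basis. \<open>lowering\<close> is the same map after reversing the
  string.\<close>

definition raising :: "nat \<Rightarrow> 'a :: field \<Rightarrow> (nat \<Rightarrow> 'a) \<Rightarrow> nat \<Rightarrow> 'a" where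
  "raising q t x = (\<lambda>m. \<Sum>i\<le>q. if i \<le> m then of_nat (m choose i) * t ^ (m - i) * x i else 0)"

definition lowering :: "nat \<Rightarrow> 'a :: field \<Rightarrow> (nat \<Rightarrow> 'a) \<Rightarrow> nat \<Rightarrow> 'a" where
  "lowering q t x = (\<lambda>m. raising q t (\<lambda>i. x (q - i)) (q - m))"

text \<open>The action of the matrix with rows (0, t) and (-1/t, 0) on the q-th symmetric power. As
  q is at most 3, only ten polynomial identities have to be checked.\<close>

lemma string_weyl:
  fixes t :: "'a :: field"
  assumes "q \<le> 3" "m \<le> q" "t \<noteq> 0"
  shows "raising q t (lowering q (- inverse t) (raising q t x)) m
    = (-1) ^ (q - m) * t powi (2 * int m - int q) * x (q - m)"
proof -
  have "q = 0 \<or> q = 1 \<or> q = 2 \<or> q = 3" using assms by linarith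
  moreover have "m = 0 \<or> m = 1 \<or> m = 2 \<or> m = 3" using assms by linarith
  ultimately show ?thesis using assms(2,3)
    by (elim disjE; simp add: raising_def lowering_def numeral_eq_Suc power_int_def field_simps)
qed
locale chevalley = rootdata +
  fixes N :: "vec \<Rightarrow> vec \<Rightarrow> int"
  assumes chev: "chevalley_basis X N"
begin

abbreviation B where "B \<equiv> basis X"

section \<open>Structure constants of a Chevalley basis along a root string\<close>

lemma fin_basis: "finite B"
  unfolding basis_def using fin_roots fin_simple by simp

lemma basis_iff [simp]: "Inl r \<in> B \<longleftrightarrow> r \<in> R" "Inr a \<in> B \<longleftrightarrow> a \<in> simple X"
  unfolding basis_def by auto

lemma sum_basis: "sum f B = (\<Sum>r\<in>R. f (Inl r)) + (\<Sum>a\<in>simple X. f (Inr a))"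
proof -
  have "sum f B = sum f (Inl ` R) + sum f (Inr ` simple X)"
    unfolding basis_def by (rule sum.union_disjoint) (use fin_roots fin_simple in auto)
  then show ?thesis by (simp add: sum.reindex)
qed

lemma sum_delta_basis: "w \<in> B \<Longrightarrow> (\<Sum>z\<in>B. delta w z * f z) = f w"
  unfolding delta_def using fin_basis by (simp add: if_distrib if_distribR sum.delta' cong: if_cong)

lemma sum_of_int_delta_basis: "w \<in> B \<Longrightarrow> (\<Sum>z\<in>B. f z * of_int (delta w z)) = (f w :: 'a :: field)"
  unfolding delta_def using fin_basis by (simp add: if_distrib if_distribR sum.delta' cong: if_cong)

lemma brb_antisym: "x \<in> B \<Longrightarrow> y \<in> B \<Longrightarrow> brb X N x y i = - brb X N y x i"
  using chev unfolding chevalley_basis_def by (metis (no_types, lifting))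

lemma N_abs: "r \<in> R \<Longrightarrow> s \<in> R \<Longrightarrow> vadd r s \<in> R \<Longrightarrow> \<bar>N r s\<bar> = int (strpos X r s) + 1"
  using chev unfolding chevalley_basis_def by fastforce

lemma root_nonzero: "r \<in> R \<Longrightarrow> vsmul 0 s \<noteq> r"
  using norm_pos[of r] ip_vsmul_left[of s "vsmul 0 s" 0] by auto

lemma vadd_neq_neg: "r \<in> R \<Longrightarrow> s \<in> R \<Longrightarrow> vadd r s \<in> R \<Longrightarrow> s \<noteq> vneg r"
proof
  assume r: "r \<in> R" "vadd r s \<in> R" "s = vneg r"
  then have "vadd r s = vsmul 0 r" by (auto intro!: nth_equalityI)
  then show False using root_nonzero r by metis
qed

lemma N_antisym:
  assumes "r \<in> R" "s \<in> R" "vadd r s \<in> R" shows "N s r = - N r s"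
proof -
  have "s \<noteq> vneg r" "r \<noteq> vneg s" using vadd_neq_neg assms vadd_commute by metis+
  then show ?thesis using brb_antisym[of "Inl r" "Inl s" "Inl (vadd r s)"] assms
    by (simp add: vadd_commute[of s r] delta_def)
qed

text \<open>Read off from the antisymmetry of [e_r, e_-r] at h_a, without returning to the
  description of \<open>coc\<close>.\<close>

lemma coc_vneg: "r \<in> R \<Longrightarrow> coc X (vneg r) a = - coc X r a"
  using brb_antisym[of "Inl r" "Inl (vneg r)" "Inr a"] vneg_root by simp

lemma brk_delta: "x \<in> B \<Longrightarrow> brk X N (delta x) v = (\<lambda>y. \<Sum>z\<in>B. v z * brb X N x z y)"
proof
  fix y assume x: "x \<in> B"
  have "brk X N (delta x) v y = (\<Sum>x'\<in>B. delta x x' * (\<Sum>z\<in>B. v z * brb X N x' z y))"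
    unfolding brk_def by (simp add: sum_distrib_left mult.assoc)
  then show "brk X N (delta x) v y = (\<Sum>z\<in>B. v z * brb X N x z y)" by (simp only: sum_delta_basis[OF x])
qed

lemma brk_delta_delta: "x \<in> B \<Longrightarrow> z \<in> B \<Longrightarrow> brk X N (delta x) (delta z) = brb X N x z"
  by (simp add: brk_delta sum_delta_basis)

lemma jacobi:
  assumes "x \<in> B" "y \<in> B" "z \<in> B"
  shows "(\<Sum>w\<in>B. brb X N y z w * brb X N x w i) + (\<Sum>w\<in>B. brb X N z x w * brb X N y w i)
       + (\<Sum>w\<in>B. brb X N x y w * brb X N z w i) = 0"
proof -
  have "(\<lambda>i. brk X N (delta x) (brk X N (delta y) (delta z)) i
            + brk X N (delta y) (brk X N (delta z) (delta x)) i
            + brk X N (delta z) (brk X N (delta x) (delta y)) i) = (\<lambda>i. 0)"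
    using chev assms unfolding chevalley_basis_def by blast
  note J = fun_cong[OF this, of i]
  have e: "brk X N (delta x) (brk X N (delta y) (delta z)) i = (\<Sum>w\<in>B. brb X N y z w * brb X N x w i)"
    if "x \<in> B" "y \<in> B" "z \<in> B" for x y z
    unfolding brk_delta_delta[OF that(2,3)] brk_delta[OF that(1)] ..
  show ?thesis using J unfolding e[OF assms(1,2,3)] e[OF assms(2,3,1)] e[OF assms(3,1,2)] .
qed

text \<open>The Jacobi identity for \<open>e\<^sub>r, e\<^sub>-\<^sub>r, e\<^sub>s\<close>, read off at \<open>e\<^sub>s\<close>.\<close>
lemma jacobi_string:
  assumes r: "r \<in> R" and s: "s \<in> R" "s \<noteq> r" "s \<noteq> vneg r"
  shows "(if vadd s (vneg r) \<in> R then N (vneg r) s * N r (vadd s (vneg r)) else 0)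
       - (if vadd s r \<in> R then N r s * N (vneg r) (vadd s r) else 0) = cint s r"
proof -
  have lens: "length s = dimv X" "length r = dimv X" using r s len by auto
  have nr: "vneg r \<in> R" using vneg_root r .
  have sums: "vadd r (vadd s (vneg r)) = s" "vadd (vneg r) (vadd s r) = s"
    using lens by (auto intro!: nth_equalityI)
  have ne: "vadd s (vneg r) \<noteq> vneg r" "vadd s r \<noteq> r"
  proof -
    have *: False if "vadd s x = x" "length x = length s" for x
    proof -
      have "s ! k = 0" if "k < length s" for k
        using arg_cong[OF \<open>vadd s x = x\<close>, of "\<lambda>v. v ! k"] that \<open>length x = length s\<close> by simp
      then have "ip s s = 0" by (simp add: ip_self_eq_0)
      then show False using norm_pos s(1) by fastforce
    qed
    then show "vadd s (vneg r) \<noteq> vneg r" "vadd s r \<noteq> r" using *[of "vneg r"] *[of r] lens by auto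
  qed
  have T1: "(\<Sum>w\<in>B. brb X N (Inl (vneg r)) (Inl s) w * brb X N (Inl r) w (Inl s))
      = (if vadd s (vneg r) \<in> R then N (vneg r) s * N r (vadd s (vneg r)) else 0)"
  proof (cases "vadd s (vneg r) \<in> R")
    case True
    then have "(\<Sum>w\<in>B. brb X N (Inl (vneg r)) (Inl s) w * brb X N (Inl r) w (Inl s))
      = N (vneg r) s * (\<Sum>w\<in>B. delta (Inl (vadd s (vneg r))) w * brb X N (Inl r) w (Inl s))"
      using s by (simp add: vadd_commute[of "vneg r" s] sum_distrib_left mult.assoc)
    also have "\<dots> = N (vneg r) s * N r (vadd s (vneg r))"
      using True ne sums s by (simp add: sum_delta_basis) (simp add: delta_def)
    finally show ?thesis using True by simp
  qed (use s in \<open>simp add: vadd_commute[of "vneg r" s]\<close>)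
  have T2: "(\<Sum>w\<in>B. brb X N (Inl s) (Inl r) w * brb X N (Inl (vneg r)) w (Inl s))
      = - (if vadd s r \<in> R then N r s * N (vneg r) (vadd s r) else 0)"
  proof (cases "vadd s r \<in> R")
    case True
    have "r \<noteq> vneg s" using s by auto
    with True have "(\<Sum>w\<in>B. brb X N (Inl s) (Inl r) w * brb X N (Inl (vneg r)) w (Inl s))
      = N s r * (\<Sum>w\<in>B. delta (Inl (vadd s r)) w * brb X N (Inl (vneg r)) w (Inl s))"
      using s by (simp add: sum_distrib_left mult.assoc)
    also have "\<dots> = N s r * N (vneg r) (vadd s r)"
      using True ne sums s by (simp add: sum_delta_basis) (simp add: delta_def)
    also have "N s r = - N r s" using N_antisym r s True vadd_commute by metis
    finally show ?thesis using True by simp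
  next
    case False
    have "r \<noteq> vneg s" using s by auto
    then show ?thesis using False by simp
  qed
  \<comment> \<open>[e_r, e_-r] is the coroot of r written in the h_a; by \<open>coc_cint\<close> it
    acts on e_s with eigenvalue <s,r>, and the reversed order of the bracket changes the
    sign.\<close>
  have T3: "(\<Sum>w\<in>B. brb X N (Inl r) (Inl (vneg r)) w * brb X N (Inl s) w (Inl s)) = - cint s r"
    unfolding sum_basis using coc_cint[OF r s(1)] by (simp add: delta_def sum_negf)
  have "(\<Sum>w\<in>B. brb X N (Inl (vneg r)) (Inl s) w * brb X N (Inl r) w (Inl s))
      + (\<Sum>w\<in>B. brb X N (Inl s) (Inl r) w * brb X N (Inl (vneg r)) w (Inl s))
      + (\<Sum>w\<in>B. brb X N (Inl r) (Inl (vneg r)) w * brb X N (Inl s) w (Inl s)) = 0"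
    by (rule jacobi) (use r s nr in auto)
  then show ?thesis unfolding T1 T2 T3 by linarith
qed

text \<open>The Jacobi identity determines the product of the two constants across each edge of the
  string, and the Chevalley condition gives the absolute value of one of them. Only one sign per
  edge is free, and running products of these signs move it to the vertices.\<close>

lemma string_signs:
  assumes r: "r \<in> R" and s: "s \<in> R" "s \<noteq> r" "s \<noteq> vneg r"
    and iff: "\<And>j. vadd s (vsmul j r) \<in> R \<longleftrightarrow> 0 \<le> j \<and> j \<le> int q" and c: "cint s r = - int q"
  defines "v \<equiv> \<lambda>i::nat. vadd s (vsmul (int i) r)"
  obtains \<eta> :: "nat \<Rightarrow> int" where "\<And>i. \<eta> i * \<eta> i = 1"
    "\<And>i. i < q \<Longrightarrow> N r (v i) = int (Suc i) * (\<eta> i * \<eta> (Suc i))"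
    "\<And>i. i < q \<Longrightarrow> N (vneg r) (v (Suc i)) = int (q - i) * (\<eta> i * \<eta> (Suc i))"
proof -
  have lens: "length s = dimv X" "length r = dimv X" using r s len by auto
  have v: "v i \<in> R" "v i \<noteq> r" "v i \<noteq> vneg r" if "i \<le> q" for i
    using iff[of "int i"] that line_neq[OF r s, of "int i"] unfolding v_def by auto
  have vS: "vadd (v i) r = v (Suc i)" for i unfolding v_def vadd_vsmul_1 by (simp add: add.commute)
  have vS': "vadd (v (Suc i)) (vneg r) = v i" for i
    unfolding v_def vadd_vsmul_neg1 vadd_vsmul_add by simp
  have v0: "vadd (v 0) (vneg r) \<notin> R" unfolding v_def vadd_vsmul_neg1 vadd_vsmul_add using iff[of "-1"] by simp
  have cv: "cint (v i) r = 2 * int i - int q" for i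
    unfolding v_def using cint_line[OF r r s(1)] cint_self[OF r] c by simp
  \<comment> \<open>The Jacobi identity lowers this product by 2 (i + 1) - q from edge i to edge i +
    1, and (i + 1)(q - i) solves the recursion.\<close>
  have F: "N r (v i) * N (vneg r) (v (Suc i)) = int (Suc i) * int (q - i)" if "i < q" for i
    using that
  proof (induction i)
    case 0
    have "vadd (v 0) r \<in> R" using v[of 1] 0 vS[of 0] by simp
    then show ?case using jacobi_string[OF r v[of 0]] v0 cv[of 0] vS[of 0] by simp
  next
    case (Suc i)
    have "vadd (v (Suc i)) r \<in> R" using v[of "Suc (Suc i)"] Suc.prems vS by simp
    moreover have "vadd (v (Suc i)) (vneg r) \<in> R" using v[of i] Suc.prems vS' by simp
    ultimately have "N (vneg r) (v (Suc i)) * N r (v i) - N r (v (Suc i)) * N (vneg r) (v (Suc (Suc i)))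
        = 2 * int (Suc i) - int q"
      using jacobi_string[OF r v[of "Suc i"]] cv Suc.prems vS' vS by simp
    moreover have "int (q - i) = int q - int i" "int (q - Suc i) = int q - int i - 1" using Suc.prems by auto
    ultimately show ?case using Suc by (simp add: algebra_simps)
  qed
  define \<sigma> :: "nat \<Rightarrow> int" where "\<sigma> i = (if N r (v i) > 0 then 1 else -1)" for i
  define \<eta> where "\<eta> i = prod \<sigma> {..<i}" for i
  have sq: "\<eta> i * \<eta> i = 1" for i
    unfolding \<eta>_def prod.distrib[symmetric] by (rule prod.neutral) (simp add: \<sigma>_def)
  have step: "\<eta> i * \<eta> (Suc i) = \<sigma> i" for i using sq[of i] by (simp add: \<eta>_def mult.assoc[symmetric])
  have N1: "N r (v i) = int (Suc i) * (\<eta> i * \<eta> (Suc i))" if "i < q" for i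
  proof -
    have "\<bar>N r (v i)\<bar> = int (strpos X r (v i)) + 1"
      using N_abs[OF r, of "v i"] v[of i] v[of "Suc i"] vS[of i] that vadd_commute by (metis Suc_leI less_imp_le)
    moreover have "strpos X r (v i) = i" unfolding v_def using strpos_string[OF iff] that by simp
    ultimately show ?thesis unfolding step \<sigma>_def by auto
  qed
  have N2: "N (vneg r) (v (Suc i)) = int (q - i) * (\<eta> i * \<eta> (Suc i))" if "i < q" for i
  proof -
    let ?e = "\<eta> i * \<eta> (Suc i)"
    have e: "?e * ?e = 1" unfolding step \<sigma>_def by auto
    have "int (Suc i) * (?e * N (vneg r) (v (Suc i))) = int (Suc i) * int (q - i)"
      using F[OF that] unfolding N1[OF that] by (simp add: mult.assoc)
    then have "?e * N (vneg r) (v (Suc i)) = int (q - i)" by simp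
    then have "?e * ?e * N (vneg r) (v (Suc i)) = int (q - i) * ?e" by (metis mult.assoc mult.commute)
    then show ?thesis unfolding e by simp
  qed
  show thesis using that[OF sq N1 N2] .
qed

text \<open>Guards the truncation in \<open>ur\<close>: a string has no more elements than the
  basis, so the sum up to \<open>card B\<close> reaches every nonzero power.\<close>

lemma card_basis_ge:
  assumes "A \<subseteq> R" "finite A" shows "card A \<le> card B"
proof -
  have "card (Inl ` A :: idx set) \<le> card B" using assms by (intro card_mono fin_basis) auto
  then show ?thesis by (simp add: card_image)
qed

text \<open>k steps up from position i multiply by (i + 1) ... (i + k), which is k! times a binomial
  coefficient, while the inner signs cancel in pairs. Hence the integer division in
  \<open>divpow\<close> is exact here.\<close>

lemma ipow_chain:
  fixes \<eta> :: "nat \<Rightarrow> int"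
  assumes r: "r \<in> R" and v: "\<And>i. i \<le> q \<Longrightarrow> v i \<in> R" "\<And>i. i \<le> q \<Longrightarrow> v i \<noteq> vneg r"
    and vS: "\<And>i. i < q \<Longrightarrow> vadd r (v i) = v (Suc i)" and vq: "vadd r (v q) \<notin> R"
    and \<eta>: "\<And>i. \<eta> i * \<eta> i = 1"
    and N: "\<And>i. i < q \<Longrightarrow> N r (v i) = int (Suc i) * (\<eta> i * \<eta> (Suc i))"
    and i: "i \<le> q"
  shows "ipow X (adm X N r) k y (Inl (v i)) =
    (if i + k \<le> q then fact k * (int ((i + k) choose i) * (\<eta> i * \<eta> (i + k)) * delta (Inl (v (i + k))) y) else 0)"
proof (induction k arbitrary: y)
  case 0
  show ?case using i v[of i] \<eta> by (auto simp: delta_def)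
next
  case (Suc k)
  have adm: "adm X N r y (Inl (v m)) = (if m < q then int (Suc m) * (\<eta> m * \<eta> (Suc m)) * delta (Inl (v (Suc m))) y else 0)"
    if "m \<le> q" for m
  proof (cases "m < q")
    case True
    then have "vadd r (v m) \<in> R" using vS v(1)[of "Suc m"] by simp
    then show ?thesis using True v[of m] v(1)[of "Suc m"] N[of m] vS[of m] by (auto simp: adm_def delta_def)
  next
    case False
    then have "m = q" using that by simp
    then show ?thesis using False v[of m] vq by (auto simp: adm_def)
  qed
  show ?case
  proof (cases "i + k \<le> q")
    case True
    let ?c = "fact k * (int ((i + k) choose i) * (\<eta> i * \<eta> (i + k)))"
    have "ipow X (adm X N r) (Suc k) y (Inl (v i)) = (\<Sum>l\<in>B. adm X N r y l * (?c * delta (Inl (v (i + k))) l))"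
      using True by (simp add: imul_def Suc mult.assoc)
    also have "\<dots> = ?c * (\<Sum>l\<in>B. delta (Inl (v (i + k))) l * adm X N r y l)"
      by (simp add: sum_distrib_left algebra_simps)
    also have "\<dots> = ?c * adm X N r y (Inl (v (i + k)))"
      using v(1)[OF True] by (simp add: sum_delta_basis)
    finally have eq: "ipow X (adm X N r) (Suc k) y (Inl (v i)) = ?c * adm X N r y (Inl (v (i + k)))" .
    show ?thesis
    proof (cases "i + k < q")
      case True
      have "fact i * (fact (Suc k) * ((i + Suc k) choose i)) = (fact (i + Suc k) :: nat)"
        using binomial_fact_lemma[of i "i + Suc k"] by (simp add: mult.assoc)
      also have "\<dots> = Suc (i + k) * (fact i * (fact k * ((i + k) choose i)))"
        using binomial_fact_lemma[of i "i + k"] by (simp add: mult.assoc)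
      finally have "fact (Suc k) * ((i + Suc k) choose i) = (fact k * ((i + k) choose i) * Suc (i + k) :: nat)"
        by (metis (no_types, lifting) fact_nonzero mult.commute mult.left_commute mult_left_cancel)
      then have f: "fact (Suc k) * int ((i + Suc k) choose i) = fact k * int ((i + k) choose i) * int (Suc (i + k))"
        by (metis of_nat_fact of_nat_mult)
      have "?c * (int (Suc (i + k)) * (\<eta> (i + k) * \<eta> (Suc (i + k)))) 
          = (fact k * int ((i + k) choose i) * int (Suc (i + k))) * ((\<eta> (i + k) * \<eta> (i + k)) * (\<eta> i * \<eta> (i + Suc k)))"
        by (simp only: mult_ac add_Suc_right)
      also have "\<dots> = fact (Suc k) * (int ((i + Suc k) choose i) * (\<eta> i * \<eta> (i + Suc k)))"
        unfolding f[symmetric] \<eta> by (simp only: mult_1 mult.assoc)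
      finally have c: "?c * (int (Suc (i + k)) * (\<eta> (i + k) * \<eta> (Suc (i + k))))
        = fact (Suc k) * (int ((i + Suc k) choose i) * (\<eta> i * \<eta> (i + Suc k)))" .
      have "ipow X (adm X N r) (Suc k) y (Inl (v i))
          = ?c * (int (Suc (i + k)) * (\<eta> (i + k) * \<eta> (Suc (i + k)))) * delta (Inl (v (i + Suc k))) y"
        unfolding eq adm[OF \<open>i + k \<le> q\<close>] using True by (simp only: if_True mult.assoc add_Suc_right)
      then show ?thesis unfolding c using True by (simp add: mult.assoc)
    qed (use eq adm \<open>i + k \<le> q\<close> in auto)
  qed (simp add: imul_def Suc)
qed

lemma ur_chain:
  fixes \<eta> :: "nat \<Rightarrow> int" and t :: "'a :: field"
  assumes r: "r \<in> R" and v: "\<And>i. i \<le> q \<Longrightarrow> v i \<in> R" "\<And>i. i \<le> q \<Longrightarrow> v i \<noteq> vneg r"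
    and vS: "\<And>i. i < q \<Longrightarrow> vadd r (v i) = v (Suc i)" and vq: "vadd r (v q) \<notin> R"
    and \<eta>: "\<And>i. \<eta> i * \<eta> i = 1"
    and N: "\<And>i. i < q \<Longrightarrow> N r (v i) = int (Suc i) * (\<eta> i * \<eta> (Suc i))"
    and i: "i \<le> q" and q: "q \<le> card B"
  shows "ur X N r t y (Inl (v i)) = (\<Sum>m\<le>q. if i \<le> m then of_nat (m choose i) * t ^ (m - i)
           * of_int (\<eta> i * \<eta> m) * of_int (delta (Inl (v m)) y) else 0)"
proof -
  let ?h = "\<lambda>m. of_nat (m choose i) * t ^ (m - i) * of_int (\<eta> i * \<eta> m) * of_int (delta (Inl (v m)) y)"
  have dp: "divpow X N r k y (Inl (v i)) =
    (if i + k \<le> q then int ((i + k) choose i) * (\<eta> i * \<eta> (i + k)) * delta (Inl (v (i + k))) y else 0)" for k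
  proof -
    have "ipow X (adm X N r) k y (Inl (v i)) = (if i + k \<le> q then
        fact k * (int ((i + k) choose i) * (\<eta> i * \<eta> (i + k)) * delta (Inl (v (i + k))) y) else 0)"
      by (rule ipow_chain[OF r v vS vq \<eta> N i])
    then show ?thesis unfolding divpow_def by simp
  qed
  have "ur X N r t y (Inl (v i)) = (\<Sum>k\<le>card B. if i + k \<le> q then ?h (i + k) else 0)"
    unfolding ur_def dp by (intro sum.cong refl) auto
  also have "\<dots> = (\<Sum>k\<in>{..q - i}. ?h (i + k))"
    using q i by (intro sum.mono_neutral_cong_right) auto
  also have "\<dots> = (\<Sum>m\<in>{i..q}. ?h m)"
    by (rule sum.reindex_bij_witness[where i = "\<lambda>m. m - i" and j = "\<lambda>k. i + k"]) (use i in auto)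
  also have "\<dots> = (\<Sum>m\<le>q. if i \<le> m then ?h m else 0)"
    by (rule sum.mono_neutral_cong_left) auto
  finally show ?thesis .
qed

text \<open>In the rescaled coordinates the signs cancel, and what remains is
  \<open>raising\<close>, an expression free of N.\<close>

lemma mulv_ur_chain:
  fixes \<eta> :: "nat \<Rightarrow> int" and t :: "'a :: field"
  assumes r: "r \<in> R" and v: "\<And>i. i \<le> q \<Longrightarrow> v i \<in> R" "\<And>i. i \<le> q \<Longrightarrow> v i \<noteq> vneg r"
    and vS: "\<And>i. i < q \<Longrightarrow> vadd r (v i) = v (Suc i)" and vq: "vadd r (v q) \<notin> R"
    and \<eta>: "\<And>i. \<eta> i * \<eta> i = 1"
    and N: "\<And>i. i < q \<Longrightarrow> N r (v i) = int (Suc i) * (\<eta> i * \<eta> (Suc i))"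
    and q: "q \<le> card B"
  shows "mulv X (ur X N r t) (stringv v \<eta> q x) = stringv v \<eta> q (raising q t x)"
proof
  fix y
  have \<eta>': "(of_int (\<eta> i) :: 'a) * of_int (\<eta> i) = 1" for i by (metis \<eta> of_int_1 of_int_mult)
  let ?D = "\<lambda>m. of_int (delta (Inl (v m)) y) :: 'a"
  have "mulv X (ur X N r t) (stringv v \<eta> q x) y
      = (\<Sum>i\<le>q. \<Sum>j\<in>B. x i * of_int (\<eta> i) * (ur X N r t y j * of_int (delta (Inl (v i)) j)))"
    unfolding mulv_def stringv_def by (subst sum.swap) (simp add: sum_distrib_left algebra_simps)
  also have "\<dots> = (\<Sum>i\<le>q. x i * of_int (\<eta> i) * ur X N r t y (Inl (v i)))"
    using v(1) by (simp add: sum_distrib_left[symmetric] sum_of_int_delta_basis)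
  also have "\<dots> = (\<Sum>i\<le>q. \<Sum>m\<le>q. (if i \<le> m then of_nat (m choose i) * t ^ (m - i) * x i else 0) * of_int (\<eta> m) * ?D m)"
  proof (intro sum.cong refl)
    fix i assume "i \<in> {..q}"
    then have "i \<le> q" by simp
    have ur: "ur X N r t y (Inl (v i)) = (\<Sum>m\<le>q. if i \<le> m then of_nat (m choose i) * t ^ (m - i)
           * of_int (\<eta> i * \<eta> m) * of_int (delta (Inl (v m)) y) else 0)"
      by (rule ur_chain[OF r v vS vq \<eta> N \<open>i \<le> q\<close> q])
    show "x i * of_int (\<eta> i) * ur X N r t y (Inl (v i))
       = (\<Sum>m\<le>q. (if i \<le> m then of_nat (m choose i) * t ^ (m - i) * x i else 0) * of_int (\<eta> m) * ?D m)"
      unfolding ur sum_distrib_left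
    proof (intro sum.cong refl)
      fix m
      have "x i * of_int (\<eta> i) * (of_nat (m choose i) * t ^ (m - i) * of_int (\<eta> i * \<eta> m) * ?D m)
          = (of_int (\<eta> i) * of_int (\<eta> i)) * (of_nat (m choose i) * t ^ (m - i) * x i * of_int (\<eta> m) * ?D m)"
        by (simp add: algebra_simps)
      then show "x i * of_int (\<eta> i) * (if i \<le> m then of_nat (m choose i) * t ^ (m - i) * of_int (\<eta> i * \<eta> m) * ?D m else 0)
          = (if i \<le> m then of_nat (m choose i) * t ^ (m - i) * x i else 0) * of_int (\<eta> m) * ?D m"
        unfolding \<eta>' by simp
    qed
  qed
  also have "\<dots> = stringv v \<eta> q (raising q t x) y"
    unfolding stringv_def raising_def by (subst sum.swap) (simp add: sum_distrib_right)
  finally show "mulv X (ur X N r t) (stringv v \<eta> q x) y = stringv v \<eta> q (raising q t x) y" .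
qed

lemma stringv_rev: "stringv v \<eta> q x = stringv (\<lambda>i. v (q - i)) (\<lambda>i. \<eta> (q - i)) q (\<lambda>i. x (q - i))"
  unfolding stringv_def
  by (rule ext, rule sum.reindex_bij_witness[where i = "\<lambda>i. q - i" and j = "\<lambda>i. q - i"]) auto

lemma stringv_cong: "(\<And>i. i \<le> q \<Longrightarrow> x i = x' i) \<Longrightarrow> stringv v \<eta> q x = stringv v \<eta> q x'"
  unfolding stringv_def by simp

text \<open>Read from its top, an r-string is a (-r)-string. The second family of constants in
  \<open>string_signs\<close> then plays the part of the first, so \<open>mulv_ur_chain\<close>
  yields the action of u_-r as well.\<close>

lemma string_action:
  assumes r: "r \<in> R" and s: "s \<in> R" "s \<noteq> r" "s \<noteq> vneg r"
  obtains v \<eta> q i where "s = v i" "i \<le> q" "q \<le> 3" "\<And>j. j \<le> q \<Longrightarrow> v j \<in> R"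
    "\<And>j. j \<le> q \<Longrightarrow> cint (v j) r = 2 * int j - int q"
    "\<And>j. \<eta> j * \<eta> j = (1::int)"
    "\<And>(t :: 'a :: field) x. mulv X (ur X N r t) (stringv v \<eta> q x) = stringv v \<eta> q (raising q t x)"
    "\<And>(t :: 'a :: field) x. mulv X (ur X N (vneg r) t) (stringv v \<eta> q x) = stringv v \<eta> q (lowering q t x)"
proof -
  obtain s0 q i where i: "s = vadd s0 (vsmul (int i) r)" "i \<le> q" and s0: "s0 \<in> R" "s0 \<noteq> r" "s0 \<noteq> vneg r"
    and iff: "\<And>j. vadd s0 (vsmul j r) \<in> R \<longleftrightarrow> 0 \<le> j \<and> j \<le> int q" and q: "q \<le> 3" and c: "cint s0 r = - int q"
    using string[OF r s] by metis
  define v where "v = (\<lambda>i::nat. vadd s0 (vsmul (int i) r))"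
  obtain \<eta> :: "nat \<Rightarrow> int" where \<eta>: "\<And>i. \<eta> i * \<eta> i = 1"
    and N1: "\<And>i. i < q \<Longrightarrow> N r (v i) = int (Suc i) * (\<eta> i * \<eta> (Suc i))"
    and N2: "\<And>i. i < q \<Longrightarrow> N (vneg r) (v (Suc i)) = int (q - i) * (\<eta> i * \<eta> (Suc i))"
    using string_signs[OF r s0 iff c] unfolding v_def by metis
  have v: "v j \<in> R" "v j \<noteq> r" "v j \<noteq> vneg r" if "j \<le> q" for j
    using iff[of "int j"] that line_neq[OF r s0, of "int j"] unfolding v_def by auto
  have vS: "vadd r (v j) = v (Suc j)" for j
    unfolding vadd_commute[of r] unfolding v_def vadd_vsmul_1 by (simp add: add.commute)
  have vS': "vadd (vneg r) (v (Suc j)) = v j" for j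
    unfolding vadd_commute[of "vneg r"] unfolding v_def vadd_vsmul_neg1 vadd_vsmul_add by simp
  have v0: "vadd (vneg r) (v 0) \<notin> R"
    unfolding vadd_commute[of "vneg r"] unfolding v_def vadd_vsmul_neg1 vadd_vsmul_add using iff[of "-1"] by simp
  have vq: "vadd r (v q) \<notin> R" unfolding vS unfolding v_def using iff[of "int (Suc q)"] by simp
  have cv: "cint (v j) r = 2 * int j - int q" for j
    unfolding v_def using cint_line[OF r r s0(1)] cint_self[OF r] c by simp
  have "inj_on v {..q}"
    using vadd_vsmul_inject[of s0 r] len[OF s0(1)] len[OF r] norm_pos[OF r] by (auto simp: inj_on_def v_def)
  then have "Suc q \<le> card B" using card_basis_ge[of "v ` {..q}"] v(1) by (auto simp: card_image)
  then have qB: "q \<le> card B" by simp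
  have up: "mulv X (ur X N r t) (stringv v \<eta> q x) = stringv v \<eta> q (raising q t x)" for t :: 'a and x
    by (rule mulv_ur_chain[OF r v(1,3) vS vq \<eta> N1 qB])
  have dn: "mulv X (ur X N (vneg r) t) (stringv v \<eta> q x) = stringv v \<eta> q (lowering q t x)" for t :: 'a and x
  proof -
    let ?v = "\<lambda>i. v (q - i)" and ?\<eta> = "\<lambda>i. \<eta> (q - i)"
    have nr: "vneg r \<in> R" using vneg_root[OF r] .
    have a: "?v j \<in> R" "?v j \<noteq> vneg (vneg r)" for j using v[of "q - j"] by auto
    have b: "vadd (vneg r) (?v j) = ?v (Suc j)" if "j < q" for j
      using vS'[of "q - Suc j"] that by (simp add: Suc_diff_Suc)
    have d: "N (vneg r) (?v j) = int (Suc j) * (?\<eta> j * ?\<eta> (Suc j))" if "j < q" for j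
      using N2[of "q - Suc j"] that by (simp add: Suc_diff_Suc mult.commute)
    have "mulv X (ur X N (vneg r) t) (stringv ?v ?\<eta> q (\<lambda>i. x (q - i))) = stringv ?v ?\<eta> q (raising q t (\<lambda>i. x (q - i)))"
      by (rule mulv_ur_chain[OF nr a b _ \<eta> d qB]) (use v0 in auto)
    also have "\<dots> = stringv v \<eta> q (lowering q t x)"
      unfolding stringv_rev[of v \<eta> q] by (rule stringv_cong) (simp add: lowering_def)
    finally show ?thesis unfolding stringv_rev[of v \<eta> q x] .
  qed
  show thesis by (rule that[of v i q \<eta>]) (use i q v cv \<eta> up dn in \<open>auto simp: v_def\<close>)
qed

end

section \<open>The semisimple elements \<open>h\<^sub>r(t)\<close> are diagonal\<close>

definition diagm :: "ctype \<Rightarrow> (vec \<Rightarrow> 'a :: field) \<Rightarrow> idx \<Rightarrow> idx \<Rightarrow> 'a" where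
  "diagm X \<chi> = (\<lambda>i j. if i = j \<and> i \<in> basis X then (case i of Inl s \<Rightarrow> \<chi> s | Inr _ \<Rightarrow> 1) else 0)"

text \<open>Elements x e_r + y e_-r + z with z in the Cartan part: the subspace left over when the
  r-strings are split off.\<close>

definition adjv :: "ctype \<Rightarrow> vec \<Rightarrow> 'a :: field \<Rightarrow> 'a \<Rightarrow> (vec \<Rightarrow> 'a) \<Rightarrow> idx \<Rightarrow> 'a" where
  "adjv X r x y z = (\<lambda>i. x * of_int (delta (Inl r) i) + y * of_int (delta (Inl (vneg r)) i)
     + (case i of Inl _ \<Rightarrow> 0 | Inr a \<Rightarrow> if a \<in> simple X then z a else 0))"

text \<open>\<open>units_of\<close> keeps the multiplication of the ambient monoid, so products in
  \<open>GLie\<close> can be computed for arbitrary matrices.\<close>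

lemma mult_GLie: "A \<otimes>\<^bsub>GLie X\<^esub> C = (\<lambda>i j. \<Sum>k\<in>basis X. A i k * C k j)"
  unfolding GLie_def units_of_def matmon_def by simp

lemma one_GLie: "\<one>\<^bsub>GLie X\<^esub> = diagm X (\<lambda>_. 1)"
  unfolding GLie_def units_of_def matmon_def diagm_def by (auto split: sum.splits intro!: ext)

lemma mulv_mult: "mulv X (A \<otimes>\<^bsub>GLie X\<^esub> C) v = mulv X A (mulv X C v)"
proof
  fix i
  have "mulv X (A \<otimes>\<^bsub>GLie X\<^esub> C) v i = (\<Sum>j\<in>basis X. \<Sum>k\<in>basis X. A i k * (C k j * v j))"
    unfolding mulv_def mult_GLie by (simp add: sum_distrib_right mult.assoc)
  also have "\<dots> = mulv X A (mulv X C v) i"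
    unfolding mulv_def by (subst sum.swap) (simp add: sum_distrib_left)
  finally show "mulv X (A \<otimes>\<^bsub>GLie X\<^esub> C) v i = mulv X A (mulv X C v) i" .
qed

context chevalley
begin

section \<open>The block spanned by e_r, e_-r and the Cartan part\<close>

lemma ipow_outside: "i \<notin> B \<or> j \<notin> B \<Longrightarrow> ipow X (adm X N r) k i j = 0"
  by (induction k arbitrary: i) (auto simp: imul_def adm_def)

lemma ur_outside: "i \<notin> B \<or> j \<notin> B \<Longrightarrow> ur X N r t i j = 0"
  unfolding ur_def divpow_def using ipow_outside by simp

lemma adm_self: "r \<in> R \<Longrightarrow> adm X N r y (Inl r) = 0"
proof -
  assume r: "r \<in> R"
  have "vadd r r = vsmul 2 r" by (auto intro!: nth_equalityI)
  then have "vadd r r \<notin> R" using multiple_root[OF r, of 2] by auto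
  then show ?thesis using vneg_neq[OF r] by (auto simp: adm_def)
qed

lemma adm_simple: "r \<in> R \<Longrightarrow> a \<in> simple X \<Longrightarrow> adm X N r y (Inr a) = - cint r a * delta (Inl r) y"
  by (auto simp: adm_def delta_def)

lemma adm_neg: "r \<in> R \<Longrightarrow> adm X N r y (Inl (vneg r)) = (case y of Inl _ \<Rightarrow> 0 | Inr a \<Rightarrow> if a \<in> simple X then coc X r a else 0)"
  using vneg_root by (auto simp: adm_def split: sum.splits)

lemma ipow_0: "j \<in> B \<Longrightarrow> ipow X (adm X N r) 0 y j = delta j y"
  by (auto simp: delta_def)

lemma ipow_1: "j \<in> B \<Longrightarrow> ipow X (adm X N r) (Suc 0) y j = adm X N r y j"
  by (simp add: imul_def fin_basis if_distrib cong: if_cong)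

lemma ipow_vanish: "(\<And>y. ipow X (adm X N r) k y j = 0) \<Longrightarrow> ipow X (adm X N r) (k + n) y j = 0"
  by (induction n arbitrary: y) (auto simp: imul_def)

lemma ur_cubic:
  fixes t :: "'a :: field"
  assumes r: "r \<in> R" and v: "\<And>y. ipow X (adm X N r) 3 y j = 0"
  shows "ur X N r t y j = of_int (divpow X N r 0 y j) + t * of_int (divpow X N r 1 y j) + t\<^sup>2 * of_int (divpow X N r 2 y j)"
proof -
  \<comment> \<open>Two opposite roots already make the basis large enough for \<open>ur\<close> to
    contain the exponents 0, 1 and 2.\<close>
  have "card {r, vneg r} \<le> card B" using r vneg_root[OF r] by (intro card_basis_ge) auto
  then have c: "2 \<le> card B" using vneg_neq[OF r] by (auto simp: card_insert_if split: if_splits)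
  have "divpow X N r k y j = 0" if "k \<notin> {..2}" for k
    unfolding divpow_def using ipow_vanish[OF v, of "k - 3" y] that by simp
  then have "ur X N r t y j = (\<Sum>k\<le>2. t ^ k * of_int (divpow X N r k y j))"
    unfolding ur_def using c by (intro sum.mono_neutral_right) auto
  then show ?thesis by (simp add: numeral_2_eq_2 lessThan_Suc_atMost[symmetric])
qed

lemma ur_col_self:
  fixes t :: "'a :: field"
  assumes r: "r \<in> R" shows "ur X N r t y (Inl r) = of_int (delta (Inl r) y)"
proof -
  have 1: "ipow X (adm X N r) (1 + n) y (Inl r) = 0" for n y
    using ipow_vanish[of r "Suc 0" "Inl r" n y] ipow_1[of "Inl r"] adm_self[OF r] r by simp
  show ?thesis using 1[of 0] 1[of 1] 1[of 2] ipow_0[of "Inl r" r y] r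
    by (subst ur_cubic[OF r]) (simp_all add: divpow_def numeral_eq_Suc del: ipow.simps)
qed

lemma ur_col_simple:
  fixes t :: "'a :: field"
  assumes r: "r \<in> R" and a: "a \<in> simple X"
  shows "ur X N r t y (Inr a) = of_int (delta (Inr a) y) - t * of_int (cint r a) * of_int (delta (Inl r) y)"
proof -
  have 1: "ipow X (adm X N r) (Suc 0) y (Inr a) = - cint r a * delta (Inl r) y" for y
    using ipow_1[of "Inr a"] adm_simple[OF r a] a by simp
  have "ipow X (adm X N r) (Suc (Suc 0)) y (Inr a) = - cint r a * (\<Sum>l\<in>B. delta (Inl r) l * adm X N r y l)" for y
    by (subst ipow.simps(2)) (simp add: imul_def 1 sum_distrib_left algebra_simps sum_negf del: ipow.simps)
  then have 2: "ipow X (adm X N r) (Suc (Suc 0)) y (Inr a) = 0" for y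
    using adm_self[OF r] r by (simp add: sum_delta_basis del: ipow.simps)
  have 3: "ipow X (adm X N r) 3 y (Inr a) = 0" for y
    using ipow_vanish[OF 2, of 1] by (simp add: numeral_3_eq_3 del: ipow.simps)
  show ?thesis using 1 2 ipow_0[of "Inr a" r y] a
    by (subst ur_cubic[OF r 3]) (simp add: divpow_def numeral_2_eq_2 del: ipow.simps)
qed

text \<open>e_-r goes to h_r, then to -2 e_r, then to 0. The 2 is absorbed by 2!, so the entry -t^2
  survives in characteristic 2.\<close>

lemma ur_col_neg:
  fixes t :: "'a :: field"
  assumes r: "r \<in> R"
  shows "ur X N r t y (Inl (vneg r)) = of_int (delta (Inl (vneg r)) y)
    + t * (case y of Inl _ \<Rightarrow> 0 | Inr a \<Rightarrow> if a \<in> simple X then of_int (coc X r a) else 0)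
    - t\<^sup>2 * of_int (delta (Inl r) y)"
proof -
  have nr: "vneg r \<in> R" using vneg_root r .
  have 1: "ipow X (adm X N r) (Suc 0) y (Inl (vneg r)) = (case y of Inl _ \<Rightarrow> 0 | Inr a \<Rightarrow> if a \<in> simple X then coc X r a else 0)" for y
    using ipow_1[of "Inl (vneg r)"] adm_neg[OF r] nr by simp
  have 2: "ipow X (adm X N r) (Suc (Suc 0)) y (Inl (vneg r)) = - 2 * delta (Inl r) y" for y
  proof -
    have "ipow X (adm X N r) (Suc (Suc 0)) y (Inl (vneg r)) = (\<Sum>a\<in>simple X. adm X N r y (Inr a) * coc X r a)"
      by (subst ipow.simps(2)) (simp add: imul_def 1 sum_basis del: ipow.simps)
    also have "\<dots> = - (\<Sum>a\<in>simple X. coc X r a * cint r a) * delta (Inl r) y"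
      by (simp add: adm_simple[OF r] sum_negf sum_distrib_left ac_simps)
    finally show ?thesis unfolding coc_cint[OF r r] cint_self[OF r] .
  qed
  have "ipow X (adm X N r) 3 y (Inl (vneg r)) = - 2 * (\<Sum>l\<in>B. delta (Inl r) l * adm X N r y l)" for y
    unfolding numeral_3_eq_3
    by (subst ipow.simps(2)) (simp add: imul_def 2 sum_distrib_left algebra_simps sum_negf del: ipow.simps)
  then have 3: "ipow X (adm X N r) 3 y (Inl (vneg r)) = 0" for y
    using adm_self[OF r] r by (simp add: sum_delta_basis del: ipow.simps)
  have half: "(- 2 * d) div 2 = - d" for d :: int by simp
  show ?thesis using 1 2 ipow_0[of "Inl (vneg r)" r y] nr half
    by (subst ur_cubic[OF r 3]) (simp add: divpow_def numeral_2_eq_2 del: ipow.simps split: sum.splits)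
qed

text \<open>The root r as a linear form, evaluated at the Cartan element with coordinates z.\<close>

definition adjval :: "vec \<Rightarrow> (vec \<Rightarrow> 'a :: field) \<Rightarrow> 'a" where
  "adjval r z = (\<Sum>a\<in>simple X. of_int (cint r a) * z a)"

lemma adjval_add: "adjval r (\<lambda>a. z a + c * of_int (coc X r a)) = adjval r z + 2 * c" if "r \<in> R"
proof -
  have "adjval r (\<lambda>a. z a + c * of_int (coc X r a)) = adjval r z + c * of_int (\<Sum>a\<in>simple X. coc X r a * cint r a)"
    unfolding adjval_def by (simp add: algebra_simps sum.distrib sum_distrib_left)
  then show ?thesis unfolding coc_cint[OF that that] cint_self[OF that] by simp
qed

lemma adjval_neg: "r \<in> R \<Longrightarrow> adjval (vneg r) z = - adjval r z"
  unfolding adjval_def using cint_neg_left[of _ r] simple_roots by (simp add: sum_negf[symmetric] subset_iff)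

lemma adjv_swap: "adjv X (vneg r) y x z = adjv X r x y z"
  unfolding adjv_def by (simp add: fun_eq_iff)

lemma mulv_ur_adjv:
  fixes t :: "'a :: field"
  assumes r: "r \<in> R"
  shows "mulv X (ur X N r t) (adjv X r x y z)
    = adjv X r (x - t * adjval r z - t\<^sup>2 * y) y (\<lambda>a. z a + t * y * of_int (coc X r a))"
proof
  fix i
  have nr: "vneg r \<in> R" using vneg_root r .
  have s1: "(\<Sum>j\<in>B. ur X N r t i j * (case j of Inl _ \<Rightarrow> 0 | Inr a \<Rightarrow> if a \<in> simple X then z a else 0))
      = (\<Sum>a\<in>simple X. ur X N r t i (Inr a) * z a)"
    unfolding sum_basis by simp
  have "mulv X (ur X N r t) (adjv X r x y z) i = x * (\<Sum>j\<in>B. ur X N r t i j * of_int (delta (Inl r) j))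
      + y * (\<Sum>j\<in>B. ur X N r t i j * of_int (delta (Inl (vneg r)) j)) + (\<Sum>a\<in>simple X. ur X N r t i (Inr a) * z a)"
    unfolding mulv_def adjv_def s1[symmetric] by (simp add: algebra_simps sum.distrib sum_distrib_left)
  also have "\<dots> = x * ur X N r t i (Inl r) + y * ur X N r t i (Inl (vneg r)) + (\<Sum>a\<in>simple X. ur X N r t i (Inr a) * z a)"
    using r nr by (simp add: sum_of_int_delta_basis)
  also have "(\<Sum>a\<in>simple X. ur X N r t i (Inr a) * z a)
      = (\<Sum>a\<in>simple X. of_int (delta (Inr a) i) * z a) - t * adjval r z * of_int (delta (Inl r) i)"
    by (simp add: ur_col_simple[OF r] adjval_def sum_subtractf sum_distrib_left sum_distrib_right algebra_simps)
  also have "(\<Sum>a\<in>simple X. of_int (delta (Inr a) i) * z a) = (case i of Inl _ \<Rightarrow> 0 | Inr a \<Rightarrow> if a \<in> simple X then z a else 0)"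
    by (cases i) (simp_all add: delta_def if_distrib if_distribR sum.delta fin_simple cong: if_cong)
  finally show "mulv X (ur X N r t) (adjv X r x y z) i
    = adjv X r (x - t * adjval r z - t\<^sup>2 * y) y (\<lambda>a. z a + t * y * of_int (coc X r a)) i"
    unfolding ur_col_self[OF r] ur_col_neg[OF r] adjv_def by (simp add: algebra_simps split: sum.splits)
qed

lemma mulv_ur_neg_adjv:
  fixes t :: "'a :: field"
  assumes r: "r \<in> R"
  shows "mulv X (ur X N (vneg r) t) (adjv X r x y z)
    = adjv X r x (y + t * adjval r z - t\<^sup>2 * x) (\<lambda>a. z a - t * x * of_int (coc X r a))"
  using mulv_ur_adjv[OF vneg_root[OF r], of t y x z]
  unfolding adjv_swap adjval_neg[OF r] coc_vneg[OF r] by simp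

text \<open>On this block n_r(t) exchanges the lines of e_r and e_-r and acts on the Cartan part as
  the reflection in r. \<open>y2\<close> and \<open>z2\<close> simplify the coordinates after the
  second factor, \<open>x3\<close> and \<open>z3\<close> those after the third.\<close>

lemma nr_adjv:
  fixes t :: "'a :: field"
  assumes r: "r \<in> R" and t: "t \<noteq> 0"
  shows "mulv X (nr X N r t) (adjv X r x y z)
    = adjv X r (- t\<^sup>2 * y) (- x / t\<^sup>2) (\<lambda>a. z a - adjval r z * of_int (coc X r a))"
proof -
  let ?c = "\<lambda>a. of_int (coc X r a) :: 'a"
  let ?l = "adjval r z"
  define x1 where "x1 = x - t * ?l - t\<^sup>2 * y"
  have A: "adjval r (\<lambda>a. z a + t * y * ?c a) = ?l + 2 * (t * y)"
    by (rule adjval_add[OF r])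
  have y2: "y + - inverse t * (?l + 2 * (t * y)) - (- inverse t)\<^sup>2 * x1 = - x / t\<^sup>2"
    unfolding x1_def using t by (simp add: field_simps power2_eq_square)
  have z2: "(\<lambda>a. z a + t * y * ?c a - - inverse t * x1 * ?c a) = (\<lambda>a. z a + (t * y + inverse t * x1) * ?c a)"
    by (simp add: algebra_simps)
  have x3: "x1 - t * (?l + 2 * (t * y + inverse t * x1)) - t\<^sup>2 * (- x / t\<^sup>2) = - t\<^sup>2 * y"
    unfolding x1_def using t by (simp add: field_simps power2_eq_square)
  have z3: "z a + t * y * ?c a - - inverse t * x1 * ?c a + t * (- x / t\<^sup>2) * ?c a = z a - ?l * ?c a" for a
  proof -
    have "t * y + inverse t * x1 + t * (- x / t\<^sup>2) = - ?l"
      unfolding x1_def using t by (simp add: field_simps power2_eq_square)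
    then have "(t * y + inverse t * x1 + t * (- x / t\<^sup>2)) * ?c a = - ?l * ?c a" by simp
    then show ?thesis by (simp add: algebra_simps)
  qed
  show ?thesis
    unfolding nr_def mulv_mult mulv_ur_adjv[OF r] mulv_ur_neg_adjv[OF r] A
    unfolding x1_def[symmetric] y2 z2 adjval_add[OF r] x3 z3 ..
qed

text \<open>n_r(t) and n_r(-1) act on the Cartan part by the same involution, which cancels; the
  scalars of the two exchanges multiply to t^2 and t^-2.\<close>

lemma hr_adjv:
  fixes t :: "'a :: field"
  assumes r: "r \<in> R" and t: "t \<noteq> 0"
  shows "mulv X (hr X N r t) (adjv X r x y z) = adjv X r (t\<^sup>2 * x) (inverse (t\<^sup>2) * y) z"
proof -
  have "adjval r (\<lambda>a. z a + (- adjval r z) * of_int (coc X r a)) = - adjval r z"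
    unfolding adjval_add[OF r] by simp
  then show ?thesis
    unfolding hr_def mulv_mult using nr_adjv[OF r, of "-1 :: 'a"] nr_adjv[OF r t] by (simp add: divide_inverse mult.commute)
qed

lemma nr_outside: "i \<notin> B \<or> j \<notin> B \<Longrightarrow> nr X N r t i j = 0"
  unfolding nr_def mult_GLie by (auto simp: ur_outside)

lemma hr_outside: "i \<notin> B \<or> j \<notin> B \<Longrightarrow> hr X N r t i j = 0"
  unfolding hr_def mult_GLie by (auto simp: nr_outside)

lemma mulv_delta: "j \<in> B \<Longrightarrow> mulv X M (\<lambda>k. of_int (delta j k)) i = M i j"
  unfolding mulv_def by (rule sum_of_int_delta_basis)

text \<open>The columns h_a, e_r and e_-r belong to the block of \<open>adjv\<close>; every other
  e_s is treated in its r-string, where h_r(t) is a product of two Weyl elements covered by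
  \<open>string_weyl\<close>.\<close>

lemma hr_diag:
  fixes t :: "'a :: field"
  assumes r: "r \<in> R" and t: "t \<noteq> 0"
  shows "hr X N r t = diagm X (\<lambda>s. t powi cint s r)"
proof (intro ext)
  fix i j
  have nr: "vneg r \<in> R" using vneg_root r .
  show "hr X N r t i j = diagm X (\<lambda>s. t powi cint s r) i j"
  proof (cases "j \<in> B")
    case False
    then show ?thesis using hr_outside by (auto simp: diagm_def)
  next
    case True
    consider a where "j = Inr a" "a \<in> simple X" | "j = Inl r" | "j = Inl (vneg r)"
      | s where "j = Inl s" "s \<in> R" "s \<noteq> r" "s \<noteq> vneg r"
      using True by (cases j) auto
    then show ?thesis
    proof cases
      case (1 a)
      have "(\<lambda>k. of_int (delta j k)) = adjv X r 0 0 (\<lambda>b. of_int (delta j (Inr b)) :: 'a)"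
        unfolding adjv_def using 1 by (auto simp: fun_eq_iff delta_def split: sum.splits)
      then have "hr X N r t i j = adjv X r 0 0 (\<lambda>b. of_int (delta j (Inr b)) :: 'a) i"
        using mulv_delta[OF True, of "hr X N r t" i] hr_adjv[OF r t] by simp
      then show ?thesis unfolding adjv_def diagm_def using 1 by (auto simp: delta_def split: sum.splits)
    next
      case 2
      have "(\<lambda>k. of_int (delta j k)) = adjv X r 1 0 (\<lambda>b. 0 :: 'a)"
        unfolding adjv_def using 2 by (auto simp: fun_eq_iff delta_def split: sum.splits)
      then have "hr X N r t i j = adjv X r (t\<^sup>2) 0 (\<lambda>b. 0 :: 'a) i"
        using mulv_delta[OF True, of "hr X N r t" i] hr_adjv[OF r t] by simp
      then show ?thesis unfolding adjv_def diagm_def using 2 r vneg_neq[OF r] cint_self[OF r]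
        by (auto simp: delta_def split: sum.splits)
    next
      case 3
      have "(\<lambda>k. of_int (delta j k)) = adjv X r 0 1 (\<lambda>b. 0 :: 'a)"
        unfolding adjv_def using 3 by (auto simp: fun_eq_iff delta_def split: sum.splits)
      then have "hr X N r t i j = adjv X r 0 (inverse (t\<^sup>2)) (\<lambda>b. 0 :: 'a) i"
        using mulv_delta[OF True, of "hr X N r t" i] hr_adjv[OF r t] by simp
      then show ?thesis unfolding adjv_def diagm_def using 3 r nr vneg_neq[OF r] cint_self[OF r] cint_neg_left[OF r r]
        by (auto simp: delta_def power_int_minus split: sum.splits)
    next
      case (4 s)
      obtain v \<eta> q m where m: "s = v m" "m \<le> q" "q \<le> 3" and v: "\<And>j. j \<le> q \<Longrightarrow> v j \<in> R"
        and c: "\<And>j. j \<le> q \<Longrightarrow> cint (v j) r = 2 * int j - int q"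
        and \<eta>: "\<And>j. \<eta> j * \<eta> j = (1::int)"
        and up: "\<And>(t :: 'a) x. mulv X (ur X N r t) (stringv v \<eta> q x) = stringv v \<eta> q (raising q t x)"
        and dn: "\<And>(t :: 'a) x. mulv X (ur X N (vneg r) t) (stringv v \<eta> q x) = stringv v \<eta> q (lowering q t x)"
        by (rule string_action[OF r 4(2-4)], rule that)
      have w: "mulv X (nr X N r t) (stringv v \<eta> q x)
          = stringv v \<eta> q (\<lambda>m. (-1) ^ (q - m) * t powi (2 * int m - int q) * x (q - m))"
        if "t \<noteq> 0" for t :: 'a and x
        unfolding nr_def mulv_mult up dn by (rule stringv_cong) (rule string_weyl[OF m(3) _ that])
      have h: "mulv X (hr X N r t) (stringv v \<eta> q x) = stringv v \<eta> q (\<lambda>m. t powi (2 * int m - int q) * x m)" for x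
      proof -
        have "mulv X (hr X N r t) (stringv v \<eta> q x) = stringv v \<eta> q (\<lambda>m. (-1) ^ (q - m) * t powi (2 * int m - int q) *
            ((-1) ^ (q - (q - m)) * (-1) powi (2 * int (q - m) - int q) * x (q - (q - m))))"
          unfolding hr_def mulv_mult using w[OF t] w[of "-1"] by simp
        also have "\<dots> = stringv v \<eta> q (\<lambda>m. t powi (2 * int m - int q) * x m)"
        proof (rule stringv_cong)
          fix k assume k: "k \<le> q"
          \<comment> \<open>The signs (-1)^(q-k) and (-1)^k of the two Weyl elements combine to
            (-1)^q, and the parameter -1 of the second contributes another (-1)^q.\<close>
          have "(-1 :: 'a) powi (2 * int (q - k) - int q) = (-1) ^ q"
            by (cases "even q") (simp_all add: power_int_diff power_int_mult)
          moreover have "(-1 :: 'a) ^ (q - k) * (-1) ^ k = (-1) ^ q" using k by (simp add: power_add[symmetric])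
          moreover have "(-1 :: 'a) ^ q * (-1) ^ q = 1" by (simp add: power_add[symmetric])
          moreover have "(-1) ^ (q - k) * t powi (2 * int k - int q) * ((-1) ^ k * (-1) powi (2 * int (q - k) - int q) * x k)
            = ((-1) ^ (q - k) * (-1) ^ k) * (-1) powi (2 * int (q - k) - int q) * (t powi (2 * int k - int q) * x k)"
            by (simp only: ac_simps)
          ultimately show "(-1) ^ (q - k) * t powi (2 * int k - int q) *
            ((-1) ^ (q - (q - k)) * (-1) powi (2 * int (q - k) - int q) * x (q - (q - k))) = t powi (2 * int k - int q) * x k"
            using k by simp
        qed
        finally show ?thesis .
      qed
      \<comment> \<open>In string coordinates e_s is \<eta>_m at position m, because \<eta>_m
        squares to 1.\<close>
      have sv: "stringv v \<eta> q (\<lambda>k. if k = m then c * of_int (\<eta> m) else 0) = (\<lambda>y. c * of_int (delta j y))" for c :: 'a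
      proof
        fix y
        have "stringv v \<eta> q (\<lambda>k. if k = m then c * of_int (\<eta> m) else 0) y
          = (\<Sum>k\<le>q. if k = m then c * of_int (\<eta> m) * of_int (\<eta> m) * of_int (delta (Inl (v m)) y) else 0)"
          unfolding stringv_def by (intro sum.cong) auto
        also have "\<dots> = c * of_int (\<eta> m * \<eta> m) * of_int (delta (Inl (v m)) y)" using m by (simp add: mult.assoc)
        finally show "stringv v \<eta> q (\<lambda>k. if k = m then c * of_int (\<eta> m) else 0) y = c * of_int (delta j y)"
          unfolding \<eta> using m 4 by simp
      qed
      have "hr X N r t i j = mulv X (hr X N r t) (stringv v \<eta> q (\<lambda>k. if k = m then 1 * of_int (\<eta> m) else 0)) i"
        unfolding sv using mulv_delta[OF True, of "hr X N r t" i] by simp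
      also have "\<dots> = stringv v \<eta> q (\<lambda>k. if k = m then t powi (2 * int m - int q) * of_int (\<eta> m) else 0) i"
        unfolding h by (rule fun_cong[OF stringv_cong]) auto
      also have "\<dots> = t powi cint s r * of_int (delta j i)" unfolding sv using c m by simp
      finally show ?thesis unfolding diagm_def using 4 by (auto simp: delta_def split: sum.splits)
    qed
  qed
qed

end

section \<open>The torus and its mixed subgroup\<close>

lemma powi_sum: "(t :: 'a :: field) \<noteq> 0 \<Longrightarrow> t powi (\<Sum>a\<in>A. f a) = (\<Prod>a\<in>A. t powi f a)"
  by (induction A rule: infinite_finite_induct) (auto simp: power_int_add)

lemma diagm_cong: "(\<And>s. s \<in> roots X \<Longrightarrow> \<chi> s = \<psi> s) \<Longrightarrow> diagm X \<chi> = diagm X \<psi>"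
  by (auto simp: diagm_def basis_def fun_eq_iff split: sum.splits)

lemma diagm_Inl: "s \<in> roots X \<Longrightarrow> diagm X \<chi> (Inl s) (Inl s) = \<chi> s"
  by (simp add: diagm_def basis_def)

definition wt :: "(vec \<Rightarrow> 'a :: field) \<Rightarrow> idx \<Rightarrow> 'a" where
  "wt \<chi> i = (case i of Inl s \<Rightarrow> \<chi> s | Inr _ \<Rightarrow> 1)"

lemma diagm_wt: "diagm X \<chi> i j = (if i = j \<and> i \<in> basis X then wt \<chi> i else 0)"
  by (auto simp: diagm_def wt_def)

lemma mult_diagm_left:
  "finite (basis X) \<Longrightarrow> (diagm X \<chi> \<otimes>\<^bsub>GLie X\<^esub> M) i j = (if i \<in> basis X then wt \<chi> i * M i j else 0)"
  unfolding mult_GLie diagm_wt by (simp add: if_distribR if_distrib cong: if_cong)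

lemma mult_diagm_right:
  "finite (basis X) \<Longrightarrow> (M \<otimes>\<^bsub>GLie X\<^esub> diagm X \<chi>) i j = (if j \<in> basis X then M i j * wt \<chi> j else 0)"
  unfolding mult_GLie diagm_wt by (simp add: if_distribR if_distrib cong: if_cong)

context rootdata
begin

text \<open>Value at the root s of the product of the h_a(u_a) over simple a; u is a point of the
  simply connected torus in the coordinates given by the simple coroots.\<close>

definition simpleprod :: "(vec \<Rightarrow> 'a :: field) \<Rightarrow> vec \<Rightarrow> 'a" where
  "simpleprod u s = (\<Prod>a\<in>simple X. u a powi cint s a)"

lemma simpleprod_nonzero: "(\<And>a. u a \<noteq> 0) \<Longrightarrow> simpleprod u s \<noteq> 0"
  unfolding simpleprod_def using fin_simple by (simp add: power_int_not_zero)

lemma simpleprod_vadd: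
  "(\<And>a. u a \<noteq> 0) \<Longrightarrow> r \<in> R \<Longrightarrow> s \<in> R \<Longrightarrow> simpleprod u (vadd r s) = simpleprod u r * simpleprod u s"
  unfolding simpleprod_def prod.distrib[symmetric] using simple_roots
  by (intro prod.cong refl) (auto simp: cint_vadd power_int_add)

lemma simpleprod_vneg: "r \<in> R \<Longrightarrow> simpleprod u (vneg r) = inverse (simpleprod u r)"
  unfolding simpleprod_def prod_inversef[symmetric] using simple_roots
  by (intro prod.cong refl) (auto simp: cint_neg_left power_int_minus)

lemma simpleprod_mult: "simpleprod (\<lambda>a. u a * u' a) s = simpleprod u s * simpleprod u' s"
  unfolding simpleprod_def prod.distrib[symmetric] by (simp add: power_int_mult_distrib)

lemma simpleprod_inverse: "simpleprod (\<lambda>a. inverse (u a)) = (\<lambda>s. inverse (simpleprod u s))"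
  unfolding simpleprod_def prod_inversef[symmetric] by (simp add: power_int_inverse)

text \<open>Expanding the coroot of r in simple coroots turns h_r(t) into a product of h_a(u_a) in
  which each u_a is a power of t.\<close>

lemma simpleprod_coc:
  "t \<noteq> 0 \<Longrightarrow> r \<in> R \<Longrightarrow> s \<in> R \<Longrightarrow> simpleprod (\<lambda>a. t powi coc X r a) s = t powi cint s r"
  unfolding simpleprod_def by (simp add: coc_cint[symmetric] powi_sum power_int_mult)

end

context chevalley
begin

lemma diagm_mult: "diagm X \<chi> \<otimes>\<^bsub>GLie X\<^esub> diagm X \<psi> = diagm X (\<lambda>s. \<chi> s * \<psi> s)"
  by (intro ext, subst mult_diagm_left[OF fin_basis]) (simp add: diagm_def wt_def split: sum.splits)

lemma diagm_inv_mult: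
  "(\<And>s. s \<in> R \<Longrightarrow> \<chi> s \<noteq> 0) \<Longrightarrow> diagm X \<chi> \<otimes>\<^bsub>GLie X\<^esub> diagm X (\<lambda>s. inverse (\<chi> s)) = \<one>\<^bsub>GLie X\<^esub>"
  "(\<And>s. s \<in> R \<Longrightarrow> \<chi> s \<noteq> 0) \<Longrightarrow> diagm X (\<lambda>s. inverse (\<chi> s)) \<otimes>\<^bsub>GLie X\<^esub> diagm X \<chi> = \<one>\<^bsub>GLie X\<^esub>"
  unfolding diagm_mult one_GLie by (rule diagm_cong, simp)+

lemma diagm_carrier:
  assumes "\<And>s. s \<in> R \<Longrightarrow> \<chi> s \<noteq> 0" shows "diagm X \<chi> \<in> carrier (GLie X)"
proof -
  have c: "diagm X \<psi> \<in> carrier (matmon X)" for \<psi> :: "vec \<Rightarrow> 'a"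
    by (auto simp: matmon_def diagm_def)
  have e: "mult (GLie X) = mult (matmon X :: (idx \<Rightarrow> idx \<Rightarrow> 'a) monoid)" "\<one>\<^bsub>GLie X\<^esub> = \<one>\<^bsub>matmon X :: (idx \<Rightarrow> idx \<Rightarrow> 'a) monoid\<^esub>"
    by (simp_all add: GLie_def units_of_def)
  have "diagm X \<chi> \<in> Units (matmon X)"
    unfolding Units_def using c diagm_inv_mult[of \<chi>, OF assms] unfolding e by blast
  then show ?thesis by (simp add: GLie_def units_of_def)
qed

text \<open>\<open>m_inv\<close> is a definite description, so uniqueness has to be shown. A
  diagonal factor rescales the rows of a competing M by nonzero weights, which fixes them, and
  membership in the carrier makes M vanish outside the basis.\<close>

lemma diagm_inv:
  assumes nz: "\<And>s. s \<in> R \<Longrightarrow> \<chi> s \<noteq> 0"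
  shows "inv\<^bsub>GLie X\<^esub> (diagm X \<chi>) = diagm X (\<lambda>s. inverse (\<chi> s))"
  unfolding m_inv_def
proof (rule the_equality)
  show "diagm X (\<lambda>s. inverse (\<chi> s)) \<in> carrier (GLie X) \<and>
    diagm X \<chi> \<otimes>\<^bsub>GLie X\<^esub> diagm X (\<lambda>s. inverse (\<chi> s)) = \<one>\<^bsub>GLie X\<^esub> \<and>
    diagm X (\<lambda>s. inverse (\<chi> s)) \<otimes>\<^bsub>GLie X\<^esub> diagm X \<chi> = \<one>\<^bsub>GLie X\<^esub>"
    using diagm_inv_mult[of \<chi>, OF nz] diagm_carrier[of "\<lambda>s. inverse (\<chi> s)"] nz by simp
next
  fix M assume M: "M \<in> carrier (GLie X) \<and> diagm X \<chi> \<otimes>\<^bsub>GLie X\<^esub> M = \<one>\<^bsub>GLie X\<^esub> \<and> M \<otimes>\<^bsub>GLie X\<^esub> diagm X \<chi> = \<one>\<^bsub>GLie X\<^esub>"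
  show "M = diagm X (\<lambda>s. inverse (\<chi> s))"
  proof (intro ext)
    fix i j
    have "M \<in> carrier (matmon X)" using M by (auto simp: GLie_def units_of_def Units_def)
    then have o: "i \<notin> B \<Longrightarrow> M i j = 0" by (auto simp: matmon_def)
    have w: "i \<in> B \<Longrightarrow> wt \<chi> i \<noteq> 0" using nz by (auto simp: wt_def split: sum.splits)
    have "i \<in> B \<Longrightarrow> wt \<chi> i * M i j = diagm X (\<lambda>_. 1) i j"
      using M mult_diagm_left[OF fin_basis, of \<chi> M i j] by (simp add: one_GLie)
    then show "M i j = diagm X (\<lambda>s. inverse (\<chi> s)) i j"
      using o w by (cases "i \<in> B") (auto simp: diagm_def wt_def field_simps split: sum.splits if_splits)
  qed
qed

text \<open>Multiplicativity along sums of roots, as far as these are roots; this is what makes ad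
  e_r homogeneous for the weights.\<close>

definition character :: "(vec \<Rightarrow> 'a :: field) \<Rightarrow> bool" where
  "character \<chi> \<longleftrightarrow> (\<forall>s\<in>R. \<chi> s \<noteq> 0 \<and> \<chi> (vneg s) = inverse (\<chi> s))
     \<and> (\<forall>r\<in>R. \<forall>s\<in>R. vadd r s \<in> R \<longrightarrow> \<chi> (vadd r s) = \<chi> r * \<chi> s)"

lemma simpleprod_character: "(\<And>a. u a \<noteq> 0) \<Longrightarrow> character (simpleprod u)"
  unfolding character_def using simpleprod_nonzero[of u] simpleprod_vadd[of u] simpleprod_vneg by blast

lemma adm_weight:
  assumes \<chi>: "character \<chi>" and r: "r \<in> R" and nz: "adm X N r i j \<noteq> 0"
  shows "wt \<chi> i = \<chi> r * wt \<chi> j"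
proof -
  have ij: "i \<in> B" "j \<in> B" and b: "brb X N (Inl r) j i \<noteq> 0" using nz by (auto simp: adm_def split: if_splits)
  have c: "\<chi> r \<noteq> 0" "\<chi> (vneg r) = inverse (\<chi> r)" using \<chi> r unfolding character_def by auto
  show ?thesis
  proof (cases j)
    case (Inl s)
    then show ?thesis
      using b c \<chi> r ij by (auto simp: wt_def delta_def character_def split: if_splits sum.splits)
  next
    case (Inr a)
    then show ?thesis using b by (auto simp: wt_def delta_def split: if_splits)
  qed
qed

lemma ipow_weight:
  assumes \<chi>: "character \<chi>" and r: "r \<in> R" and nz: "ipow X (adm X N r) k i j \<noteq> 0"
  shows "wt \<chi> i = \<chi> r ^ k * wt \<chi> j"
  using nz
proof (induction k arbitrary: i)
  case 0
  then show ?case by (simp split: if_splits)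
next
  case (Suc k)
  then obtain l where "adm X N r i l \<noteq> 0" "ipow X (adm X N r) k l j \<noteq> 0"
    by (auto simp: imul_def elim!: sum.not_neutral_contains_not_neutral)
  then show ?case using Suc.IH adm_weight[OF \<chi> r] by simp
qed

text \<open>A nonzero entry of (ad e_r)^k connects basis vectors whose weights differ by the k-th
  power of \<chi> r, so conjugation multiplies the coefficient of t^k by just this power.\<close>

lemma conj_ur:
  assumes \<chi>: "character \<chi>" and r: "r \<in> R"
  shows "diagm X \<chi> \<otimes>\<^bsub>GLie X\<^esub> ur X N r t \<otimes>\<^bsub>GLie X\<^esub> inv\<^bsub>GLie X\<^esub> (diagm X \<chi>) = ur X N r (\<chi> r * t)"
proof (intro ext)
  fix i j
  have nz: "\<And>s. s \<in> R \<Longrightarrow> \<chi> s \<noteq> 0" using \<chi> unfolding character_def by simp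
  have iv: "inv\<^bsub>GLie X\<^esub> (diagm X \<chi>) = diagm X (\<lambda>s. inverse (\<chi> s))" by (rule diagm_inv[OF nz])
  have w: "wt (\<lambda>s. inverse (\<chi> s)) j = inverse (wt \<chi> j)" by (simp add: wt_def split: sum.splits)
  have L: "(diagm X \<chi> \<otimes>\<^bsub>GLie X\<^esub> ur X N r t \<otimes>\<^bsub>GLie X\<^esub> inv\<^bsub>GLie X\<^esub> (diagm X \<chi>)) i j
     = (if i \<in> B \<and> j \<in> B then wt \<chi> i * ur X N r t i j * inverse (wt \<chi> j) else 0)"
    unfolding iv mult_diagm_right[OF fin_basis] mult_diagm_left[OF fin_basis] w by simp
  show "(diagm X \<chi> \<otimes>\<^bsub>GLie X\<^esub> ur X N r t \<otimes>\<^bsub>GLie X\<^esub> inv\<^bsub>GLie X\<^esub> (diagm X \<chi>)) i j = ur X N r (\<chi> r * t) i j"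
  proof (cases "i \<in> B \<and> j \<in> B")
    case True
    then have wj: "wt \<chi> j \<noteq> 0" using nz by (auto simp: wt_def split: sum.splits)
    have e: "(\<chi> r * t) ^ k * of_int (divpow X N r k i j) = wt \<chi> i * (t ^ k * of_int (divpow X N r k i j)) * inverse (wt \<chi> j)" for k
    proof (cases "ipow X (adm X N r) k i j = 0")
      case False
      show ?thesis unfolding ipow_weight[OF \<chi> r False] using wj by (simp add: field_simps)
    qed (simp add: divpow_def)
    have "wt \<chi> i * ur X N r t i j * inverse (wt \<chi> j) = ur X N r (\<chi> r * t) i j"
      unfolding ur_def e by (simp add: sum_distrib_left sum_distrib_right)
    then show ?thesis unfolding L using True by simp
  qed (auto simp: L ur_outside)
qed

text \<open>Induction over \<open>generate\<close> with a property \<open>Q\<close> of the weight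
  function. The matrix fixes this function only on roots, hence the existential quantifier.\<close>

lemma torus_like_generate:
  assumes H: "\<And>M. M \<in> H \<Longrightarrow> \<exists>\<chi>. M = diagm X \<chi> \<and> (\<forall>s\<in>R. \<chi> s \<noteq> 0) \<and> Q \<chi>"
    and one: "Q (\<lambda>_. 1)" and mult: "\<And>\<chi> \<psi>. Q \<chi> \<Longrightarrow> Q \<psi> \<Longrightarrow> Q (\<lambda>s. \<chi> s * \<psi> s)"
    and inv: "\<And>\<chi>. Q \<chi> \<Longrightarrow> Q (\<lambda>s. inverse (\<chi> s))"
    and M: "M \<in> generate (GLie X) H"
  shows "\<exists>\<chi>. M = diagm X \<chi> \<and> (\<forall>s\<in>R. \<chi> s \<noteq> 0) \<and> Q \<chi>"
  using M
proof (induction rule: generate.induct)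
  case one
  show ?case using \<open>Q (\<lambda>_. 1)\<close> by (intro exI[of _ "\<lambda>_. 1"]) (simp add: one_GLie)
next
  case (incl h)
  then show ?case by (rule H)
next
  case (inv h)
  then obtain \<chi> where "h = diagm X \<chi>" "\<forall>s\<in>R. \<chi> s \<noteq> 0" "Q \<chi>" using H by blast
  then show ?case using assms(4)[of \<chi>] by (intro exI[of _ "\<lambda>s. inverse (\<chi> s)"]) (simp add: diagm_inv)
next
  case (eng h1 h2)
  then obtain \<chi> \<psi> where "h1 = diagm X \<chi>" "\<forall>s\<in>R. \<chi> s \<noteq> 0" "Q \<chi>" "h2 = diagm X \<psi>" "\<forall>s\<in>R. \<psi> s \<noteq> 0" "Q \<psi>"
    by blast
  then show ?case using mult[of \<chi> \<psi>] by (intro exI[of _ "\<lambda>s. \<chi> s * \<psi> s"]) (simp add: diagm_mult)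
qed

lemma simpleprod_generate:
  assumes u: "\<And>a. u a \<noteq> 0" and H: "\<And>a. a \<in> simple X \<Longrightarrow> hr X N a (u a) \<in> H"
  shows "diagm X (simpleprod u) \<in> generate (GLie X) H"
proof -
  have "diagm X (\<lambda>s. \<Prod>a\<in>A. u a powi cint s a) \<in> generate (GLie X) H" if "finite A" "A \<subseteq> simple X" for A
    using that
  proof (induction A)
    case empty
    show ?case using generate.one[of "GLie X" H] by (simp add: one_GLie)
  next
    case (insert a A)
    then have "hr X N a (u a) \<in> generate (GLie X) H" using H by (intro generate.incl) auto
    moreover have "hr X N a (u a) = diagm X (\<lambda>s. u a powi cint s a)"
      using insert simple_roots u by (intro hr_diag) auto
    ultimately have "diagm X (\<lambda>s. u a powi cint s a) \<otimes>\<^bsub>GLie X\<^esub> diagm X (\<lambda>s. \<Prod>a\<in>A. u a powi cint s a) \<in> generate (GLie X) H"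
      using insert by (intro generate.eng) auto
    then show ?case using insert.hyps unfolding diagm_mult by simp
  qed
  from this[OF fin_simple] show ?thesis unfolding simpleprod_def[abs_def] by simp
qed

text \<open>Every h_r(t) has this form by \<open>simpleprod_coc\<close>, and the form is stable
  under products and inverses; conversely the h_a with a simple produce all such matrices.\<close>

lemma torus_iff: "M \<in> torus X N \<longleftrightarrow> (\<exists>u :: vec \<Rightarrow> 'a :: field. (\<forall>a. u a \<noteq> 0) \<and> M = diagm X (simpleprod u))"
proof
  assume M: "M \<in> torus X N"
  let ?Q = "\<lambda>\<chi>. \<exists>u :: vec \<Rightarrow> 'a. (\<forall>a. u a \<noteq> 0) \<and> (\<forall>s\<in>R. \<chi> s = simpleprod u s)"
  have "\<exists>\<chi>. M = diagm X \<chi> \<and> (\<forall>s\<in>R. \<chi> s \<noteq> 0) \<and> ?Q \<chi>"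
  proof (rule torus_like_generate[OF _ _ _ _ M[unfolded torus_def]])
    fix M :: "idx \<Rightarrow> idx \<Rightarrow> 'a" assume "M \<in> {hr X N r t |r t. r \<in> R \<and> t \<noteq> 0}"
    then obtain r t where rt: "M = hr X N r t" "r \<in> R" "t \<noteq> 0" by blast
    show "\<exists>\<chi>. M = diagm X \<chi> \<and> (\<forall>s\<in>R. \<chi> s \<noteq> 0) \<and> ?Q \<chi>"
    proof (rule exI[of _ "\<lambda>s. t powi cint s r"], intro exI[of _ "\<lambda>a. t powi coc X r a"] conjI ballI allI)
      show "M = diagm X (\<lambda>s. t powi cint s r)" using hr_diag rt by simp
      show "t powi coc X r a \<noteq> 0" for a using rt by (simp add: power_int_not_zero)
    qed (use rt in \<open>auto simp: simpleprod_coc power_int_not_zero\<close>)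
  next
    show "?Q (\<lambda>_. 1)" by (intro exI[of _ "\<lambda>_. 1"]) (simp add: simpleprod_def)
  next
    fix \<chi> \<psi> assume "?Q \<chi>" "?Q \<psi>"
    then obtain u w :: "vec \<Rightarrow> 'a" where "\<forall>a. u a \<noteq> 0" "\<forall>s\<in>R. \<chi> s = simpleprod u s" "\<forall>a. w a \<noteq> 0" "\<forall>s\<in>R. \<psi> s = simpleprod w s"
      by blast
    then show "?Q (\<lambda>s. \<chi> s * \<psi> s)" by (intro exI[of _ "\<lambda>a. u a * w a"]) (simp add: simpleprod_mult)
  next
    fix \<chi> assume "?Q \<chi>"
    then obtain u :: "vec \<Rightarrow> 'a" where "\<forall>a. u a \<noteq> 0" "\<forall>s\<in>R. \<chi> s = simpleprod u s" by blast
    then show "?Q (\<lambda>s. inverse (\<chi> s))" by (intro exI[of _ "\<lambda>a. inverse (u a)"]) (simp add: simpleprod_inverse)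
  qed
  then obtain \<chi> u where "M = diagm X \<chi>" "\<forall>a. u a \<noteq> (0 :: 'a)" "\<forall>s\<in>R. \<chi> s = simpleprod u s" by blast
  then show "\<exists>u. (\<forall>a. u a \<noteq> 0) \<and> M = diagm X (simpleprod u)" using diagm_cong[of X \<chi> "simpleprod u"] by auto
next
  assume "\<exists>u :: vec \<Rightarrow> 'a. (\<forall>a. u a \<noteq> 0) \<and> M = diagm X (simpleprod u)"
  then obtain u :: "vec \<Rightarrow> 'a" where u: "\<And>a. u a \<noteq> 0" "M = diagm X (simpleprod u)" by blast
  show "M \<in> torus X N"
    unfolding torus_def u(2) by (rule simpleprod_generate[OF u(1)]) (use u(1) simple_roots in blast)
qed

end

definition mixed_torus_gens :: "ctype \<Rightarrow> (vec \<Rightarrow> vec \<Rightarrow> int) \<Rightarrow> 'a :: field set \<Rightarrow> (idx \<Rightarrow> idx \<Rightarrow> 'a) set" where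
  "mixed_torus_gens X N K = {hr X N r t | r t. long_root X r \<and> t \<in> K \<and> t \<noteq> 0} \<union> {hr X N r t | r t. short_root X r \<and> t \<noteq> 0}"

definition mixed_root_gens :: "ctype \<Rightarrow> (vec \<Rightarrow> vec \<Rightarrow> int) \<Rightarrow> 'a :: field set \<Rightarrow> (idx \<Rightarrow> idx \<Rightarrow> 'a) set" where
  "mixed_root_gens X N K = {ur X N r s | r s. long_root X r \<and> s \<in> K} \<union> {ur X N r t | r t. short_root X r}"

locale mixed = chevalley +
  fixes K :: "'a :: field set"
  assumes K: "subfield K" and char_p: "of_int p = (0 :: 'a)" and frob: "x ^ nat p \<in> K"
begin

section \<open>Values in K and the two criteria for generation\<close>

lemma K_closed: "0 \<in> K" "1 \<in> K" "x \<in> K \<Longrightarrow> y \<in> K \<Longrightarrow> x + y \<in> K" "x \<in> K \<Longrightarrow> y \<in> K \<Longrightarrow> x * y \<in> K"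
  "x \<in> K \<Longrightarrow> - x \<in> K" "x \<in> K \<Longrightarrow> inverse x \<in> K"
  using K unfolding subfield_def by auto

lemma K_power: "x \<in> K \<Longrightarrow> x ^ n \<in> K"
  by (induction n) (auto intro: K_closed)

lemma K_powi: "x \<in> K \<Longrightarrow> x powi n \<in> K"
  unfolding power_int_def by (auto intro: K_power K_closed)

lemma K_powi_dvd: "p dvd n \<Longrightarrow> x powi n \<in> K"
proof -
  assume "p dvd n"
  then obtain k where k: "n = p * k" by blast
  have "x powi p \<in> K" using frob[of x] p_pos by (simp add: power_int_def)
  then have "(x powi p) powi k \<in> K" by (rule K_powi)
  then show ?thesis unfolding k by (simp add: power_int_mult)
qed

lemma K_prod: "(\<And>a. a \<in> A \<Longrightarrow> f a \<in> K) \<Longrightarrow> prod f A \<in> K"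
  by (induction A rule: infinite_finite_induct) (auto intro: K_closed)

lemma K_cancel: "x * y \<in> K \<Longrightarrow> y \<in> K \<Longrightarrow> y \<noteq> 0 \<Longrightarrow> x \<in> K"
  using K_closed(4)[of "x * y" "inverse y"] K_closed(6)[of y] by (simp add: mult.assoc)

text \<open>Makes the scalar described by \<open>rootval\<close> unique. The entries t <r,a> do not
  suffice in characteristic 2: for r = 2 e_i in C_n all <r,a> are even. There the entry -t^2 is
  used, squaring being injective. In characteristic 3 some <r,a> is prime to 3, because the
  coefficients of the coroot of r combine these numbers to <r,r> = 2.\<close>

lemma ur_inject:
  assumes r: "r \<in> R" and eq: "ur X N r c = ur X N r (c' :: 'a)" shows "c = c'"
  using p_cases
proof
  assume "p = 2"
  then have two: "(1 :: 'a) + 1 = 0" using char_p by simp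
  have "c\<^sup>2 = c'\<^sup>2"
    using fun_cong[OF fun_cong[OF eq, of "Inl r"], of "Inl (vneg r)"] vneg_neq[OF r]
    unfolding ur_col_neg[OF r] by (simp add: delta_def)
  moreover have "(c - c') * (c - c') = c\<^sup>2 - c'\<^sup>2 - (1 + 1) * (c * c' - c'\<^sup>2)"
    by (simp add: algebra_simps power2_eq_square)
  ultimately show ?thesis unfolding two by simp
next
  assume p: "p = 3"
  have "\<exists>a\<in>simple X. \<not> 3 dvd cint r a"
  proof (rule ccontr)
    assume "\<not> ?thesis"
    then have "3 dvd (\<Sum>a\<in>simple X. coc X r a * cint r a)" by (intro dvd_sum) auto
    then show False unfolding coc_cint[OF r r] cint_self[OF r] by simp
  qed
  then obtain a where a: "a \<in> simple X" "\<not> 3 dvd cint r a" by blast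
  have "of_int (cint r a) \<noteq> (0 :: 'a)"
  proof
    assume z: "of_int (cint r a) = (0 :: 'a)"
    define k where "k = cint r a div 3"
    have "cint r a mod 3 = 1 \<or> cint r a mod 3 = 2" using a(2) by presburger
    then have "cint r a = 3 * k + 1 \<or> cint r a = 3 * (k + 1) - 1" unfolding k_def by presburger
    moreover have "of_int (3 * x) = (0 :: 'a)" for x using char_p p by (simp only: of_int_mult) simp
    ultimately show False using z by (metis add_0 diff_0 of_int_1 of_int_add of_int_diff neg_equal_0_iff_equal zero_neq_one)
  qed
  moreover have "c * of_int (cint r a) = c' * of_int (cint r a)"
    using fun_cong[OF fun_cong[OF eq, of "Inl r"], of "Inr a"] unfolding ur_col_simple[OF r a(1)]
    by (simp add: delta_def)
  ultimately show ?thesis by simp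
qed

lemma rootval_diagm:
  assumes \<chi>: "character \<chi>" and r: "r \<in> R" shows "rootval X N r (diagm X \<chi>) = (\<chi> r :: 'a)"
  unfolding rootval_def conj_ur[OF \<chi> r]
proof (rule the_equality)
  fix c assume "\<forall>t. ur X N r (\<chi> r * t) = ur X N r (c * t)"
  from this[rule_format, of 1] show "c = \<chi> r" using ur_inject[OF r] by simp
qed simp

lemma TKL_iff: "M \<in> TKL X N K \<longleftrightarrow>
  (\<exists>u. (\<forall>a. u a \<noteq> 0) \<and> (\<forall>s. long_root X s \<longrightarrow> simpleprod u s \<in> K) \<and> M = diagm X (simpleprod u))"
proof -
  have "rootval X N r (diagm X (simpleprod u)) = simpleprod u r" if "long_root X r" "\<forall>a. u a \<noteq> 0" for r and u :: "vec \<Rightarrow> 'a"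
    using that by (intro rootval_diagm simpleprod_character) (auto simp: long_iff)
  then show ?thesis unfolding TKL_def torus_iff mem_Collect_eq by (metis (no_types, lifting))
qed

abbreviation torus_gens where "torus_gens \<equiv> mixed_torus_gens X N K"
abbreviation root_gens where "root_gens \<equiv> mixed_root_gens X N K"

lemma torus_gensE:
  assumes "M \<in> torus_gens"
  obtains r t where "M = hr X N r t" "r \<in> R" "t \<noteq> 0" "long_root X r \<and> t \<in> K \<or> short_root X r"
  using assms unfolding mixed_torus_gens_def long_iff short_iff by blast

lemma torus_gens_generate:
  assumes H: "\<And>r t. r \<in> R \<Longrightarrow> t \<noteq> 0 \<Longrightarrow> long_root X r \<and> t \<in> K \<or> short_root X r \<Longrightarrow> Q (\<lambda>s. t powi cint s r)"
    and one: "Q (\<lambda>_. 1)" and mult: "\<And>\<chi> \<psi>. Q \<chi> \<Longrightarrow> Q \<psi> \<Longrightarrow> Q (\<lambda>s. \<chi> s * \<psi> s)"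
    and inv: "\<And>\<chi>. Q \<chi> \<Longrightarrow> Q (\<lambda>s. inverse (\<chi> s))"
    and M: "M \<in> generate (GLie X) torus_gens"
  shows "\<exists>\<chi>. M = diagm X \<chi> \<and> Q \<chi>"
proof -
  have "\<exists>\<chi>. M = diagm X \<chi> \<and> (\<forall>s\<in>R. \<chi> s \<noteq> 0) \<and> Q \<chi>"
  proof (rule torus_like_generate[OF _ one mult inv M])
    fix M assume "M \<in> torus_gens"
    then obtain r t where rt: "M = hr X N r t" "r \<in> R" "t \<noteq> 0" "long_root X r \<and> t \<in> K \<or> short_root X r"
      by (rule torus_gensE)
    then show "\<exists>\<chi>. M = diagm X \<chi> \<and> (\<forall>s\<in>R. \<chi> s \<noteq> 0) \<and> Q \<chi>"
      using hr_diag[of r t] H[of r t] by (intro exI[of _ "\<lambda>s. t powi cint s r"]) (simp add: power_int_not_zero)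
  qed
  then show ?thesis by blast
qed

lemma generate_torus: "generate (GLie X) torus_gens \<subseteq> torus X N"
proof
  fix M assume "M \<in> generate (GLie X) torus_gens"
  then show "M \<in> torus X N"
  proof (induction rule: generate.induct)
    case (incl h)
    then show ?case unfolding torus_def by (intro generate.incl) (blast elim: torus_gensE)
  next
    case (inv h)
    then show ?case unfolding torus_def by (intro generate.inv) (blast elim: torus_gensE)
  qed (auto simp: torus_def intro: generate.one generate.eng)
qed

text \<open>For long r the parameter itself lies in K, and for short r the exponent at a long root
  is divisible by p.\<close>

lemma generate_TKL: "generate (GLie X) torus_gens \<subseteq> TKL X N K"
proof
  fix M assume M: "M \<in> generate (GLie X) torus_gens"
  have "\<exists>\<chi>. M = diagm X \<chi> \<and> (\<forall>s. long_root X s \<longrightarrow> \<chi> s \<in> K)"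
  proof (rule torus_gens_generate[OF _ _ _ _ M])
    fix r t assume "r \<in> R" "(t :: 'a) \<noteq> 0" and rt: "long_root X r \<and> t \<in> K \<or> short_root X r"
    show "\<forall>s. long_root X s \<longrightarrow> t powi cint s r \<in> K"
      using rt K_powi K_powi_dvd cint_long_short by blast
  qed (auto intro: K_closed)
  then obtain \<chi> where \<chi>: "M = diagm X \<chi>" "\<forall>s. long_root X s \<longrightarrow> \<chi> s \<in> K" by blast
  moreover obtain u where u: "\<forall>a. u a \<noteq> 0" "M = diagm X (simpleprod u)"
    using M generate_torus torus_iff by blast
  moreover have "\<chi> s = simpleprod u s" if "s \<in> R" for s
    using diagm_Inl[OF that, of \<chi>] diagm_Inl[OF that, of "simpleprod u"] \<chi> u by simp
  ultimately show "M \<in> TKL X N K" unfolding TKL_iff using long_iff by metis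
qed

text \<open>Under this assumption the product of the h_a(u_a) over simple a is already a product of
  generators, since the parameters at short a are unrestricted.\<close>

lemma TKL_generated:
  assumes "\<And>u a. \<lbrakk>\<And>a. u a \<noteq> 0; \<And>s. long_root X s \<Longrightarrow> simpleprod u s \<in> K; a \<in> simple X; long_root X a\<rbrakk> \<Longrightarrow> u a \<in> K"
  shows "TKL X N K = generate (GLie X) torus_gens"
proof
  show "TKL X N K \<subseteq> generate (GLie X) torus_gens"
  proof
    fix M assume "M \<in> TKL X N K"
    then obtain u where u: "\<And>a. u a \<noteq> 0" "\<And>s. long_root X s \<Longrightarrow> simpleprod u s \<in> K" "M = diagm X (simpleprod u)"
      unfolding TKL_iff by blast
    show "M \<in> generate (GLie X) torus_gens" unfolding u(3)
    proof (rule simpleprod_generate[OF u(1)])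
      fix a assume a: "a \<in> simple X"
      show "hr X N a (u a) \<in> torus_gens"
      proof (cases "long_root X a")
        case True
        then show ?thesis using assms[OF u(1,2) a] u(1) unfolding mixed_torus_gens_def by blast
      next
        case False
        then have "short_root X a" using a simple_roots unfolding short_root_def by auto
        then show ?thesis using u(1) unfolding mixed_torus_gens_def by blast
      qed
    qed
  qed
qed (rule generate_TKL)

text \<open>\<open>Q\<close> is an invariant of all generated elements that the element given by
  \<open>u\<close> violates. It is refuted for every \<chi> that agrees with
  \<open>simpleprod u\<close> on roots, because the matrix sees nothing else.\<close>

lemma TKL_not_generated:
  assumes u: "\<And>a. u a \<noteq> 0" "\<And>s. long_root X s \<Longrightarrow> simpleprod u s \<in> K"
    and H: "\<And>r t. r \<in> R \<Longrightarrow> t \<noteq> 0 \<Longrightarrow> long_root X r \<and> t \<in> K \<or> short_root X r \<Longrightarrow> Q (\<lambda>s. t powi cint s r)"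
    and one: "Q (\<lambda>_. 1)" and mult: "\<And>\<chi> \<psi>. Q \<chi> \<Longrightarrow> Q \<psi> \<Longrightarrow> Q (\<lambda>s. \<chi> s * \<psi> s)"
    and inv: "\<And>\<chi>. Q \<chi> \<Longrightarrow> Q (\<lambda>s. inverse (\<chi> s))"
    and nQ: "\<And>\<chi>. \<lbrakk>\<And>s. s \<in> R \<Longrightarrow> \<chi> s = simpleprod u s\<rbrakk> \<Longrightarrow> \<not> Q \<chi>"
  shows "TKL X N K \<noteq> generate (GLie X) torus_gens"
proof
  assume eq: "TKL X N K = generate (GLie X) torus_gens"
  have "diagm X (simpleprod u) \<in> TKL X N K" unfolding TKL_iff using u by blast
  then obtain \<chi> where \<chi>: "diagm X (simpleprod u) = diagm X \<chi>" "Q \<chi>"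
    unfolding eq using torus_gens_generate[of Q, OF H one mult inv] by blast
  have "\<chi> s = simpleprod u s" if "s \<in> R" for s
    using diagm_Inl[OF that, of \<chi>] diagm_Inl[OF that, of "simpleprod u"] \<chi> by simp
  then show False using nQ \<chi> by blast
qed

lemma nr_root_gens:
  assumes "t \<noteq> 0" "long_root X r \<and> t \<in> K \<or> short_root X r"
  shows "nr X N r t \<in> generate (GLie X) root_gens"
proof -
  have r: "r \<in> R" using assms long_iff short_iff by blast
  then have n: "vneg r \<in> R" "ip (vneg r) (vneg r) = ip r r" using vneg_root by (auto simp: ip_linear)
  have "ur X N r t \<in> root_gens" using assms unfolding mixed_root_gens_def by blast
  moreover have "long_root X (vneg r) \<and> - inverse t \<in> K \<or> short_root X (vneg r)"
    using assms(2) n K_closed unfolding long_iff short_iff by metis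
  then have "ur X N (vneg r) (- inverse t) \<in> root_gens" unfolding mixed_root_gens_def by blast
  ultimately show ?thesis unfolding nr_def by (intro generate.eng generate.incl)
qed

lemma generate_torus_root: "generate (GLie X) torus_gens \<subseteq> generate (GLie X) root_gens"
proof
  have H: "M \<in> generate (GLie X) root_gens" if "M \<in> torus_gens" for M
  proof -
    obtain r t where rt: "M = hr X N r t" "r \<in> R" "t \<noteq> 0" "long_root X r \<and> t \<in> K \<or> short_root X r"
      by (rule torus_gensE[OF \<open>M \<in> torus_gens\<close>])
    have "long_root X r \<and> - 1 \<in> K \<or> short_root X r" using rt K_closed by blast
    then show ?thesis unfolding rt hr_def using rt by (intro generate.eng nr_root_gens) auto
  qed
  fix M assume "M \<in> generate (GLie X) torus_gens"
  then show "M \<in> generate (GLie X) root_gens"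
  proof (induction rule: generate.induct)
    case (inv h)
    \<comment> \<open>Writing h as a product of root elements does not place its inverse in a set
      built by \<open>generate\<close> from inverses of single generators. The inverse is therefore
      recognised as h_r(1/t), again a generator.\<close>
    obtain r t where rt: "h = hr X N r t" "r \<in> R" "t \<noteq> 0" "long_root X r \<and> t \<in> K \<or> short_root X r"
      by (rule torus_gensE[OF inv])
    have "inv\<^bsub>GLie X\<^esub> h = hr X N r (inverse t)"
      using rt(2,3) unfolding rt(1) by (simp add: hr_diag diagm_inv power_int_not_zero power_int_inverse)
    moreover have "hr X N r (inverse t) \<in> torus_gens"
      using rt K_closed(6)[of t] inverse_nonzero_iff_nonzero unfolding mixed_torus_gens_def by blast
    ultimately show ?case using H by simp
  qed (auto intro: generate.one generate.eng H)
qed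

text \<open>T(K,L) consists of products of root elements because each h_r does. To drop it from the
  generating set, the inverses of its elements must be such products too; they are, T(K,L) being
  closed under inverses.\<close>

lemma XKL_generated:
  assumes eq: "TKL X N K = generate (GLie X) torus_gens"
  shows "XKL X N K = generate (GLie X) root_gens"
proof -
  have XKL: "XKL X N K = generate (GLie X) (TKL X N K \<union> root_gens)"
    unfolding XKL_def mixed_root_gens_def by (simp add: Un_assoc)
  have T: "TKL X N K \<subseteq> generate (GLie X) root_gens" using eq generate_torus_root by simp
  have "inv\<^bsub>GLie X\<^esub> h \<in> TKL X N K" if "h \<in> TKL X N K" for h
  proof -
    obtain u where u: "\<forall>a. u a \<noteq> 0" "\<forall>s. long_root X s \<longrightarrow> simpleprod u s \<in> K" "h = diagm X (simpleprod u)"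
      using \<open>h \<in> TKL X N K\<close> unfolding TKL_iff by blast
    then have "inv\<^bsub>GLie X\<^esub> h = diagm X (simpleprod (\<lambda>a. inverse (u a)))"
      by (simp add: diagm_inv simpleprod_nonzero simpleprod_inverse)
    then show ?thesis unfolding TKL_iff using u K_closed(6)
      by (intro exI[of _ "\<lambda>a. inverse (u a)"]) (auto simp: simpleprod_inverse)
  qed
  then have inv: "inv\<^bsub>GLie X\<^esub> h \<in> generate (GLie X) root_gens" if "h \<in> TKL X N K \<union> root_gens" for h
    using that T by (auto intro: generate.inv)
  show ?thesis unfolding XKL
  proof
    show "generate (GLie X) (TKL X N K \<union> root_gens) \<subseteq> generate (GLie X) root_gens"
    proof
      fix M assume "M \<in> generate (GLie X) (TKL X N K \<union> root_gens)"
      then show "M \<in> generate (GLie X) root_gens"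
        by (induction rule: generate.induct) (use T inv in \<open>auto intro: generate.intros\<close>)
    qed
    show "generate (GLie X) root_gens \<subseteq> generate (GLie X) (TKL X N K \<union> root_gens)"
    proof
      fix M assume "M \<in> generate (GLie X) root_gens"
      then show "M \<in> generate (GLie X) (TKL X N K \<union> root_gens)"
        by (induction rule: generate.induct) (auto intro: generate.intros)
    qed
  qed
qed

end

section \<open>Types \<open>B\<^sub>n\<close> and \<open>C\<^sub>n\<close>\<close>

lemma sum_squares_eq_1:
  fixes f :: "'b \<Rightarrow> int"
  assumes "finite A" "(\<Sum>k\<in>A. f k * f k) = 1"
  obtains i where "i \<in> A" "f i = 1 \<or> f i = -1" "\<And>k. k \<in> A \<Longrightarrow> k \<noteq> i \<Longrightarrow> f k = 0"
proof -
  obtain i where i: "i \<in> A" "f i \<noteq> 0"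
    using assms by (metis (no_types, lifting) mult_zero_left sum.neutral zero_neq_one)
  have s: "f i * f i + (\<Sum>k\<in>A - {i}. f k * f k) = 1" using assms i by (simp add: sum.remove)
  have "0 \<le> (\<Sum>k\<in>A - {i}. f k * f k)" by (intro sum_nonneg) simp
  moreover have "0 < f i * f i" using i by (metis not_square_less_zero linorder_neqE_linordered_idom mult_eq_0_iff)
  ultimately have 1: "f i * f i = 1" "(\<Sum>k\<in>A - {i}. f k * f k) = 0" using s by linarith+
  then have "\<forall>k\<in>A - {i}. f k * f k = 0" using assms(1) by (subst (asm) sum_nonneg_eq_0_iff) auto
  then show thesis using that[OF i(1)] 1 by (auto simp: square_eq_1_iff)
qed

lemma sum_squares_eq_2:
  fixes f :: "'b \<Rightarrow> int"
  assumes "finite A" "(\<Sum>k\<in>A. f k * f k) = 2"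
  obtains i j where "i \<in> A" "j \<in> A" "i \<noteq> j" "f i = 1 \<or> f i = -1" "f j = 1 \<or> f j = -1"
    "\<And>k. k \<in> A \<Longrightarrow> k \<noteq> i \<Longrightarrow> k \<noteq> j \<Longrightarrow> f k = 0"
proof -
  obtain i where i: "i \<in> A" "f i \<noteq> 0"
    using assms by (metis (no_types, lifting) mult_zero_left sum.neutral zero_neq_numeral)
  have s: "f i * f i + (\<Sum>k\<in>A - {i}. f k * f k) = 2" using assms i by (simp add: sum.remove)
  have ge: "0 \<le> (\<Sum>k\<in>A - {i}. f k * f k)" by (intro sum_nonneg) simp
  have "\<bar>f i\<bar> = 1"
  proof (rule ccontr)
    assume "\<bar>f i\<bar> \<noteq> 1"
    then have "2 \<le> \<bar>f i\<bar>" using i by linarith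
    then have "2 * 2 \<le> \<bar>f i\<bar> * \<bar>f i\<bar>" by (intro mult_mono) auto
    then show False using s ge by simp
  qed
  then have fi: "f i = 1 \<or> f i = -1" by linarith
  then have "(\<Sum>k\<in>A - {i}. f k * f k) = 1" using s by auto
  then obtain j where "j \<in> A - {i}" "f j = 1 \<or> f j = -1" "\<And>k. k \<in> A - {i} \<Longrightarrow> k \<noteq> j \<Longrightarrow> f k = 0"
    using sum_squares_eq_1[of "A - {i}" f] assms(1) by blast
  then show thesis using that[of i j] i fi by auto
qed

lemma ip_unitv_left: "i < n \<Longrightarrow> length v = n \<Longrightarrow> ip (unitv n i) v = v ! i"
  by (subst ip_conv_sum[of _ n]) (auto simp: if_distrib if_distribR sum.delta' cong: if_cong)

lemma norm_1_cases:
  assumes "length v = n" "ip v v = 1"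
  obtains a i where "a \<in> {1, -1}" "i < n" "v = vsmul a (unitv n i)"
proof -
  have "(\<Sum>k\<in>{..<n}. v ! k * v ! k) = 1" using ip_conv_sum[OF assms(1,1)] assms(2) by simp
  then obtain i where i: "i < n" "v ! i = 1 \<or> v ! i = -1" "\<And>k. k < n \<Longrightarrow> k \<noteq> i \<Longrightarrow> v ! k = 0"
    using sum_squares_eq_1[of "{..<n}" "\<lambda>k. v ! k"] by auto
  have "v = vsmul (v ! i) (unitv n i)" using i(1,3) assms(1) by (auto intro!: nth_equalityI)
  then show thesis using that[of "v ! i" i] i by auto
qed

lemma norm_2_cases:
  assumes "length v = n" "ip v v = 2"
  obtains a b i j where "a \<in> {1, -1}" "b \<in> {1, -1}" "i < j" "j < n"
    "v = vadd (vsmul a (unitv n i)) (vsmul b (unitv n j))"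
proof -
  have "(\<Sum>k\<in>{..<n}. v ! k * v ! k) = 2" using ip_conv_sum[OF assms(1,1)] assms(2) by simp
  then obtain i j where ij: "i < n" "j < n" "i \<noteq> j" "v ! i = 1 \<or> v ! i = -1" "v ! j = 1 \<or> v ! j = -1"
      "\<And>k. k < n \<Longrightarrow> k \<noteq> i \<Longrightarrow> k \<noteq> j \<Longrightarrow> v ! k = 0"
    using sum_squares_eq_2[of "{..<n}" "\<lambda>k. v ! k"] by auto
  have "v = vadd (vsmul (v ! i) (unitv n i)) (vsmul (v ! j) (unitv n j))"
    "v = vadd (vsmul (v ! j) (unitv n j)) (vsmul (v ! i) (unitv n i))"
    using ij(1-3,6) assms(1) by (auto intro!: nth_equalityI)
  then show thesis using that[of "v ! i" "v ! j" i j] that[of "v ! j" "v ! i" j i] ij by (metis insertI1 insertI2 linorder_neqE_nat)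
qed

text \<open>As the set of all integer vectors of norm 1 or 2, the roots are stable under reflections
  simply because these preserve norms and integrality.\<close>

lemma roots_TB: "roots (TB n) = {v. length v = n \<and> (ip v v = 1 \<or> ip v v = 2)}"
proof (intro equalityI subsetI)
  fix v assume "v \<in> roots (TB n)"
  then show "v \<in> {v. length v = n \<and> (ip v v = 1 \<or> ip v v = 2)}"
    by (auto simp: ip_linear ip_unitv_left)
next
  fix v assume v: "v \<in> {v. length v = n \<and> (ip v v = 1 \<or> ip v v = 2)}"
  then show "v \<in> roots (TB n)"
    using norm_1_cases[of v n "v \<in> roots (TB n)"] norm_2_cases[of v n "v \<in> roots (TB n)"] by fastforce
qed

lemma even_vec:
  assumes "\<forall>k<length v. even (v ! k :: int)" obtains w where "v = vsmul 2 w"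
proof
  show "v = vsmul 2 (map (\<lambda>x. x div 2) v)" using assms by (auto intro!: nth_equalityI)
qed

text \<open>The evenness condition excludes the vectors of norm 4 that have four entries 1 or
  -1.\<close>

lemma roots_TC: "roots (TC n) = {v. length v = n \<and> (ip v v = 2 \<or> ip v v = 4 \<and> (\<forall>k<n. even (v ! k)))}"
proof (intro equalityI subsetI)
  fix v assume "v \<in> roots (TC n)"
  then show "v \<in> {v. length v = n \<and> (ip v v = 2 \<or> ip v v = 4 \<and> (\<forall>k<n. even (v ! k)))}"
    by (auto simp: ip_linear ip_unitv_left)
next
  fix v assume v: "v \<in> {v. length v = n \<and> (ip v v = 2 \<or> ip v v = 4 \<and> (\<forall>k<n. even (v ! k)))}"
  then consider "length v = n" "ip v v = 2" | "length v = n" "ip v v = 4" "\<forall>k<n. even (v ! k)" by auto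
  then show "v \<in> roots (TC n)"
  proof cases
    case 1
    then show ?thesis using norm_2_cases[of v n "v \<in> roots (TC n)"] by fastforce
  next
    case 2
    then obtain w where w: "v = vsmul 2 w" using even_vec[of v] by auto
    then have "ip w w = 1" "length w = n" using 2 by (auto simp: ip_linear)
    then obtain a i where a: "a \<in> {1, -1}" "i < n" "w = vsmul a (unitv n i)" using norm_1_cases by metis
    then have "v = vsmul (2 * a) (unitv n i)" unfolding w by (auto intro!: nth_equalityI)
    then show ?thesis using a by auto
  qed
qed

declare roots.simps [simp del] simple.simps [simp del]

text \<open>8 is the largest norm that occurs in B_n, C_n and F_4, that of a long root of F_4 in
  doubled coordinates.\<close>

lemma finite_bounded_norm: "finite {v. length v = n \<and> ip v v \<le> 8}"
proof (rule finite_subset)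
  show "{v. length v = n \<and> ip v v \<le> 8} \<subseteq> {v. set v \<subseteq> {-2..2} \<and> length v = n}"
  proof safe
    fix v :: vec and x assume v: "ip v v \<le> 8" "x \<in> set v" "n = length v"
    then obtain k where k: "k < length v" "x = v ! k" by (metis in_set_conv_nth)
    have "v ! k * v ! k \<le> (\<Sum>k<length v. v ! k * v ! k)"
      using k by (intro member_le_sum[of k]) auto
    then have "x * x \<le> 8" using v k ip_conv_sum[of v "length v" v] by simp
    then have "\<bar>x\<bar> < 3"
      using abs_le_square_iff[of 3 x] by (simp add: power2_eq_square)
    then show "x \<in> {-2..2}" by auto
  qed
  show "finite {v :: vec. set v \<subseteq> {-2..2} \<and> length v = n}" by (rule finite_lists_length_eq) simp
qed

lemma norm_reflect:
  assumes "length s = length r" "c * ip r r = 2 * ip s r"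
  shows "ip (vadd s (vsmul (- c) r)) (vadd s (vsmul (- c) r)) = ip s s"
proof -
  have "ip (vadd s (vsmul (- c) r)) (vadd s (vsmul (- c) r)) = ip s s - c * (2 * ip s r) + c * (c * ip r r)"
    using assms(1) ip_commute[of r s] by (simp add: ip_linear algebra_simps)
  then show ?thesis unfolding assms(2) by simp
qed

text \<open>An integer and its square have the same parity, so the norm of a root decides the parity
  of its coordinate sum.\<close>

lemma even_sum_squares: "even (\<Sum>k\<in>A. f k :: int) \<longleftrightarrow> even (\<Sum>k\<in>A. f k * f k)"
proof -
  have "even (\<Sum>k\<in>A. f k * f k - f k)" by (rule dvd_sum) simp
  then show ?thesis by (simp add: sum_subtractf)
qed

text \<open>The simple roots of \<open>B\<^sub>n\<close> (for \<open>e = 1\<close>) and \<open>C\<^sub>n\<close> (for \<open>e = 2\<close>).\<close>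
definition csimple :: "int \<Rightarrow> nat \<Rightarrow> nat \<Rightarrow> vec" where
  "csimple e n i = (if Suc i < n then vadd (unitv n i) (vneg (unitv n (Suc i))) else vsmul e (unitv n i))"

lemma length_csimple [simp]: "length (csimple e n i) = n"
  by (simp add: csimple_def)

lemma ip_csimple:
  "i < n \<Longrightarrow> length v = n \<Longrightarrow> ip (csimple e n i) v = (if Suc i < n then v ! i - v ! Suc i else e * v ! i)"
  by (simp add: csimple_def ip_linear ip_unitv_left)

lemma nth_csimple: "k < n \<Longrightarrow> csimple e n i ! k = (if Suc i < n then of_bool (k = i) - of_bool (k = Suc i) else e * of_bool (k = i))"
  by (auto simp: csimple_def)

lemma norm_csimple: "i < n \<Longrightarrow> ip (csimple e n i) (csimple e n i) = (if Suc i < n then 2 else e * e)"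
  by (simp add: ip_csimple nth_csimple)

lemma simple_TB: "n \<ge> 1 \<Longrightarrow> simple (TB n) = csimple 1 n ` {..<n}"
proof -
  assume n: "n \<ge> 1"
  have "vsmul 1 v = v" for v by (auto intro!: nth_equalityI)
  moreover have "{..<n} = {i. Suc i < n} \<union> {n - 1}" using n by auto
  ultimately show ?thesis using n by (auto simp: csimple_def image_Un image_def simple.simps)
qed

lemma simple_TC: "n \<ge> 1 \<Longrightarrow> simple (TC n) = csimple 2 n ` {..<n}"
proof -
  assume n: "n \<ge> 1"
  moreover have "{..<n} = {i. Suc i < n} \<union> {n - 1}" using n by auto
  ultimately show ?thesis by (auto simp: csimple_def image_Un image_def simple.simps)
qed

text \<open>The vector e_0 + ... + e_i, up to a factor the i-th fundamental weight: it is orthogonal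
  to all simple roots but the i-th.\<close>

definition partialv :: "nat \<Rightarrow> nat \<Rightarrow> vec" where
  "partialv n i = map (\<lambda>k. if k \<le> i then 1 else 0) [0..<n]"

lemma ip_csimple_partialv:
  "i < n \<Longrightarrow> j < n \<Longrightarrow> ip (csimple e n j) (partialv n i) = (if i = j then if Suc i < n then 1 else e else 0)"
  by (auto simp: ip_csimple partialv_def)

lemma inj_csimple: "e \<noteq> 0 \<Longrightarrow> inj_on (csimple e n) {..<n}"
  by (rule inj_onI) (metis ip_csimple_partialv lessThan_iff zero_neq_one)

text \<open>Summation by parts: the i-th coefficient is the i-th partial sum of the coordinates of
  the coroot of r. The last simple coroot is 2/e times a unit vector, whence the factor e/2
  there.\<close>

lemma csimple_coroot:
  assumes r: "length r = n" and e: "e \<noteq> 0"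
    and int: "\<And>i. i < n \<Longrightarrow> \<exists>c :: int. of_int c = ((if Suc i < n then 1 else of_int e / 2) * (2 * of_int (\<Sum>k\<le>i. r ! k) / of_int (ip r r)) :: rat)"
  shows "\<exists>c :: vec \<Rightarrow> int. \<forall>k<n. (\<Sum>a\<in>csimple e n ` {..<n}. of_int (c a) * (2 * of_int (a ! k) / of_int (ip a a)))
         = (2 * of_int (r ! k) / of_int (ip r r) :: rat)"
proof -
  obtain C :: "nat \<Rightarrow> int" where C: "\<And>i. i < n \<Longrightarrow> of_int (C i) = ((if Suc i < n then 1 else of_int e / 2) * (2 * of_int (\<Sum>k\<le>i. r ! k) / of_int (ip r r)) :: rat)"
    using int by metis
  define c where "c a = C (inv_into {..<n} (csimple e n) a)" for a
  have c: "c (csimple e n i) = C i" if "i < n" for i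
    unfolding c_def using inv_into_f_f[OF inj_csimple[OF e], of i n] that by simp
  define Q :: "nat \<Rightarrow> rat" where "Q i = 2 * of_int (\<Sum>k\<le>i. r ! k) / of_int (ip r r)" for i
  have "(\<Sum>a\<in>csimple e n ` {..<n}. of_int (c a) * (2 * of_int (a ! k) / of_int (ip a a)))
         = (2 * of_int (r ! k) / of_int (ip r r) :: rat)" if k: "k < n" for k
  proof -
    have "(\<Sum>a\<in>csimple e n ` {..<n}. of_int (c a) * (2 * of_int (a ! k) / of_int (ip a a)) :: rat)
       = (\<Sum>i<n. of_int (C i) * (2 * of_int (csimple e n i ! k) / of_int (ip (csimple e n i) (csimple e n i))))"
      by (subst sum.reindex[OF inj_csimple[OF e]]) (simp add: c)
    also have "\<dots> = (\<Sum>i<n. (if i = k then Q i else 0) - (if Suc i = k then Q i else 0))"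
    proof (intro sum.cong refl)
      fix i assume "i \<in> {..<n}"
      then have i: "i < n" by simp
      show "of_int (C i) * (2 * of_int (csimple e n i ! k) / of_int (ip (csimple e n i) (csimple e n i)))
         = (if i = k then Q i else 0) - (if Suc i = k then Q i else 0)"
        using i k e unfolding C[OF i] norm_csimple[OF i] nth_csimple[OF k] Q_def[symmetric]
        by (auto simp: field_simps)
    qed
    also have "\<dots> = Q k - (if k = 0 then 0 else Q (k - 1))"
      using k by (cases k) (simp_all add: sum_subtractf)
    also have "\<dots> = 2 * of_int (r ! k) / of_int (ip r r)"
      unfolding Q_def by (cases k) (simp_all add: diff_divide_distrib[symmetric] algebra_simps)
    finally show ?thesis .
  qed
  then show ?thesis by blast
qed

lemma simple_dual_csimple:
  assumes "e \<noteq> 0" "a \<in> csimple e n ` {..<n}"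
  shows "\<exists>w. length w = n \<and> ip a w \<noteq> 0 \<and> (\<forall>b\<in>csimple e n ` {..<n}. b \<noteq> a \<longrightarrow> ip b w = 0)"
proof -
  obtain i where i: "i < n" "a = csimple e n i" using assms by auto
  then show ?thesis using assms(1) ip_csimple_partialv[of i n _ e]
    by (intro exI[of _ "partialv n i"]) (auto simp: partialv_def)
qed

lemma of_int_div_exact: "b dvd a \<Longrightarrow> (of_int (a div b) :: rat) = of_int a / of_int b"
  by (auto elim!: dvdE)

lemma rootdata_TB: "n \<ge> 2 \<Longrightarrow> rootdata (TB n) 2 1"
proof
  assume n: "n \<ge> 2"
  note S = simple_TB[of n]
  show "finite (roots (TB n))" by (rule finite_subset[OF _ finite_bounded_norm[of n]]) (auto simp: roots_TB)
  show "ip r r dvd 2 * ip s r" if "r \<in> roots (TB n)" for r s using that unfolding roots_TB by auto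
  then have c: "cint s r * ip r r = 2 * ip s r" if "r \<in> roots (TB n)" for r s
    using that unfolding cint_def by simp
  show "vadd s (vsmul (- cint s r) r) \<in> roots (TB n)" if "r \<in> roots (TB n)" "s \<in> roots (TB n)" for r s
    using norm_reflect[of s r "cint s r", OF _ c[OF that(1)]] that unfolding roots_TB by simp
  show "\<exists>r\<in>roots (TB n). ip r r = 2 * 1"
    using n by (intro bexI[of _ "vadd (unitv n 0) (unitv n 1)"]) (auto simp: roots_TB ip_linear ip_unitv_left)
  show "finite (simple (TB n))" "simple (TB n) \<subseteq> roots (TB n)"
    using S n by (auto simp: roots_TB norm_csimple)
  show "\<exists>c :: vec \<Rightarrow> int. \<forall>k<dimv (TB n). (\<Sum>a\<in>simple (TB n). of_int (c a) * (2 * of_int (a ! k) / of_int (ip a a)))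
         = (2 * of_int (r ! k) / of_int (ip r r) :: rat)" if r: "r \<in> roots (TB n)" for r
  proof -
    have "\<exists>c. of_int c = (if Suc i < n then 1 else of_int 1 / 2) * (2 * of_int (\<Sum>k\<le>i. r ! k) / rat_of_int (ip r r))"
      if i: "i < n" for i
    proof (cases "Suc i < n \<or> ip r r = 1")
      case True
      then have "ip r r dvd (if Suc i < n then 2 else 1) * (\<Sum>k\<le>i. r ! k)" using r by (auto simp: roots_TB)
      then show ?thesis
        by (intro exI[of _ "((if Suc i < n then 2 else 1) * (\<Sum>k\<le>i. r ! k)) div ip r r"]) (simp add: of_int_div_exact)
    next
      case False
      then have r2: "ip r r = 2" "{..i} = {..<n}" "length r = n" using r i by (auto simp: roots_TB)
      \<comment> \<open>For a long root the last coefficient is half the full coordinate sum, which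
        is even because the norm 2 is.\<close>
      then have "even (\<Sum>k\<le>i. r ! k)" using ip_conv_sum[of r n r] by (simp add: even_sum_squares[of "nth r"])
      then show ?thesis using False r2
        by (intro exI[of _ "(\<Sum>k\<le>i. r ! k) div 2"]) (simp add: of_int_div_exact del: of_int_sum)
    qed
    moreover have "length r = n" using r by (simp add: roots_TB)
    ultimately have "\<exists>c :: vec \<Rightarrow> int. \<forall>k<n. (\<Sum>a\<in>csimple 1 n ` {..<n}. of_int (c a) * (2 * of_int (a ! k) / of_int (ip a a)))
         = (2 * of_int (r ! k) / of_int (ip r r) :: rat)"
      by (intro csimple_coroot) auto
    then show ?thesis using S n by simp
  qed
  show "\<exists>w. length w = dimv (TB n) \<and> ip a w \<noteq> 0 \<and> (\<forall>b\<in>simple (TB n). b \<noteq> a \<longrightarrow> ip b w = 0)" if "a \<in> simple (TB n)" for a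
    using simple_dual_csimple[of 1 a n] that S n by simp
qed (auto simp: roots_TB)

lemma rootdata_TC: "n \<ge> 2 \<Longrightarrow> rootdata (TC n) 2 2"
proof
  assume n: "n \<ge> 2"
  note S = simple_TC[of n]
  show "finite (roots (TC n))" by (rule finite_subset[OF _ finite_bounded_norm[of n]]) (auto simp: roots_TC)
  have ev: "even (ip s r)" if "length s = n" "length r = n" "\<forall>k<n. even (r ! k)" for r s
    unfolding ip_conv_sum[OF that(1,2)] using that by (intro dvd_sum) auto
  show i: "ip r r dvd 2 * ip s r" if rs: "r \<in> roots (TC n)" "s \<in> roots (TC n)" for r s
  proof (cases "ip r r = 2")
    case False
    then have "ip r r = 4" "even (ip s r)" using rs ev[of s r] unfolding roots_TC by auto
    then show ?thesis by auto
  qed simp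
  then have c: "cint s r * ip r r = 2 * ip s r" if "r \<in> roots (TC n)" "s \<in> roots (TC n)" for r s
    using that unfolding cint_def by simp
  show "vadd s (vsmul (- cint s r) r) \<in> roots (TC n)" if rs: "r \<in> roots (TC n)" "s \<in> roots (TC n)" for r s
  proof -
    have l: "length r = n" "length s = n" using rs by (auto simp: roots_TC)
    have nm: "ip (vadd s (vsmul (- cint s r) r)) (vadd s (vsmul (- cint s r) r)) = ip s s"
      using norm_reflect[of s r "cint s r", OF _ c[OF rs]] l by simp
    \<comment> \<open>Long roots must keep even coordinates: for short r the integer <s,r> equals
      the inner product of s and r, even for even s, and a long r is itself even.\<close>
    have "even (vadd s (vsmul (- cint s r) r) ! k)" if k: "k < n" and s: "\<forall>k<n. even (s ! k)" for k
    proof (cases "ip r r = 2")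
      case True
      have "even (cint s r)" using c[OF rs] ev[OF l s] ip_commute[of s r] l True by simp
      then show ?thesis using k s l by simp
    next
      case False
      then have "\<forall>k<n. even (r ! k)" using rs by (auto simp: roots_TC)
      then show ?thesis using k s l by simp
    qed
    then show ?thesis using nm rs unfolding roots_TC by auto
  qed
  show "\<exists>r\<in>roots (TC n). ip r r = 2 * 2"
    using n by (intro bexI[of _ "vsmul 2 (unitv n 0)"]) (auto simp: roots_TC ip_linear ip_unitv_left)
  show "finite (simple (TC n))" "simple (TC n) \<subseteq> roots (TC n)"
    using S n by (auto simp: roots_TC norm_csimple nth_csimple)
  show "\<exists>c :: vec \<Rightarrow> int. \<forall>k<dimv (TC n). (\<Sum>a\<in>simple (TC n). of_int (c a) * (2 * of_int (a ! k) / of_int (ip a a)))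
         = (2 * of_int (r ! k) / of_int (ip r r) :: rat)" if r: "r \<in> roots (TC n)" for r
  proof -
    have "\<exists>c. of_int c = (if Suc i < n then 1 else of_int 2 / 2) * (2 * of_int (\<Sum>k\<le>i. r ! k) / rat_of_int (ip r r))"
      if i: "i < n" for i
    proof -
      have "ip r r dvd 2 * (\<Sum>k\<le>i. r ! k)"
      proof (cases "ip r r = 2")
        case False
        then have "ip r r = 4" "\<forall>k<n. even (r ! k)" using r by (auto simp: roots_TC)
        moreover from this have "even (\<Sum>k\<le>i. r ! k)" using i by (intro dvd_sum) auto
        ultimately show ?thesis by auto
      qed simp
      then show ?thesis
        by (intro exI[of _ "(2 * (\<Sum>k\<le>i. r ! k)) div ip r r"]) (simp add: of_int_div_exact)
    qed
    moreover have "length r = n" using r by (simp add: roots_TC)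
    ultimately have "\<exists>c :: vec \<Rightarrow> int. \<forall>k<n. (\<Sum>a\<in>csimple 2 n ` {..<n}. of_int (c a) * (2 * of_int (a ! k) / of_int (ip a a)))
         = (2 * of_int (r ! k) / of_int (ip r r) :: rat)"
      by (intro csimple_coroot) auto
    then show ?thesis using S n by simp
  qed
  show "\<exists>w. length w = dimv (TC n) \<and> ip a w \<noteq> 0 \<and> (\<forall>b\<in>simple (TC n). b \<noteq> a \<longrightarrow> ip b w = 0)" if "a \<in> simple (TC n)" for a
    using simple_dual_csimple[of 2 a n] that S n by simp
qed (auto simp: roots_TC)

section \<open>Types \<open>F\<^sub>4\<close> and \<open>G\<^sub>2\<close>\<close>

lemma less_4: "(\<forall>k<4. P k) \<longleftrightarrow> P 0 \<and> P 1 \<and> P 2 \<and> P (3::nat)"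
proof -
  have "k < 4 \<longleftrightarrow> k = 0 \<or> k = 1 \<or> k = 2 \<or> k = 3" for k :: nat by auto
  then show ?thesis by auto
qed

lemma less_3: "(\<forall>k<3. P k) \<longleftrightarrow> P 0 \<and> P 1 \<and> P (2::nat)"
proof -
  have "k < 3 \<longleftrightarrow> k = 0 \<or> k = 1 \<or> k = 2" for k :: nat by auto
  then show ?thesis by auto
qed

lemma length_4E:
  assumes "length v = 4" obtains a b c d where "v = [a, b, c, d]"
  using assms by (auto simp: numeral_eq_Suc length_Suc_conv)

lemma odd_square_le: 
  assumes "odd (a::int)" "a * a \<le> 5" shows "a = 1 \<or> a = -1"
proof -
  have "\<bar>a\<bar> < 3"
  proof (rule ccontr)
    assume "\<not> \<bar>a\<bar> < 3"
    then have "3 * 3 \<le> \<bar>a\<bar> * \<bar>a\<bar>" by (intro mult_mono) auto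
    then show False using assms(2) by simp
  qed
  then have "a = -2 \<or> a = -1 \<or> a = 0 \<or> a = 1 \<or> a = 2" by linarith
  then show ?thesis using assms(1) by auto
qed

lemma odd_square_ge: "odd (a::int) \<Longrightarrow> a * a \<ge> 1"
  by (metis dvd_0_right int_one_le_iff_zero_less linorder_neqE_linordered_idom mult_eq_0_iff not_square_less_zero)

text \<open>Three odd squares sum to at least 3, so the fourth is at most 8 - 3 = 5 and its root is
  1 or -1.\<close>

lemma odd_norm_8:
  assumes "odd a" "odd b" "odd c" "odd d" "ip [a, b, c, d] [a, b, c, d] \<le> 8"
  shows "set [a, b, c, d] \<subseteq> {1, -1}"
proof -
  have "a * a + b * b + c * c + d * d \<le> 8" using assms(5) by (simp add: ip_def)
  then have "a * a \<le> 5" "b * b \<le> 5" "c * c \<le> 5" "d * d \<le> 5"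
    using odd_square_ge[OF assms(1)] odd_square_ge[OF assms(2)] odd_square_ge[OF assms(3)] odd_square_ge[OF assms(4)]
    by linarith+
  then show ?thesis using odd_square_le assms(1-4) by auto
qed

text \<open>All coordinates of the same parity: twice the Hurwitz lattice, in which the roots are
  the vectors of norm 4 and 8.\<close>

definition f4parity :: "vec \<Rightarrow> bool" where
  "f4parity v \<longleftrightarrow> (\<forall>k<4. even (v ! k)) \<or> (\<forall>k<4. odd (v ! k))"

lemma f4parity_iff: "f4parity [a, b, c, d] \<longleftrightarrow> (even b \<longleftrightarrow> even a) \<and> (even c \<longleftrightarrow> even a) \<and> (even d \<longleftrightarrow> even a)"
  unfolding f4parity_def less_4 by (auto simp: numeral_eq_Suc)

lemma roots_TF4: "roots TF4 = {v. length v = 4 \<and> f4parity v \<and> (ip v v = 4 \<or> ip v v = 8)}"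
proof (intro equalityI subsetI)
  fix v assume "v \<in> roots TF4"
  then consider a i where "v = vsmul (2*a) (unitv 4 i)" "a \<in> {1,-1}" "i < 4"
    | a b i j where "v = vadd (vsmul (2*a) (unitv 4 i)) (vsmul (2*b) (unitv 4 j))" "a \<in> {1,-1}" "b \<in> {1,-1}" "i < j" "j < 4"
    | "length v = 4" "set v \<subseteq> {1,-1}"
    unfolding roots.simps by blast
  then show "v \<in> {v. length v = 4 \<and> f4parity v \<and> (ip v v = 4 \<or> ip v v = 8)}"
  proof cases
    case 3
    then obtain a b c d where "v = [a, b, c, d]" using length_4E by blast
    then show ?thesis using 3 by (auto simp: f4parity_iff ip_def)
  qed (auto simp: f4parity_def ip_linear ip_unitv_left)
next
  fix v assume v: "v \<in> {v. length v = 4 \<and> f4parity v \<and> (ip v v = 4 \<or> ip v v = 8)}"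
  then consider "\<forall>k<4. odd (v ! k)" | "\<forall>k<4. even (v ! k)" unfolding f4parity_def by blast
  then show "v \<in> roots TF4"
  proof cases
    case 1
    obtain a b c d where e: "v = [a, b, c, d]" using length_4E v by blast
    have "odd a" "odd b" "odd c" "odd d" using 1 unfolding e less_4 by simp_all
    moreover have "ip v v \<le> 8" using v by auto
    ultimately have "set v \<subseteq> {1, -1}" using odd_norm_8[of a b c d] unfolding e by blast
    then show ?thesis using v unfolding roots.simps by blast
  next
    case 2
    then obtain w where w: "v = vsmul 2 w" using even_vec[of v] v by auto
    then have l: "length w = 4" and "4 * ip w w = ip v v" using v by (auto simp: ip_linear)
    then consider "ip w w = 1" | "ip w w = 2" using v by force
    then show ?thesis
    proof cases
      case 1
      then obtain a i where a: "a \<in> {1, -1}" "i < 4" "w = vsmul a (unitv 4 i)" using norm_1_cases[OF l] by metis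
      then have "v = vsmul (2 * a) (unitv 4 i)" unfolding w by (auto intro!: nth_equalityI)
      then show ?thesis using a unfolding roots.simps by blast
    next
      case 2
      then obtain a b i j where a: "a \<in> {1, -1}" "b \<in> {1, -1}" "i < j" "j < 4"
        "w = vadd (vsmul a (unitv 4 i)) (vsmul b (unitv 4 j))" using norm_2_cases[OF l] by metis
      then have "v = vadd (vsmul (2 * a) (unitv 4 i)) (vsmul (2 * b) (unitv 4 j))"
        unfolding w by (auto intro!: nth_equalityI simp: algebra_simps)
      then show ?thesis using a unfolding roots.simps by blast
    qed
  qed
qed

text \<open>Odd entries with norm at most 8 would force norm 4, so a long root is twice an integer
  vector of norm 2, whose coordinate sum is even. This evenness carries the integrality statements
  for long roots of F_4.\<close>

lemma f4_long_half:
  assumes "[a, b, c, d] \<in> roots TF4" "ip [a, b, c, d] [a, b, c, d] = 8"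
  obtains a' b' c' d' where "a = 2 * a'" "b = 2 * b'" "c = 2 * c'" "d = 2 * d'" "even (a' + b' + c' + d')"
proof -
  have "even a"
  proof (rule ccontr)
    assume "odd a"
    then have "set [a, b, c, d] \<subseteq> {1, -1}"
      using odd_norm_8[of a b c d] assms unfolding roots_TF4 by (auto simp: f4parity_iff)
    then show False using assms(2) by (auto simp: ip_def)
  qed
  then have "even a" "even b" "even c" "even d" using assms(1) unfolding roots_TF4 by (auto simp: f4parity_iff)
  then obtain a' b' c' d' where h: "a = 2 * a'" "b = 2 * b'" "c = 2 * c'" "d = 2 * d'" by (auto elim!: evenE)
  have "a' * a' + b' * b' + c' * c' + d' * d' = 2" using assms(2) unfolding h ip_def by simp
  then have "even (a' * a' + b' * b' + c' * c' + d' * d')" by simp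
  then have "even (a' + b' + c' + d')" by simp
  then show thesis using that h by blast
qed

lemma simple_TF4: "simple TF4 = {[0,2,-2,0], [0,0,2,-2], [0,0,0,2], [1,-1,-1,-1]}"
  by (simp add: simple.simps)

lemma rootdata_TF4: "rootdata TF4 2 4"
proof
  note R = roots_TF4
  have vec: "\<exists>a b c d. v = [a, b, c, d]" if "v \<in> roots TF4" for v
    by (rule length_4E[of v]) (use that in \<open>auto simp: R\<close>)
  show "finite (roots TF4)" by (rule finite_subset[OF _ finite_bounded_norm[of 4]]) (auto simp: R)
  show i: "ip r r dvd 2 * ip s r" if rs: "r \<in> roots TF4" "s \<in> roots TF4" for r s
  proof -
    obtain a b c d x y z w where v: "r = [a, b, c, d]" "s = [x, y, z, w]" using vec rs by metis
    have s: "(even y \<longleftrightarrow> even x) \<and> (even z \<longleftrightarrow> even x) \<and> (even w \<longleftrightarrow> even x)"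
      using rs(2) unfolding R v by (simp add: f4parity_iff)
    show ?thesis
    proof (cases "ip r r = 8")
      case True
      obtain a' b' c' d' where h: "a = 2 * a'" "b = 2 * b'" "c = 2 * c'" "d = 2 * d'" "even (a' + b' + c' + d')"
        using f4_long_half rs(1) True unfolding v by metis
      have "ip s r = 2 * (x * a' + y * b' + z * c' + w * d')" unfolding v h ip_def by simp
      moreover have "even (x * a' + y * b' + z * c' + w * d')" using h(5) s by auto
      moreover have "8 dvd 2 * (2 * n)" if "even n" for n :: int using that by presburger
      ultimately show ?thesis unfolding True by metis
    next
      case False
      have r: "(even b \<longleftrightarrow> even a) \<and> (even c \<longleftrightarrow> even a) \<and> (even d \<longleftrightarrow> even a)"
        using rs(1) unfolding R v by (simp add: f4parity_iff)
      have "ip s r = x * a + y * b + z * c + w * d" unfolding v ip_def by simp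
      moreover have "even (x * a + y * b + z * c + w * d)" using r s by auto
      moreover have "ip r r = 4" using False rs(1) unfolding R by auto
      moreover have "4 dvd 2 * n" if "even n" for n :: int using that by presburger
      ultimately show ?thesis by metis
    qed
  qed
  then have c: "cint s r * ip r r = 2 * ip s r" if "r \<in> roots TF4" "s \<in> roots TF4" for r s
    using that unfolding cint_def by simp
  show "vadd s (vsmul (- cint s r) r) \<in> roots TF4" if rs: "r \<in> roots TF4" "s \<in> roots TF4" for r s
  proof -
    obtain a b c d x y z w where v: "r = [a, b, c, d]" "s = [x, y, z, w]" using vec rs by metis
    have "f4parity r" "f4parity s" using rs unfolding R by auto
    then have "f4parity (vadd s (vsmul (- cint s r) r))"
      unfolding v by (auto simp: vadd_def vsmul_def f4parity_iff)
    then show ?thesis using norm_reflect[of s r "cint s r", OF _ c[OF rs]] rs unfolding R by simp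
  qed
  show "\<exists>r\<in>roots TF4. ip r r = 2 * 4"
    by (intro bexI[of _ "[2,2,0,0]"]) (auto simp: R ip_def f4parity_iff)
  show "finite (simple TF4)" "simple TF4 \<subseteq> roots TF4"
    unfolding simple_TF4 R by (auto simp: ip_def f4parity_iff)
  show "\<exists>c :: vec \<Rightarrow> int. \<forall>k<dimv TF4. (\<Sum>a\<in>simple TF4. of_int (c a) * (2 * of_int (a ! k) / of_int (ip a a)))
         = (2 * of_int (r ! k) / of_int (ip r r) :: rat)" if r: "r \<in> roots TF4" for r
  proof -
    obtain a b c d where v: "r = [a, b, c, d]" using vec r by metis
    \<comment> \<open>The coefficients of the simple coroots, solved from the coordinates 0 to 3 in
      turn. Up to a factor each is the inner product of r with a fixed vector; these vectors
      [1,1,0,0], [2,1,1,0], [3,1,1,1], [1,0,0,0] are the dual witnesses further down.\<close>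
    have "\<exists>c1 c2 c3 c4 :: int. of_int c1 = (4 * of_int (a + b) / of_int (ip r r) :: rat) \<and>
      of_int c2 = (4 * of_int (c + b + 2 * a) / of_int (ip r r) :: rat) \<and>
      of_int c3 = (2 * of_int (d + c + b + 3 * a) / of_int (ip r r) :: rat) \<and>
      of_int c4 = (4 * of_int a / of_int (ip r r) :: rat)"
    proof (cases "ip r r = 8")
      case True
      obtain a' b' c' d' where h: "a = 2 * a'" "b = 2 * b'" "c = 2 * c'" "d = 2 * d'" "even (a' + b' + c' + d')"
        using f4_long_half r True unfolding v by metis
      from h(5) obtain e where "a' + b' + c' + d' = 2 * e" by (rule evenE)
      then have e: "d' = 2 * e - a' - b' - c'" by linarith
      show ?thesis unfolding True h(1-4) e
        by (intro exI[of _ "a' + b'"] exI[of _ "c' + b' + 2 * a'"] exI[of _ "e + a'"] exI[of _ a'])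
          (simp add: field_simps)
    next
      case False
      then have n: "ip r r = 4" using r unfolding R by auto
      have "(even b \<longleftrightarrow> even a) \<and> (even c \<longleftrightarrow> even a) \<and> (even d \<longleftrightarrow> even a)"
        using r unfolding R v by (simp add: f4parity_iff)
      then have "even (a + b + c + d)" by auto
      then obtain e where "a + b + c + d = 2 * e" by (rule evenE)
      then have e: "d = 2 * e - a - b - c" by linarith
      show ?thesis unfolding n e
        by (intro exI[of _ "a + b"] exI[of _ "c + b + 2 * a"] exI[of _ "e + a"] exI[of _ a])
          (simp add: field_simps)
    qed
    then obtain c1 c2 c3 c4 :: int where cs: "of_int c1 = (4 * of_int (a + b) / of_int (ip r r) :: rat)"
      "of_int c2 = (4 * of_int (c + b + 2 * a) / of_int (ip r r) :: rat)"
      "of_int c3 = (2 * of_int (d + c + b + 3 * a) / of_int (ip r r) :: rat)"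
      "of_int c4 = (4 * of_int a / of_int (ip r r) :: rat)" by blast
    define C :: "vec \<Rightarrow> int" where "C v = (if v = [0,2,-2,0] then c1 else if v = [0,0,2,-2] then c2 else if v = [0,0,0,2] then c3 else c4)" for v
    define n where "n = rat_of_int (ip r r)"
    have n: "n \<noteq> 0" using r unfolding R n_def by auto
    have rk: "r ! 0 = a" "r ! 1 = b" "r ! 2 = c" "r ! 3 = d" unfolding v by simp_all
    show ?thesis
      using n cs rk unfolding n_def[symmetric]
      by (intro exI[of _ C]) (simp add: simple_TF4 less_4 C_def ip_def field_simps)
  qed
  show "\<exists>w. length w = dimv TF4 \<and> ip a w \<noteq> 0 \<and> (\<forall>b\<in>simple TF4. b \<noteq> a \<longrightarrow> ip b w = 0)" if "a \<in> simple TF4" for a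
  proof -
    consider "a = [0,2,-2,0]" | "a = [0,0,2,-2]" | "a = [0,0,0,2]" | "a = [1,-1,-1,-1]" using \<open>a \<in> simple TF4\<close> unfolding simple_TF4 by auto
    then show ?thesis
    proof cases
      case 1 then show ?thesis by (intro exI[of _ "[1,1,0,0]"]) (simp add: simple_TF4 ip_def)
    next
      case 2 then show ?thesis by (intro exI[of _ "[2,1,1,0]"]) (simp add: simple_TF4 ip_def)
    next
      case 3 then show ?thesis by (intro exI[of _ "[3,1,1,1]"]) (simp add: simple_TF4 ip_def)
    next
      case 4 then show ?thesis by (intro exI[of _ "[1,0,0,0]"]) (simp add: simple_TF4 ip_def)
    qed
  qed
qed (auto simp: roots_TF4)

text \<open>The twelve roots as an executable list, so that integrality, reflections and
  divisibilities become finite computations.\<close>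

definition g2list :: "vec list" where
  "g2list = concat (map (\<lambda>i. map (\<lambda>j. vadd (unitv 3 i) (vneg (unitv 3 j))) (filter (\<lambda>j. i \<noteq> j) [0..<3])) [0..<3])
    @ concat (map (\<lambda>a. concat (map (\<lambda>i. concat (map (\<lambda>j. map (\<lambda>k. 
        vsmul a (vadd (vsmul 2 (unitv 3 i)) (vneg (vadd (unitv 3 j) (unitv 3 k)))))
        (filter (\<lambda>k. i \<noteq> k \<and> j \<noteq> k) [0..<3])) (filter (\<lambda>j. i \<noteq> j) [0..<3]))) [0..<3])) [1,-1])"

lemma roots_TG2: "roots TG2 = set g2list"
proof -
  have 1: "{vadd (unitv 3 i) (vneg (unitv 3 j)) | i j. i < 3 \<and> j < 3 \<and> i \<noteq> j}
    = set (concat (map (\<lambda>i. map (\<lambda>j. vadd (unitv 3 i) (vneg (unitv 3 j))) (filter (\<lambda>j. i \<noteq> j) [0..<3])) [0..<3]))"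
    unfolding set_concat set_map set_upt set_filter list.set atLeast0LessThan image_image by blast
  have 2: "{vsmul a (vadd (vsmul 2 (unitv 3 i)) (vneg (vadd (unitv 3 j) (unitv 3 k)))) | a i j k.
        a \<in> {1,-1} \<and> i < 3 \<and> j < 3 \<and> k < 3 \<and> i \<noteq> j \<and> i \<noteq> k \<and> j \<noteq> k}
    = set (concat (map (\<lambda>a. concat (map (\<lambda>i. concat (map (\<lambda>j. map (\<lambda>k. 
        vsmul a (vadd (vsmul 2 (unitv 3 i)) (vneg (vadd (unitv 3 j) (unitv 3 k)))))
        (filter (\<lambda>k. i \<noteq> k \<and> j \<noteq> k) [0..<3])) (filter (\<lambda>j. i \<noteq> j) [0..<3]))) [0..<3])) [1,-1]))"
    unfolding set_concat set_map set_upt set_filter list.set atLeast0LessThan image_image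
    by (intro equalityI subsetI) blast+
  show ?thesis unfolding g2list_def roots.simps 1 2 set_append ..
qed

lemma g2list_eq: "set g2list = {[1,-1,0],[1,0,-1],[0,1,-1],[-1,1,0],[-1,0,1],[0,-1,1],
     [2,-1,-1],[-1,2,-1],[-1,-1,2],[-2,1,1],[1,-2,1],[1,1,-2]}"
  by code_simp

lemma g2list_check: "\<forall>r\<in>set g2list. \<forall>s\<in>set g2list.
    (2 * ip s r) mod ip r r = 0 \<and> vadd s (vsmul (- cint s r) r) \<in> set g2list"
  by code_simp

text \<open>The quotients are the coefficients of the coroot of r: coordinate 2 yields 6 r_2 / |r|^2
  for [-2,1,1], coordinate 1 then 2 (r_2 - r_1) / |r|^2 for [1,-1,0], and coordinate 0 follows from
  the zero sum.\<close>

lemma g2list_coroot: "\<forall>r\<in>set g2list. (2 * (r ! 2 - r ! 1)) mod ip r r = 0 \<and> (6 * r ! 2) mod ip r r = 0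
    \<and> r ! 0 + r ! 1 + r ! 2 = 0 \<and> ip r r \<noteq> 0"
  by code_simp

lemma simple_TG2: "simple TG2 = {[1,-1,0], [-2,1,1]}"
  by (simp add: simple.simps)

lemma rootdata_TG2: "rootdata TG2 3 2"
proof
  note R = roots_TG2
  show "finite (roots TG2)" by (simp add: R)
  show "ip r r dvd 2 * ip s r" if "r \<in> roots TG2" "s \<in> roots TG2" for r s
    using g2list_check that unfolding R by (auto simp: dvd_eq_mod_eq_0)
  show "vadd s (vsmul (- cint s r) r) \<in> roots TG2" if "r \<in> roots TG2" "s \<in> roots TG2" for r s
    using g2list_check that unfolding R by blast
  show "\<exists>r\<in>roots TG2. ip r r = 3 * 2"
    by (intro bexI[of _ "[2,-1,-1]"]) (auto simp: R g2list_eq ip_def)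
  show "finite (simple TG2)" "simple TG2 \<subseteq> roots TG2"
    unfolding simple_TG2 R g2list_eq by auto
  show "ip r r = 2 \<or> ip r r = 3 * 2" "length r = dimv TG2" if "r \<in> roots TG2" for r
    using that unfolding R g2list_eq by (auto simp: ip_def)
  show "\<exists>c :: vec \<Rightarrow> int. \<forall>k<dimv TG2. (\<Sum>a\<in>simple TG2. of_int (c a) * (2 * of_int (a ! k) / of_int (ip a a)))
         = (2 * of_int (r ! k) / of_int (ip r r) :: rat)" if r: "r \<in> roots TG2" for r
  proof -
    define C :: "vec \<Rightarrow> int" where "C v = (if v = [1,-1,0] then 2 * (r ! 2 - r ! 1) div ip r r else 6 * r ! 2 div ip r r)" for v
    define n where "n = rat_of_int (ip r r)"
    have r: "ip r r dvd 2 * (r ! 2 - r ! 1)" "ip r r dvd 6 * r ! 2" and sum: "r ! 0 = - r ! 1 - r ! 2" and n: "n \<noteq> 0"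
      using g2list_coroot that unfolding R n_def by (auto simp: dvd_eq_mod_eq_0)
    have "of_int (C [1,-1,0]) = 2 * (of_int (r ! 2) - of_int (r ! 1)) / n" "of_int (C [-2,1,1]) = 6 * of_int (r ! 2) / n"
      unfolding C_def n_def using r by (simp_all add: of_int_div_exact)
    then show ?thesis
      using n sum unfolding n_def[symmetric]
      by (intro exI[of _ C]) (simp add: simple_TG2 less_3 ip_def field_simps)
  qed
  show "\<exists>w. length w = dimv TG2 \<and> ip a w \<noteq> 0 \<and> (\<forall>b\<in>simple TG2. b \<noteq> a \<longrightarrow> ip b w = 0)" if "a \<in> simple TG2" for a
  proof -
    consider "a = [1,-1,0]" | "a = [-2,1,1]" using \<open>a \<in> simple TG2\<close> unfolding simple_TG2 by auto
    then show ?thesis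
    proof cases
      case 1 then show ?thesis by (intro exI[of _ "[0,-1,1]"]) (simp add: simple_TG2 ip_def)
    next
      case 2 then show ?thesis by (intro exI[of _ "[0,0,1]"]) (simp add: simple_TG2 ip_def)
    qed
  qed
qed auto

section \<open>Generation of the mixed torus\<close>

lemma TKL_TG2:
  assumes "mixed TG2 3 2 N K"
  shows "TKL TG2 N K = generate (GLie TG2) (mixed_torus_gens TG2 N K)"
proof -
  interpret mixed TG2 3 2 N K by fact
  show ?thesis
  proof (rule TKL_generated)
    fix u a assume u: "\<And>a. u a \<noteq> 0" and lng: "\<And>s. long_root TG2 s \<Longrightarrow> simpleprod u s \<in> K"
      and a: "a \<in> simple TG2" "long_root TG2 a"
    have b: "a = [-2,1,1]" using a unfolding simple_TG2 long_iff by (auto simp: ip_def)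
    let ?t = "u [1,-1,0]"
    \<comment> \<open>This root pairs to -1 with the long simple coroot and to 3 with the short one,
      so its value is the inverse of u_a up to a cube.\<close>
    have "long_root TG2 [1,-2,1]" unfolding long_iff by (auto simp: roots_TG2 g2list_eq ip_def)
    then have "simpleprod u [1,-2,1] \<in> K" by (rule lng)
    then have "inverse (u a) * ?t powi 3 \<in> K"
      unfolding simpleprod_def simple_TG2 b by (simp add: cint_def ip_def power_int_minus mult.commute)
    moreover have "?t powi 3 \<in> K" by (rule K_powi_dvd) simp
    moreover have "?t powi 3 \<noteq> 0" using u[of "[1,-1,0]"] by simp
    ultimately have "inverse (u a) \<in> K" by (rule K_cancel)
    then show "u a \<in> K" using K_closed(6)[of "inverse (u a)"] by simp
  qed
qed

lemma TKL_TF4: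
  assumes "mixed TF4 2 4 N K"
  shows "TKL TF4 N K = generate (GLie TF4) (mixed_torus_gens TF4 N K)"
proof -
  interpret mixed TF4 2 4 N K by fact
  show ?thesis
  proof (rule TKL_generated)
    fix u a assume u: "\<And>a. u a \<noteq> 0" and lng: "\<And>s. long_root TF4 s \<Longrightarrow> simpleprod u s \<in> K"
      and a: "a \<in> simple TF4" "long_root TF4 a"
    let ?b1 = "[0,2,-2,0] :: vec" and ?b2 = "[0,0,2,-2] :: vec"
    have sq: "u x powi k \<in> K" "u x powi k \<noteq> 0" if "even k" for x k
      using that K_powi_dvd u by (auto simp: power_int_not_zero)
    have inv: "z \<in> K" if "inverse z * w \<in> K" "w \<in> K" "w \<noteq> 0" for z w
      using K_cancel[OF that] K_closed(6)[of "inverse z"] by simp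
    have "long_root TF4 ?b1" "long_root TF4 ?b2"
      unfolding long_iff by (auto simp: roots_TF4 f4parity_iff ip_def)
    then have "simpleprod u ?b1 \<in> K" "simpleprod u ?b2 \<in> K" by (auto intro: lng)
    \<comment> \<open>Squares lie in K, so modulo K the Cartan matrix of the long A_2 merely
      exchanges the two unknowns: the value at \<open>?b1\<close> controls u at \<open>?b2\<close>,
      and conversely.\<close>
    then have "inverse (u ?b2) * u ?b1 powi 2 \<in> K"
      "inverse (u ?b1) * (u ?b2 powi 2 * u [0,0,0,2] powi (-2)) \<in> K"
      unfolding simpleprod_def simple_TF4 by (simp_all add: cint_def ip_def power_int_minus ac_simps)
    then have "u ?b1 \<in> K" "u ?b2 \<in> K"
      using inv sq(1,2)[of 2] sq(1,2)[of "-2"] K_closed(4) mult_eq_0_iff by (metis even_minus even_numeral)+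
    moreover have "a = ?b1 \<or> a = ?b2" using a unfolding simple_TF4 long_iff by (auto simp: ip_def)
    ultimately show "u a \<in> K" by blast
  qed
qed

section \<open>Type B_n by the parity of n, and type C_n\<close>

lemma cint_csimple_TB:
  assumes "i < n" "length v = n"
  shows "cint v (csimple 1 n i) = (if Suc i < n then v ! i - v ! Suc i else 2 * v ! i)"
  unfolding cint_def using assms ip_csimple[of i n v 1] ip_commute[of v "csimple 1 n i"] norm_csimple[of i n 1] by simp

lemma simpleprod_TB:
  assumes "rootdata (TB n) 2 1" "n \<ge> 1"
  shows "rootdata.simpleprod (TB n) u s = (\<Prod>i<n. u (csimple 1 n i) powi cint s (csimple 1 n i))"
  unfolding rootdata.simpleprod_def[OF assms(1)] simple_TB[OF assms(2)]
  by (subst prod.reindex[OF inj_csimple]) auto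

text \<open>The values y_k at the short roots e_k agree modulo K, since their ratios are values at
  long roots, and their full product is a square. Thus y_0^n lies in K, hence y_0 does as n is odd;
  the u_a with a long are partial products of the y_k.\<close>

lemma TKL_TB_odd:
  assumes "mixed (TB n) 2 1 N K" "odd n" "n \<ge> 2"
  shows "TKL (TB n) N K = generate (GLie (TB n)) (mixed_torus_gens (TB n) N K)"
proof -
  interpret mixed "TB n" 2 1 N K by fact
  let ?a = "csimple 1 n"
  have long: "long_root (TB n) s \<longleftrightarrow> length s = n \<and> ip s s = 2" for s
    unfolding long_iff roots_TB by auto
  show ?thesis
  proof (rule TKL_generated)
    fix u a assume u: "\<And>a. u a \<noteq> 0" and lng: "\<And>s. long_root (TB n) s \<Longrightarrow> simpleprod u s \<in> K"
      and a: "a \<in> simple (TB n)" "long_root (TB n) a"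
    define y where "y k = simpleprod u (unitv n k)" for k
    have E: "unitv n k \<in> roots (TB n)" if "k < n" for k
      using that by (simp add: roots_TB ip_unitv_left)
    have y0: "y k \<noteq> 0" for k unfolding y_def by (rule simpleprod_nonzero[OF u])
    have sq: "z powi 2 \<in> K" for z using K_powi_dvd[of 2 z] by simp
    \<comment> \<open>e_0 + ... + e_i pairs to 0 with every simple coroot but the i-th; the last
      simple coroot is 2 e_(n-1), which accounts for the exponent 2.\<close>
    have prod_y: "(\<Prod>k\<le>i. y k) = u (?a i) powi (if Suc i < n then 1 else 2)" if i: "i < n" for i
    proof -
      have c: "(\<Sum>k\<le>i. cint (unitv n k) (?a j)) = (if j = i then if Suc i < n then 1 else 2 else 0)" if j: "j < n" for j
      proof -
        have "(\<Sum>k\<le>i. cint (unitv n k) (?a j)) = (\<Sum>k\<le>i. if Suc j < n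
            then (if k = j then 1 else 0) - (if k = Suc j then 1 else 0) else (if k = j then 2 else 0))"
          using j by (intro sum.cong refl) (auto simp: cint_csimple_TB)
        then show ?thesis using i j by (cases "Suc j < n") (auto simp: sum_subtractf)
      qed
      have "(\<Prod>k\<le>i. y k) = (\<Prod>k\<le>i. \<Prod>j<n. u (?a j) powi cint (unitv n k) (?a j))"
        unfolding y_def using simpleprod_TB[OF rootdata_axioms, of u] assms(3) by simp
      also have "\<dots> = (\<Prod>j<n. u (?a j) powi (\<Sum>k\<le>i. cint (unitv n k) (?a j)))"
        by (subst prod.swap) (simp add: powi_sum[OF u])
      also have "\<dots> = (\<Prod>j<n. if j = i then u (?a i) powi (if Suc i < n then 1 else 2) else 1)"
        by (intro prod.cong refl) (auto simp: c)
      also have "\<dots> = u (?a i) powi (if Suc i < n then 1 else 2)" using i by (simp add: prod.delta)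
      finally show ?thesis .
    qed
    have ratio: "y k * inverse (y 0) \<in> K" if k: "k < n" for k
    proof (cases "k = 0")
      case True then show ?thesis using y0[of 0] K_closed(2) by simp
    next
      case False
      let ?s = "vadd (unitv n k) (vneg (unitv n 0))"
      have l: "long_root (TB n) ?s"
        unfolding long using k False by (simp add: ip_linear ip_unitv_left)
      then have "simpleprod u ?s \<in> K" by (rule lng)
      moreover have "simpleprod u ?s = y k * inverse (y 0)"
        unfolding y_def using E[OF k] E[of 0] k by (simp add: simpleprod_vadd[OF u] simpleprod_vneg vneg_root)
      ultimately show ?thesis by simp
    qed
    have "y 0 \<in> K"
    proof -
      obtain m where m: "n = 2 * m + 1" using assms(2) by (rule oddE)
      have "{..n - 1} = {..<n}" using assms(3) by auto
      then have "(\<Prod>k<n. y k) \<in> K" using prod_y[of "n - 1"] assms(3) sq by simp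
      moreover have "(\<Prod>k<n. y k * inverse (y 0)) \<in> K" using ratio by (intro K_prod) auto
      \<comment> \<open>With n = 2 m + 1, exactly one factor y_0 remains beside a square and the
        ratios.\<close>
      moreover have "(\<Prod>k<n. y k) = y 0 * ((y 0 powi 2) ^ m * (\<Prod>k<n. y k * inverse (y 0)))"
        unfolding prod.distrib using y0[of 0] by (simp add: m power_mult power2_eq_square power_mult_distrib field_simps)
      moreover have "(y 0 powi 2) ^ m * (\<Prod>k<n. y k * inverse (y 0)) \<noteq> 0" using y0 by (simp add: power_int_not_zero)
      ultimately show ?thesis using K_cancel[of "y 0" "(y 0 powi 2) ^ m * (\<Prod>k<n. y k * inverse (y 0))"] K_power sq K_closed(4)
        by metis
    qed
    then have yK: "y k \<in> K" if "k < n" for k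
      using K_closed(4)[OF ratio[OF that], of "y 0"] y0[of 0] by (simp add: mult.assoc)
    obtain i where i: "i < n" "a = ?a i" using a(1) simple_TB[of n] assms(3) by auto
    have "Suc i < n" using a(2) i norm_csimple[of i n 1] unfolding long by (auto split: if_splits)
    then have "u a = (\<Prod>k\<le>i. y k)" using prod_y[OF i(1)] i(2) by simp
    also have "\<dots> \<in> K" using yK i by (intro K_prod) auto
    finally show "u a \<in> K" .
  qed
qed

lemma sum_Abel:
  fixes s :: "nat \<Rightarrow> int"
  shows "(\<Sum>i<m. int (Suc i) * (s i - s (Suc i))) = (\<Sum>i<m. s i) - int m * s m"
  by (induction m) (auto simp: algebra_simps)

lemma TKL_TB_even:
  assumes "mixed (TB n) 2 1 N K" "even n" "n \<ge> 2" and x: "x \<notin> K"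
  shows "TKL (TB n) N K \<noteq> generate (GLie (TB n)) (mixed_torus_gens (TB n) N K)"
proof -
  interpret mixed "TB n" 2 1 N K by fact
  let ?a = "csimple 1 n"
  have x0: "x \<noteq> 0" using x K_closed(1) by auto
  \<comment> \<open>Coefficients of the cocharacter in the simple coroots: the partial sums i + 1,
    and n/2 instead of n at the last coroot 2 e_(n-1).\<close>
  define C where "C i = (if Suc i < n then int (Suc i) else int (n div 2))" for i
  define u where "u a = x powi C (inv_into {..<n} ?a a)" for a
  have u: "u a \<noteq> 0" for a unfolding u_def using x0 by (simp add: power_int_not_zero)
  have ua: "u (?a i) = x powi C i" if "i < n" for i
    unfolding u_def using inv_into_f_f[OF inj_csimple, of 1 i n] that by simp
  text \<open>The cocharacter \<open>e\<^sub>0 + \<dots> + e\<^sub>n\<^sub>-\<^sub>1\<close> lies in the coroot lattice because \<open>n\<close> is even.\<close>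
  have val: "simpleprod u s = x powi (\<Sum>k<n. s ! k)" if l: "length s = n" for s
  proof -
    obtain m where m: "n = Suc m" using assms(3) by (cases n) auto
    have "simpleprod u s = (\<Prod>i<n. x powi (C i * cint s (?a i)))"
      using simpleprod_TB[OF rootdata_axioms, of u s] assms(3) by (simp add: ua power_int_mult)
    also have "\<dots> = x powi (\<Sum>i<n. C i * cint s (?a i))" by (rule powi_sum[OF x0, symmetric])
    also have "(\<Sum>i<n. C i * cint s (?a i)) = (\<Sum>i<m. int (Suc i) * (s ! i - s ! Suc i)) + int (n div 2) * (2 * s ! m)"
      unfolding m sum.lessThan_Suc using l m
      by (intro arg_cong2[where f = "(+)"] sum.cong) (auto simp: C_def cint_csimple_TB)
    also have "int (n div 2) * (2 * s ! m) = int n * s ! m" using assms(2) by (auto elim!: evenE)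
    finally show ?thesis unfolding sum_Abel m by (simp add: algebra_simps)
  qed
  have E: "unitv n 0 \<in> roots (TB n)" using assms(3) by (simp add: roots_TB ip_unitv_left)
  show ?thesis
  proof (rule TKL_not_generated[where u = u and Q = "\<lambda>\<chi>. \<chi> (unitv n 0) \<in> K"])
    show "simpleprod u s \<in> K" if "long_root (TB n) s" for s
    proof -
      have s: "length s = n" "ip s s = 2" using that unfolding long_iff roots_TB by auto
      then have "even (\<Sum>k<n. s ! k)" using ip_conv_sum[of s n s] by (simp add: even_sum_squares[of "nth s"])
      then show ?thesis unfolding val[OF s(1)] by (rule K_powi_dvd)
    qed
    show "t powi cint (unitv n 0) r \<in> K" if "r \<in> roots (TB n)" "long_root (TB n) r \<and> t \<in> K \<or> short_root (TB n) r" for r t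
      using that(2)
    proof
      assume "short_root (TB n) r"
      \<comment> \<open>A short root of B_n has norm 1, so every Cartan integer against it is even,
        also for the short root e_0.\<close>
      then have "2 dvd cint (unitv n 0) r" unfolding short_iff cint_def by simp
      then show ?thesis by (rule K_powi_dvd)
    qed (use K_powi in blast)
    show "\<not> \<chi> (unitv n 0) \<in> K" if "\<And>s. s \<in> roots (TB n) \<Longrightarrow> \<chi> s = simpleprod u s" for \<chi>
      using that[OF E] val[of "unitv n 0"] x assms(3) by (simp add: sum.delta')
  qed (use u K_closed in auto)
qed

lemma TKL_TC:
  assumes "mixed (TC n) 2 2 N K" "n \<ge> 2" and x: "x \<notin> K"
  shows "TKL (TC n) N K \<noteq> generate (GLie (TC n)) (mixed_torus_gens (TC n) N K)"
proof -
  interpret mixed "TC n" 2 2 N K by fact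
  have x0: "x \<noteq> 0" using x K_closed(1) by auto
  define E where "E i = vsmul 2 (unitv n i)" for i
  have E: "E i \<in> roots (TC n)" "length (E i) = n" "ip (E i) v = 2 * v ! i" "ip v (E i) = 2 * v ! i" "ip (E i) (E i) = 4"
    if "i < n" "length v = n" for i v
    using that ip_commute[of v "unitv n i"] unfolding E_def by (auto simp: roots_TC ip_linear ip_unitv_left)
  \<comment> \<open>The coroot of 2 e_0 is e_0, so the value at s is x^(s_0); long roots have even
    coordinates, and their values are even powers of x.\<close>
  define u where "u a = x powi coc (TC n) (E 0) a" for a
  have u: "u a \<noteq> 0" for a unfolding u_def using x0 by (simp add: power_int_not_zero)
  have val: "simpleprod u s = x powi (s ! 0)" if "s \<in> roots (TC n)" for s
  proof -
    have l: "length s = n" using that unfolding roots_TC by simp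
    then have "simpleprod u s = x powi cint s (E 0)"
      unfolding u_def using simpleprod_coc[OF x0 _ that] E(1)[of 0 s] assms(2) by simp
    moreover have "cint s (E 0) = s ! 0" unfolding cint_def using E(4,5)[of 0 s] l assms(2) by simp
    ultimately show ?thesis by simp
  qed
  \<comment> \<open>Single values at long roots lie in K for all of T(K,L), so the invariant asks
    for the square of an element of K. Over the roots 2 e_i the exponents of h_r(t) add up to the
    coordinate sum S of r, an even number, if r is long, and to 2 S if r is short; S is again even
    there, so that t^S lies in K for any t.\<close>
  let ?Q = "\<lambda>\<chi>. \<exists>k\<in>K. (\<Prod>i<n. \<chi> (E i)) = k\<^sup>2"
  show ?thesis
  proof (rule TKL_not_generated[where u = u and Q = ?Q])
    show "simpleprod u s \<in> K" if "long_root (TC n) s" for s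
    proof -
      have "0 < n" using assms(2) by simp
      with that have "s \<in> roots (TC n)" "even (s ! 0)" unfolding long_iff roots_TC by auto
      then show ?thesis using val K_powi_dvd by simp
    qed
    show "?Q (\<lambda>s. t powi cint s r)" if r: "r \<in> roots (TC n)" and t: "t \<noteq> 0"
      and lng: "long_root (TC n) r \<and> t \<in> K \<or> short_root (TC n) r" for r t
    proof -
      have l: "length r = n" using r by (simp add: roots_TC)
      define S where "S = (\<Sum>i<n. r ! i)"
      have P: "(\<Prod>i<n. t powi cint (E i) r) = t powi (\<Sum>i<n. cint (E i) r)" by (rule powi_sum[OF t, symmetric])
      from lng show ?thesis
      proof
        assume lt: "long_root (TC n) r \<and> t \<in> K"
        then have n4: "ip r r = 4" "\<forall>k<n. even (r ! k)" unfolding long_iff roots_TC by auto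
        then have "even S" unfolding S_def by (intro dvd_sum) auto
        then obtain h where h: "S = h * 2" by (metis dvd_def mult.commute)
        have "(\<Sum>i<n. cint (E i) r) = S"
          unfolding S_def cint_def n4 using E(3)[OF _ l] by (intro sum.cong) auto
        then have "(\<Prod>i<n. t powi cint (E i) r) = (t powi h)\<^sup>2" unfolding P h by (simp add: power_int_mult)
        then show ?thesis using K_powi lt by blast
      next
        assume "short_root (TC n) r"
        then have n2: "ip r r = 2" unfolding short_iff by auto
        have "(\<Sum>i<n. r ! i * r ! i) = 2" using ip_conv_sum[OF l l] n2 by simp
        then have "even S" unfolding S_def by (simp add: even_sum_squares[of "nth r"])
        have "(\<Sum>i<n. cint (E i) r) = S * 2"
          unfolding S_def cint_def n2 sum_distrib_right using E(3)[OF _ l] by (intro sum.cong) auto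
        then have "(\<Prod>i<n. t powi cint (E i) r) = (t powi S)\<^sup>2" unfolding P by (simp add: power_int_mult)
        then show ?thesis using K_powi_dvd[OF \<open>even S\<close>] by blast
      qed
    qed
    show "?Q (\<lambda>_. 1)" using K_closed(2) by (intro bexI[of _ 1]) auto
    show "?Q (\<lambda>s. \<chi> s * \<psi> s)" if "?Q \<chi>" "?Q \<psi>" for \<chi> \<psi>
      using that K_closed(4) by (auto simp: prod.distrib power_mult_distrib[symmetric])
    show "?Q (\<lambda>s. inverse (\<chi> s))" if "?Q \<chi>" for \<chi>
    proof -
      obtain k where "k \<in> K" "(\<Prod>i<n. \<chi> (E i)) = k\<^sup>2" using \<open>?Q \<chi>\<close> by blast
      then show ?thesis using K_closed(6)[of k] prod_inversef[of "\<lambda>i. \<chi> (E i)" "{..<n}"]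
        by (intro bexI[of _ "inverse k"]) (simp_all add: power_inverse comp_def)
    qed
    show "\<not> ?Q \<chi>" if \<chi>: "\<And>s. s \<in> roots (TC n) \<Longrightarrow> \<chi> s = simpleprod u s" for \<chi>
    proof
      assume "?Q \<chi>"
      then obtain k where k: "k \<in> K" "(\<Prod>i<n. \<chi> (E i)) = k\<^sup>2" by blast
      have "(\<Prod>i<n. \<chi> (E i)) = (\<Prod>i<n. if i = 0 then x\<^sup>2 else 1)"
      proof (intro prod.cong refl)
        fix i assume "i \<in> {..<n}"
        then show "\<chi> (E i) = (if i = 0 then x\<^sup>2 else 1)"
          using \<chi>[OF E(1)[of i "E i"]] val[OF E(1)[of i "E i"]] assms(2) by (simp add: E_def)
      qed
      then have sq: "x\<^sup>2 = k\<^sup>2" using k assms(2) by (simp add: prod.delta)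
      have two: "(1 :: 'a) + 1 = 0" using char_p by simp
      \<comment> \<open>In characteristic 2 a difference of squares is the square of the difference,
        so x would equal k and lie in K.\<close>
      have "(x - k) * (x - k) = x\<^sup>2 - k\<^sup>2 - (1 + 1) * (x * k - k\<^sup>2)"
        by (simp add: algebra_simps power2_eq_square)
      then show False using sq two k(1) x by simp
    qed
  qed (rule u)
qed

theorem mainTheorem2:
  fixes X :: ctype and N :: "vec \<Rightarrow> vec \<Rightarrow> int" and K :: "'a::field set"
  assumes "valid_type X"
    and "chevalley_basis X N"
    and "subfield K" and "K \<noteq> UNIV"
    and "of_nat (charp X) = (0::'a)"
    and "\<forall>x::'a. x ^ charp X \<in> K"
  shows "(TKL X N K = generate (GLie X)
            ({hr X N r t | r t. long_root X r \<and> t \<in> K \<and> t \<noteq> 0}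
             \<union> {hr X N r t | r t. short_root X r \<and> t \<noteq> 0})
          \<longleftrightarrow> (X = TG2 \<or> X = TF4 \<or> (\<exists>n. X = TB n \<and> odd n)))
       \<and> ((X = TG2 \<or> X = TF4 \<or> (\<exists>n. X = TB n \<and> odd n)) \<longrightarrow>
          XKL X N K = generate (GLie X)
            ({ur X N r s | r s. long_root X r \<and> s \<in> K} \<union> {ur X N r t | r t. short_root X r}))"
proof -
  obtain x where x: "x \<notin> K" using assms(4) by blast
  have mixed: "mixed X p m N K" if "rootdata X p m" for p m
  proof -
    interpret rootdata X p m by fact
    have nat: "nat p = charp X" using charp_eq by linarith
    have p: "of_int p = (0 :: 'a)" using assms(5) charp_eq by (metis of_int_of_nat_eq)
    show ?thesis using assms(2,3,6) p nat by unfold_locales auto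
  qed
  let ?good = "X = TG2 \<or> X = TF4 \<or> (\<exists>n. X = TB n \<and> odd n)"
  have "(TKL X N K = generate (GLie X) (mixed_torus_gens X N K) \<longleftrightarrow> ?good)
      \<and> (?good \<longrightarrow> XKL X N K = generate (GLie X) (mixed_root_gens X N K))"
  proof (cases X)
    case (TB n)
    then have "n \<ge> 2" using assms(1) by simp
    then have M: "mixed (TB n) 2 1 N K" using mixed rootdata_TB TB by blast
    show ?thesis
    proof (cases "odd n")
      case True
      then show ?thesis using TKL_TB_odd[OF M True \<open>n \<ge> 2\<close>] mixed.XKL_generated[OF M] TB by simp
    next
      \<comment> \<open>This contains n = 2, where B_2 and C_2 are the same system up to scaling and
        the two negative answers agree.\<close>
      case False
      then show ?thesis using TKL_TB_even[OF M _ \<open>n \<ge> 2\<close> x] TB by simp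
    qed
  next
    case (TC n)
    then have "n \<ge> 2" using assms(1) by simp
    then have M: "mixed (TC n) 2 2 N K" using mixed rootdata_TC TC by blast
    show ?thesis using TKL_TC[OF M \<open>n \<ge> 2\<close> x] TC by simp
  next
    case TF4
    then have M: "mixed TF4 2 4 N K" using mixed rootdata_TF4 by blast
    show ?thesis using TKL_TF4[OF M] mixed.XKL_generated[OF M] TF4 by simp
  next
    case TG2
    then have M: "mixed TG2 3 2 N K" using mixed rootdata_TG2 by blast
    show ?thesis using TKL_TG2[OF M] mixed.XKL_generated[OF M] TG2 by simp
  qed
  then show ?thesis unfolding mixed_torus_gens_def mixed_root_gens_def .
qed

end
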